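(* In $L^2(\mathbb{R})$ let $A$ be the operator $$(Ay)(x)=(\operatorname{sgn}x)\left(-y''(x)+6\,\frac{x^4-6|x|}{(|x|^3+3)^2}\,y(x)\right),\qquad \operatorname{dom}(A)=W_2^2(\mathbb{R}),$$ where $W_2^2(\mathbb{R})$ is the Sobolev space. Then: (i) $A$ has a real spectrum, $\sigma(A)\subset\mathbb{R}$; (ii) $0$ is a simple eigenvalue of $A$; (iii) $A$ is not similar to a self-adjoint operator.
   Context: An eigenvalue $\lambda$ of an operator $T$ is simple if $\dim\ker(T-\lambda)=1$ and $\ker(T-\lambda)=\ker(T-\lambda)^2$. Two closed operators $T_1,T_2$ in a Hilbert space $\mathfrak{H}$ are similar if there is a bounded operator $S$ with bounded inverse on $\mathfrak{H}$ such that $S\operatorname{dom}(T_1)=\operatorname{dom}(T_2)$ and $T_2=ST_1S^{-1}$. *)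

theory Defs
  imports "HOL-Analysis.Analysis"
begin

section \<open>Complex Hilbert spaces\<close>

text \<open>The inner product is linear in its first argument; \<^const>\<open>inner\<close>, and hence norm and
  topology, are those of the underlying real inner product space.\<close>

class complex_inner = real_inner +
  fixes scaleC :: "complex \<Rightarrow> 'a \<Rightarrow> 'a" (infixr "*\<^sub>C" 75)
    and cinner :: "'a \<Rightarrow> 'a \<Rightarrow> complex"
  assumes scaleC_add_right: "c *\<^sub>C (x + y) = c *\<^sub>C x + c *\<^sub>C y"
    and scaleC_add_left: "(c + d) *\<^sub>C x = c *\<^sub>C x + d *\<^sub>C x"
    and scaleC_scaleC: "c *\<^sub>C d *\<^sub>C x = (c * d) *\<^sub>C x"
    and scaleC_one: "1 *\<^sub>C x = x"
    and scaleR_scaleC: "r *\<^sub>R x = complex_of_real r *\<^sub>C x"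
    and cinner_commute: "cinner x y = cnj (cinner y x)"
    and cinner_add_left: "cinner (x + y) z = cinner x z + cinner y z"
    and cinner_scaleC_left: "cinner (c *\<^sub>C x) y = c * cinner x y"
    and inner_cinner: "inner x y = Re (cinner x y)"

class complex_hilbert = complex_inner + complete_space

global_interpretation complex_vector: vector_space "scaleC :: complex \<Rightarrow> 'a \<Rightarrow> 'a::complex_inner"
  defines cdim = complex_vector.dim
  by unfold_locales
    (simp_all add: scaleC_add_right scaleC_add_left scaleC_scaleC scaleC_one)

definition bounded_clinear :: "('a::complex_inner \<Rightarrow> 'b::complex_inner) \<Rightarrow> bool" where
  "bounded_clinear S \<longleftrightarrow> bounded_linear S \<and> (\<forall>c x. S (c *\<^sub>C x) = c *\<^sub>C S x)"


section \<open>Unbounded operators\<close>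

text \<open>An operator \<open>T\<close> in a Hilbert space is represented by its graph, so that its domain is
  \<^term>\<open>Domain T\<close> and products of operators are relational compositions.\<close>

definition linear_operator :: "('a::complex_hilbert \<times> 'a) set \<Rightarrow> bool" where
  "linear_operator T \<longleftrightarrow>
     single_valued T \<and> (0, 0) \<in> T \<and>
     (\<forall>x y u v. (x, u) \<in> T \<longrightarrow> (y, v) \<in> T \<longrightarrow> (x + y, u + v) \<in> T) \<and>
     (\<forall>c x u. (x, u) \<in> T \<longrightarrow> (c *\<^sub>C x, c *\<^sub>C u) \<in> T)"

definition adjoint_operator :: "('a::complex_hilbert \<times> 'a) set \<Rightarrow> ('a \<times> 'a) set" where
  "adjoint_operator T = {(u, v). \<forall>(x, y) \<in> T. cinner y u = cinner x v}"

definition self_adjoint :: "('a::complex_hilbert \<times> 'a) set \<Rightarrow> bool" where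
  "self_adjoint T \<longleftrightarrow>
     linear_operator T \<and> closure (Domain T) = UNIV \<and> adjoint_operator T = T"

text \<open>The operator \<open>T - z\<close>.\<close>

definition op_shift :: "('a::complex_hilbert \<times> 'a) set \<Rightarrow> complex \<Rightarrow> ('a \<times> 'a) set" where
  "op_shift T z = {(x, y - z *\<^sub>C x) | x y. (x, y) \<in> T}"

definition op_kernel :: "('a::complex_hilbert \<times> 'a) set \<Rightarrow> 'a set" where
  "op_kernel T = {x. (x, 0) \<in> T}"

text \<open>\<open>z\<close> belongs to the resolvent set iff \<open>T - z\<close> has a bounded, everywhere defined inverse.\<close>

definition resolvent_set :: "('a::complex_hilbert \<times> 'a) set \<Rightarrow> complex set" where
  "resolvent_set T = {z. \<exists>R. bounded_clinear R \<and> (op_shift T z)\<inverse> = {(y, R y) | y. True}}"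

definition spectrum :: "('a::complex_hilbert \<times> 'a) set \<Rightarrow> complex set" where
  "spectrum T = - resolvent_set T"

definition simple_eigenvalue :: "('a::complex_hilbert \<times> 'a) set \<Rightarrow> complex \<Rightarrow> bool" where
  "simple_eigenvalue T z \<longleftrightarrow>
     cdim (op_kernel (op_shift T z)) = 1 \<and>
     op_kernel (op_shift T z) = op_kernel (op_shift T z O op_shift T z)"

text \<open>\<open>S'\<close> is the inverse of \<open>S\<close>, and the last line says \<open>T\<^sub>2 = S T\<^sub>1 S\<^sup>-\<^sup>1\<close>.  Closedness is not part
  of the relation: an operator that is similar to a closed one is itself closed, and
  self-adjoint operators are closed.\<close>

definition similar_operators ::
    "('a::complex_hilbert \<times> 'a) set \<Rightarrow> ('a \<times> 'a) set \<Rightarrow> bool" where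
  "similar_operators T\<^sub>1 T\<^sub>2 \<longleftrightarrow>
     (\<exists>S S'. bounded_clinear S \<and> bounded_clinear S' \<and>
        (\<forall>x. S' (S x) = x) \<and> (\<forall>x. S (S' x) = x) \<and>
        S ` Domain T\<^sub>1 = Domain T\<^sub>2 \<and>
        T\<^sub>2 = {(x, S y) | x y. (S' x, y) \<in> T\<^sub>1})"


section \<open>The space of square-integrable functions on the real line\<close>

text \<open>Every Lebesgue measurable function agrees almost everywhere with a Borel measurable one,
  so the classes modulo null sets may be formed with Borel representatives.\<close>

definition square_integrable :: "(real \<Rightarrow> complex) \<Rightarrow> bool" where
  "square_integrable f \<longleftrightarrow>
     f \<in> borel_measurable lborel \<and> integrable lborel (\<lambda>x. (cmod (f x))\<^sup>2)"

definition eq_L2 :: "(real \<Rightarrow> complex) \<Rightarrow> (real \<Rightarrow> complex) \<Rightarrow> bool" where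
  "eq_L2 f g \<longleftrightarrow> square_integrable f \<and> square_integrable g \<and> (AE x in lborel. f x = g x)"

lemma borel_measurable_cnj [measurable (raw)]:
  "f \<in> borel_measurable M \<Longrightarrow> (\<lambda>x. cnj (f x)) \<in> borel_measurable M"
  by (rule borel_measurable_continuous_on[where f = cnj]) (intro continuous_intros)

lemma square_integrable_0: "square_integrable (\<lambda>x. 0)"
  by (simp add: square_integrable_def)

lemma square_integrable_measurable [measurable_dest]:
  "square_integrable f \<Longrightarrow> f \<in> borel_measurable lborel"
  by (simp add: square_integrable_def)

lemma square_integrable_add:
  assumes "square_integrable f" "square_integrable g"
  shows "square_integrable (\<lambda>x. f x + g x)"
proof -
  have [measurable]: "f \<in> borel_measurable borel" "g \<in> borel_measurable borel"
    using assms by (auto simp: square_integrable_def)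
  have "integrable lborel (\<lambda>x. 2 * (cmod (f x))\<^sup>2 + 2 * (cmod (g x))\<^sup>2)"
    using assms by (auto simp: square_integrable_def)
  then have "integrable lborel (\<lambda>x. (cmod (f x + g x))\<^sup>2)"
  proof (rule Bochner_Integration.integrable_bound)
    show "AE x in lborel. norm ((cmod (f x + g x))\<^sup>2)
        \<le> norm (2 * (cmod (f x))\<^sup>2 + 2 * (cmod (g x))\<^sup>2)"
    proof (rule AE_I2)
      fix x
      have "(cmod (f x + g x))\<^sup>2 \<le> (cmod (f x) + cmod (g x))\<^sup>2"
        by (intro power_mono norm_triangle_ineq) auto
      also have "\<dots> \<le> 2 * (cmod (f x))\<^sup>2 + 2 * (cmod (g x))\<^sup>2"
        using sum_squares_bound[of "cmod (f x)" "cmod (g x)"] by (simp add: power2_sum)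
      finally show "norm ((cmod (f x + g x))\<^sup>2)
          \<le> norm (2 * (cmod (f x))\<^sup>2 + 2 * (cmod (g x))\<^sup>2)"
        by simp
    qed
  qed simp
  then show ?thesis
    by (simp add: square_integrable_def)
qed

lemma square_integrable_scale:
  "square_integrable f \<Longrightarrow> square_integrable (\<lambda>x. c * f x)"
  by (auto simp: square_integrable_def norm_mult power_mult_distrib)

lemma square_integrable_minus:
  "square_integrable f \<Longrightarrow> square_integrable (\<lambda>x. - f x)"
  using square_integrable_scale[of f "-1"] by simp

lemma square_integrable_diff:
  "square_integrable f \<Longrightarrow> square_integrable g \<Longrightarrow> square_integrable (\<lambda>x. f x - g x)"
  using square_integrable_add[of f "\<lambda>x. - g x"] square_integrable_minus[of g] by simp

lemma integrable_mult_cnj: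
  assumes "square_integrable f" "square_integrable g"
  shows "integrable lborel (\<lambda>x. f x * cnj (g x))"
proof -
  have [measurable]: "f \<in> borel_measurable borel" "g \<in> borel_measurable borel"
    using assms by (auto simp: square_integrable_def)
  have "integrable lborel (\<lambda>x. (cmod (f x))\<^sup>2 + (cmod (g x))\<^sup>2)"
    using assms by (auto simp: square_integrable_def)
  then show ?thesis
  proof (rule Bochner_Integration.integrable_bound)
    show "(\<lambda>x. f x * cnj (g x)) \<in> borel_measurable lborel"
      by measurable
    show "AE x in lborel. norm (f x * cnj (g x)) \<le> norm ((cmod (f x))\<^sup>2 + (cmod (g x))\<^sup>2)"
    proof (rule AE_I2)
      fix x
      have "0 \<le> cmod (f x) * cmod (g x)"
        by simp
      then have "cmod (f x) * cmod (g x) \<le> (cmod (f x))\<^sup>2 + (cmod (g x))\<^sup>2"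
        using sum_squares_bound[of "cmod (f x)" "cmod (g x)"] by linarith
      then show "norm (f x * cnj (g x)) \<le> norm ((cmod (f x))\<^sup>2 + (cmod (g x))\<^sup>2)"
        by (simp add: norm_mult)
    qed
  qed
qed

lemma part_equivp_eq_L2: "part_equivp eq_L2"
proof (rule part_equivpI)
  show "\<exists>x. eq_L2 x x"
    using square_integrable_0 by (auto simp: eq_L2_def)
  show "symp eq_L2"
    by (auto simp: symp_def eq_L2_def elim!: AE_mp)
  show "transp eq_L2"
    by (auto simp: transp_def eq_L2_def elim!: AE_mp)
qed

quotient_type L2 = "real \<Rightarrow> complex" / partial: eq_L2
  by (rule part_equivp_eq_L2)

instantiation L2 :: real_vector
begin

lift_definition zero_L2 :: L2 is "\<lambda>x. 0"
  by (simp add: eq_L2_def square_integrable_0)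

lift_definition plus_L2 :: "L2 \<Rightarrow> L2 \<Rightarrow> L2" is "\<lambda>f g x. f x + g x"
  by (auto simp: eq_L2_def square_integrable_add)

lift_definition minus_L2 :: "L2 \<Rightarrow> L2 \<Rightarrow> L2" is "\<lambda>f g x. f x - g x"
  by (auto simp: eq_L2_def square_integrable_diff)

lift_definition uminus_L2 :: "L2 \<Rightarrow> L2" is "\<lambda>f x. - f x"
  by (auto simp: eq_L2_def square_integrable_minus)

lift_definition scaleR_L2 :: "real \<Rightarrow> L2 \<Rightarrow> L2" is "\<lambda>r f x. complex_of_real r * f x"
  by (auto simp: eq_L2_def square_integrable_scale)

instance
proof
  fix f g h :: L2 and a b :: real
  show "f + g + h = f + (g + h)"
    by transfer (simp add: eq_L2_def square_integrable_add add.assoc)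
  show "f + g = g + f"
    by transfer (simp add: eq_L2_def square_integrable_add add.commute)
  show "0 + f = f"
    by transfer (simp add: eq_L2_def)
  show "- f + f = 0"
    by transfer (simp add: eq_L2_def square_integrable_0)
  show "f - g = f + - g"
    by transfer (simp add: eq_L2_def square_integrable_diff)
  show "a *\<^sub>R (f + g) = a *\<^sub>R f + a *\<^sub>R g"
    by transfer (simp add: eq_L2_def square_integrable_add square_integrable_scale distrib_left)
  show "(a + b) *\<^sub>R f = a *\<^sub>R f + b *\<^sub>R f"
    by transfer (simp add: eq_L2_def square_integrable_add square_integrable_scale distrib_right)
  show "a *\<^sub>R b *\<^sub>R f = (a * b) *\<^sub>R f"
    by transfer (simp add: eq_L2_def square_integrable_scale mult.assoc)
  show "1 *\<^sub>R f = f"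
    by transfer (simp add: eq_L2_def)
qed

end

instantiation L2 :: complex_inner
begin

lift_definition scaleC_L2 :: "complex \<Rightarrow> L2 \<Rightarrow> L2" is "\<lambda>c f x. c * f x"
  by (auto simp: eq_L2_def square_integrable_scale)

lift_definition cinner_L2 :: "L2 \<Rightarrow> L2 \<Rightarrow> complex" is
  "\<lambda>f g. LINT x|lborel. f x * cnj (g x)"
  by (auto simp: eq_L2_def square_integrable_def intro!: integral_cong_AE borel_measurable_times borel_measurable_cnj)

definition inner_L2 :: "L2 \<Rightarrow> L2 \<Rightarrow> real" where
  "inner_L2 f g = Re (cinner f g)"

definition norm_L2 :: "L2 \<Rightarrow> real" where
  "norm_L2 f = sqrt (inner f f)"

definition sgn_L2 :: "L2 \<Rightarrow> L2" where
  "sgn_L2 f = inverse (norm f) *\<^sub>R f"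

definition dist_L2 :: "L2 \<Rightarrow> L2 \<Rightarrow> real" where
  "dist_L2 f g = norm (f - g)"

definition uniformity_L2 :: "(L2 \<times> L2) filter" where
  "uniformity_L2 = (INF e\<in>{0 <..}. principal {(f, g). dist f g < e})"

definition open_L2 :: "L2 set \<Rightarrow> bool" where
  "open_L2 U \<longleftrightarrow> (\<forall>f\<in>U. \<forall>\<^sub>F (f', g) in uniformity. f' = f \<longrightarrow> g \<in> U)"

instance
proof
  fix f g h :: L2 and c d :: complex and r :: real
  show commute: "cinner f g = cnj (cinner g f)" for f g :: L2
    by transfer (subst Bochner_Integration.integral_cnj[symmetric], simp add: mult.commute)
  show add: "cinner (f + g) h = cinner f h + cinner g h" for f g h :: L2
    by transfer (simp add: eq_L2_def distrib_right integrable_mult_cnj)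
  show scale: "cinner (c *\<^sub>C f) g = c * cinner f g" for c and f g :: L2
    by transfer (simp add: mult.assoc)
  show "c *\<^sub>C (f + g) = c *\<^sub>C f + c *\<^sub>C g"
    by transfer (auto simp: eq_L2_def distrib_left
        intro!: square_integrable_add square_integrable_scale)
  show "(c + d) *\<^sub>C f = c *\<^sub>C f + d *\<^sub>C f"
    by transfer (auto simp: eq_L2_def distrib_right
        intro!: square_integrable_add square_integrable_scale)
  show "c *\<^sub>C d *\<^sub>C f = (c * d) *\<^sub>C f"
    by transfer (auto simp: eq_L2_def mult.assoc intro!: square_integrable_scale)
  show "1 *\<^sub>C f = f"
    by transfer (auto simp: eq_L2_def)
  show scaleR: "r *\<^sub>R f = complex_of_real r *\<^sub>C f" for r and f :: L2
    by transfer (auto simp: eq_L2_def intro!: square_integrable_scale)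
  show "inner f g = Re (cinner f g)"
    by (fact inner_L2_def)
  show "inner f g = inner g f"
    using commute[of f g] by (simp add: inner_L2_def)
  show "inner (f + g) h = inner f h + inner g h"
    by (simp add: inner_L2_def add)
  show "inner (r *\<^sub>R f) g = r * inner f g"
    by (simp add: inner_L2_def scaleR scale)
  have cinner_self: "cinner f f = 0 \<longleftrightarrow> f = 0" "0 \<le> Re (cinner f f)" "Im (cinner f f) = 0"
    for f :: L2
  proof -
    have self: "(LINT x|lborel. k x * cnj (k x)) = complex_of_real (LINT x|lborel. (cmod (k x))\<^sup>2)"
      for k
      by (simp add: complex_norm_square[symmetric] flip: of_real_power)
    show "cinner f f = 0 \<longleftrightarrow> f = 0"
    proof transfer
      fix k assume k: "eq_L2 k k"
      have "(LINT x|lborel. (cmod (k x))\<^sup>2) = 0 \<longleftrightarrow> (AE x in lborel. (cmod (k x))\<^sup>2 = 0)"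
        using k by (intro integral_nonneg_eq_0_iff_AE) (auto simp: eq_L2_def square_integrable_def)
      then show "(LINT x|lborel. k x * cnj (k x)) = 0 \<longleftrightarrow> eq_L2 k (\<lambda>x. 0)"
        using k by (auto simp: self eq_L2_def square_integrable_0)
    qed
    show "0 \<le> Re (cinner f f)"
      by transfer (simp add: self)
    show "Im (cinner f f) = 0"
      by transfer (simp add: self)
  qed
  show "0 \<le> inner f f"
    by (simp add: inner_L2_def cinner_self)
  show "inner f f = 0 \<longleftrightarrow> f = 0"
    using cinner_self[of f] by (simp add: inner_L2_def complex_eq_iff)
qed (fact norm_L2_def sgn_L2_def dist_L2_def uniformity_L2_def open_L2_def)+

end

lemma square_integrable_rep: "square_integrable (rep_L2 f)"
  using Quotient_rep_reflp[OF Quotient_L2, of f] by (simp add: eq_L2_def)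

lemma rep_L2_abs_L2: "square_integrable f \<Longrightarrow> AE x in lborel. rep_L2 (abs_L2 f) x = f x"
  using Quotient_rep_abs[OF Quotient_L2, of f] by (simp add: eq_L2_def)

lemma abs_L2_rep_L2: "abs_L2 (rep_L2 f) = f"
  by (rule Quotient_abs_rep[OF Quotient_L2])

lemma abs_L2_eqI:
  "square_integrable f \<Longrightarrow> square_integrable g \<Longrightarrow> AE x in lborel. f x = g x \<Longrightarrow> abs_L2 f = abs_L2 g"
  by (intro Quotient_rel_abs[OF Quotient_L2]) (simp add: eq_L2_def)

lemma minus_abs_L2:
  "square_integrable f \<Longrightarrow> square_integrable g \<Longrightarrow> abs_L2 f - abs_L2 g = abs_L2 (\<lambda>x. f x - g x)"
  by (rule minus_L2.abs_eq) (simp_all add: eq_L2_def)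

lemma norm_abs_L2:
  assumes "square_integrable f"
  shows "(\<integral>\<^sup>+x. ennreal ((cmod (f x))\<^sup>2) \<partial>lborel) = ennreal ((norm (abs_L2 f))\<^sup>2)"
proof -
  have "cinner (abs_L2 f) (abs_L2 f) = (LINT x|lborel. f x * cnj (f x))"
    using assms by (intro cinner_L2.abs_eq) (simp_all add: eq_L2_def)
  also have "\<dots> = complex_of_real (LINT x|lborel. (cmod (f x))\<^sup>2)"
    by (simp add: complex_norm_square[symmetric] flip: of_real_power)
  finally have "(norm (abs_L2 f))\<^sup>2 = (LINT x|lborel. (cmod (f x))\<^sup>2)"
    by (simp add: power2_norm_eq_inner inner_cinner)
  then show ?thesis
    using assms by (subst nn_integral_eq_integral) (auto simp: square_integrable_def)
qed

lemma square_integrable_nn_integral_finite: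
  assumes "f \<in> borel_measurable lborel"
    and "(\<integral>\<^sup>+x. ennreal ((cmod (f x))\<^sup>2) \<partial>lborel) < \<infinity>"
  shows "square_integrable f"
  using assms by (auto simp: square_integrable_def intro!: integrableI_nonneg)

instance L2 :: complex_hilbert
proof
  fix X :: "nat \<Rightarrow> L2"
  assume X: "Cauchy X"
  have "\<exists>r. strict_mono r \<and> (\<forall>n. dist (X (r (Suc n))) (X (r n)) < (1 / 2) ^ n)"
  proof -
    have "\<exists>N. \<forall>m\<ge>N. \<forall>k\<ge>N. dist (X m) (X k) < (1 / 2) ^ n" for n :: nat
      using X by (intro metric_CauchyD) auto
    then obtain N where N: "\<And>n m k. m \<ge> N n \<Longrightarrow> k \<ge> N n \<Longrightarrow> dist (X m) (X k) < (1 / 2) ^ n"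
      by metis
    define r where "r = rec_nat (N 0) (\<lambda>n m. max (Suc m) (N (Suc n)))"
    have r_Suc: "r (Suc n) = max (Suc (r n)) (N (Suc n))" for n
      by (simp add: r_def)
    have r_N: "N n \<le> r n" for n
      by (cases n) (simp_all add: r_def)
    have "strict_mono r"
      by (rule strict_mono_Suc_iff[THEN iffD2]) (simp add: r_Suc less_max_iff_disj)
    moreover have "N n \<le> r (Suc n)" for n
      using r_N[of n] r_Suc[of n] by linarith
    ultimately show ?thesis
      using N r_N by blast
  qed
  then obtain r where r: "strict_mono r"
    and r_dist: "\<And>n. dist (X (r (Suc n))) (X (r n)) < (1 / 2) ^ n"
    by blast
  define g where "g n = rep_L2 (X (r n))" for n
  have g: "square_integrable (g n)" for n
    by (simp add: g_def square_integrable_rep)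
  have X_g: "X (r n) = abs_L2 (g n)" for n
    by (simp add: g_def abs_L2_rep_L2)
  have [measurable]: "g n \<in> borel_measurable borel" for n
    using g[of n] by (simp add: square_integrable_def)
  have norm_g: "(\<integral>\<^sup>+x. ennreal ((cmod (g m x - g n x))\<^sup>2) \<partial>lborel)
      = ennreal ((dist (X (r m)) (X (r n)))\<^sup>2)" for m n
    using norm_abs_L2[OF square_integrable_diff[OF g[of m] g[of n]]]
    by (simp add: dist_norm X_g minus_abs_L2 g)
  define d where "d n x = 2 ^ n * (cmod (g (Suc n) x - g n x))\<^sup>2" for n x
  have [measurable]: "d n \<in> borel_measurable borel" for n
    unfolding d_def by measurable
  have d_nonneg: "0 \<le> d n x" for n x
    by (simp add: d_def)
  have "(\<integral>\<^sup>+x. ennreal (d n x) \<partial>lborel) \<le> ennreal ((1 / 2) ^ n)" for n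
  proof -
    have "(\<integral>\<^sup>+x. ennreal (d n x) \<partial>lborel)
        = ennreal (2 ^ n) * (\<integral>\<^sup>+x. ennreal ((cmod (g (Suc n) x - g n x))\<^sup>2) \<partial>lborel)"
      by (subst nn_integral_cmult[symmetric]) (auto simp: d_def ennreal_mult)
    also have "\<dots> = ennreal (2 ^ n * (dist (X (r (Suc n))) (X (r n)))\<^sup>2)"
      by (simp add: norm_g ennreal_mult)
    also have "\<dots> \<le> ennreal (2 ^ n * ((1 / 2) ^ n)\<^sup>2)"
      using less_imp_le[OF r_dist[of n]] by (intro ennreal_leI mult_left_mono power_mono) auto
    also have "2 ^ n * ((1 / 2) ^ n)\<^sup>2 = (1 / 2 :: real) ^ n"
      by (simp add: power2_eq_square power_divide)
    finally show ?thesis .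
  qed
  then have "(\<Sum>n. \<integral>\<^sup>+x. ennreal (d n x) \<partial>lborel) \<le> (\<Sum>n. ennreal ((1 / 2) ^ n))"
    by (intro suminf_le) auto
  also have "\<dots> < \<infinity>"
    by (subst suminf_ennreal2) (auto intro!: summable_geometric)
  finally have "(\<integral>\<^sup>+x. (\<Sum>n. ennreal (d n x)) \<partial>lborel) < \<infinity>"
    by (subst nn_integral_suminf) auto
  then have "AE x in lborel. (\<Sum>n. ennreal (d n x)) \<noteq> \<infinity>"
    by (intro nn_integral_PInf_AE) auto
  then have conv: "AE x in lborel. convergent (\<lambda>n. g n x)"
  proof (rule AE_mp, intro AE_I2 impI)
    fix x
    assume "(\<Sum>n. ennreal (d n x)) \<noteq> \<infinity>"
    then have "summable (\<lambda>n. d n x)"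
      using d_nonneg by (intro summable_suminf_not_top) auto
    then have "bounded (range (\<lambda>n. d n x))"
      by (intro convergent_imp_bounded[OF summable_LIMSEQ_zero])
    then obtain B where B: "\<And>n. d n x \<le> B"
      unfolding bounded_iff by (metis abs_le_D1 rangeI real_norm_def)
    have B_nonneg: "0 \<le> B"
      using B[of 0] d_nonneg[of 0 x] by linarith
    define q :: real where "q = sqrt (1 / 2)"
    have q: "0 \<le> q" "q < 1" "q\<^sup>2 = 1 / 2"
      by (simp_all add: q_def)
    have le: "cmod (g (Suc n) x - g n x) \<le> sqrt B * q ^ n" for n
    proof (rule power2_le_imp_le)
      have "(cmod (g (Suc n) x - g n x))\<^sup>2 = d n x * (1 / 2) ^ n"
        by (simp add: d_def power_divide)
      also have "\<dots> \<le> B * (1 / 2) ^ n"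
        by (intro mult_right_mono B) simp
      also have "\<dots> = (sqrt B)\<^sup>2 * (q\<^sup>2) ^ n"
        using B_nonneg by (simp only: q real_sqrt_pow2)
      also have "\<dots> = (sqrt B * q ^ n)\<^sup>2"
        by (simp only: power_mult_distrib power_mult[symmetric] mult.commute[of n 2])
      finally show "(cmod (g (Suc n) x - g n x))\<^sup>2 \<le> (sqrt B * q ^ n)\<^sup>2" .
      show "0 \<le> sqrt B * q ^ n"
        using B_nonneg q(1) by simp
    qed
    have "summable (\<lambda>n. sqrt B * q ^ n)"
      using q by (intro summable_mult summable_geometric) simp
    then have "summable (\<lambda>n. g (Suc n) x - g n x)"
      by (rule summable_comparison_test') (rule le)
    then have "convergent (\<lambda>n. \<Sum>k<n. g (Suc k) x - g k x)"
      by (simp add: summable_iff_convergent)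
    then have "convergent (\<lambda>n. g n x - g 0 x)"
      using sum_lessThan_telescope[of "\<lambda>n. g n x"] by simp
    then have "convergent (\<lambda>n. (g n x - g 0 x) + g 0 x)"
      by (intro convergent_add convergent_const)
    then show "convergent (\<lambda>n. g n x)"
      by simp
  qed
  define f where "f x = lim (\<lambda>n. g n x)" for x
  have [measurable]: "f \<in> borel_measurable borel"
    unfolding f_def by measurable
  have lim: "AE x in lborel. (\<lambda>n. g n x) \<longlonglongrightarrow> f x"
    using conv by eventually_elim (simp add: f_def convergent_LIMSEQ_iff)
  have bound: "(\<integral>\<^sup>+x. ennreal ((cmod (f x - g m x))\<^sup>2) \<partial>lborel) \<le> ennreal (e\<^sup>2)"
    if e: "0 < e" and m: "\<And>n. n \<ge> m \<Longrightarrow> dist (X (r n)) (X (r m)) < e" for e m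
  proof -
    have "(\<integral>\<^sup>+x. ennreal ((cmod (f x - g m x))\<^sup>2) \<partial>lborel)
        = (\<integral>\<^sup>+x. liminf (\<lambda>n. ennreal ((cmod (g n x - g m x))\<^sup>2)) \<partial>lborel)"
    proof (rule nn_integral_cong_AE)
      show "AE x in lborel. ennreal ((cmod (f x - g m x))\<^sup>2)
          = liminf (\<lambda>n. ennreal ((cmod (g n x - g m x))\<^sup>2))"
        using lim
      proof eventually_elim
        case (elim x)
        then have "(\<lambda>n. ennreal ((cmod (g n x - g m x))\<^sup>2))
            \<longlonglongrightarrow> ennreal ((cmod (f x - g m x))\<^sup>2)"
          by (intro tendsto_intros) auto
        then show ?case
          by (rule lim_imp_Liminf[OF sequentially_bot, symmetric])
      qed
    qed
    also have "\<dots> \<le> liminf (\<lambda>n. \<integral>\<^sup>+x. ennreal ((cmod (g n x - g m x))\<^sup>2) \<partial>lborel)"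
      by (rule nn_integral_liminf) auto
    also have "\<dots> \<le> ennreal (e\<^sup>2)"
    proof (rule Liminf_le)
      show "\<forall>\<^sub>F n in sequentially.
          (\<integral>\<^sup>+x. ennreal ((cmod (g n x - g m x))\<^sup>2) \<partial>lborel) \<le> ennreal (e\<^sup>2)"
        using eventually_ge_at_top[of m]
        by eventually_elim
          (auto simp: norm_g intro!: ennreal_leI power_mono less_imp_le[OF m])
    qed simp
    finally show ?thesis .
  qed
  have cauchy: "\<exists>M. \<forall>m\<ge>M. \<forall>n\<ge>M. dist (X (r m)) (X (r n)) < e" if "0 < e" for e
    using metric_CauchyD[OF Cauchy_subseq_Cauchy[OF X r] that] by simp
  have f: "square_integrable f"
  proof -
    obtain M where "\<forall>m\<ge>M. \<forall>n\<ge>M. dist (X (r m)) (X (r n)) < 1"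
      using cauchy[of 1] by auto
    then have "(\<integral>\<^sup>+x. ennreal ((cmod (f x - g M x))\<^sup>2) \<partial>lborel) \<le> ennreal (1\<^sup>2)"
      by (intro bound) auto
    then have "(\<integral>\<^sup>+x. ennreal ((cmod (f x - g M x))\<^sup>2) \<partial>lborel) < \<infinity>"
      by (rule le_less_trans) simp
    then have "square_integrable (\<lambda>x. f x - g M x)"
      by (intro square_integrable_nn_integral_finite) auto
    from square_integrable_add[OF this g[of M]] show ?thesis
      by simp
  qed
  have "(\<lambda>n. X (r n)) \<longlonglongrightarrow> abs_L2 f"
  proof (rule metric_LIMSEQ_I)
    fix e :: real
    assume e: "0 < e"
    then obtain M where M: "\<forall>m\<ge>M. \<forall>n\<ge>M. dist (X (r m)) (X (r n)) < e / 2"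
      using cauchy[of "e / 2"] by auto
    have "dist (X (r m)) (abs_L2 f) < e" if "m \<ge> M" for m
    proof -
      have "ennreal ((norm (abs_L2 f - X (r m)))\<^sup>2) \<le> ennreal ((e / 2)\<^sup>2)"
        using bound[of "e / 2" m] M e that
          norm_abs_L2[OF square_integrable_diff[OF f g[of m]]]
        by (simp add: X_g minus_abs_L2 f g)
      then have "(norm (abs_L2 f - X (r m)))\<^sup>2 \<le> (e / 2)\<^sup>2"
        by (simp add: ennreal_le_iff)
      then have "norm (abs_L2 f - X (r m)) \<le> e / 2"
        by (rule power2_le_imp_le) (use e in auto)
      then show ?thesis
        using e by (simp add: dist_norm norm_minus_commute)
    qed
    then show "\<exists>M. \<forall>m\<ge>M. dist (X (r m)) (abs_L2 f) < e"
      by blast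
  qed
  then have "X \<longlonglongrightarrow> abs_L2 f"
    using Cauchy_converges_subseq[OF X r] by (simp add: o_def)
  then show "convergent X"
    by (rule convergentI)
qed


section \<open>Sobolev spaces and the operator\<close>

definition test_function :: "(real \<Rightarrow> real) \<Rightarrow> bool" where
  "test_function \<phi> \<longleftrightarrow>
     (\<forall>k x. (deriv ^^ k) \<phi> field_differentiable at x) \<and> compact (closure {x. \<phi> x \<noteq> 0})"

text \<open>\<open>g\<close> is the weak (distributional) derivative of order \<open>k\<close> of \<open>f\<close>.  Real-valued test functions
  suffice, since both sides are linear in \<open>\<phi>\<close>.  Neither this nor the definition of \<open>op_A\<close> below
  depends on the choice of the representatives \<^term>\<open>rep_L2 f\<close>.\<close>

definition has_weak_deriv :: "nat \<Rightarrow> L2 \<Rightarrow> L2 \<Rightarrow> bool" where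
  "has_weak_deriv k f g \<longleftrightarrow>
     (\<forall>\<phi>. test_function \<phi> \<longrightarrow>
        (LINT x|lborel. complex_of_real ((deriv ^^ k) \<phi> x) * rep_L2 f x) =
        (-1) ^ k * (LINT x|lborel. complex_of_real (\<phi> x) * rep_L2 g x))"

definition sobolev :: "nat \<Rightarrow> L2 set" where
  "sobolev m = {f. \<forall>k\<le>m. \<exists>g. has_weak_deriv k f g}"

definition potential :: "real \<Rightarrow> real" where
  "potential x = 6 * (x ^ 4 - 6 * \<bar>x\<bar>) / (\<bar>x\<bar> ^ 3 + 3)\<^sup>2"

text \<open>\<open>y''\<close> is the weak second derivative of \<open>y\<close>, and \<open>z\<close> is \<open>A y\<close>.\<close>

definition op_A :: "(L2 \<times> L2) set" where
  "op_A = {(y, z). y \<in> sobolev 2 \<and>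
     (\<exists>y''. has_weak_deriv 2 y y'' \<and>
        (AE x in lborel. rep_L2 z x =
           complex_of_real (sgn x) *
             (- rep_L2 y'' x + complex_of_real (potential x) * rep_L2 y x)))}"

end

theory Submission
  imports Defs
begin

text \<open>For \<open>x > 0\<close> the potential is \<open>- 2 (log (x ^ 3 + 3))''\<close>, a reflectionless rational potential
  with explicit solutions at every energy.  With \<open>m(k) = \<i> k - 1 / k\<^sup>2\<close> the logarithmic derivative at \<open>0\<close>
  of the Jost solution of \<open>- y'' + q y = k\<^sup>2 y\<close> on the half-line, the Wronskian of the two
  solutions of \<open>A y = z y\<close> that decay at \<open>\<infinity>\<close> and \<open>- \<infinity>\<close> is
  \<open>m(k\<^sub>1) + m(k\<^sub>2) = \<i> (k\<^sub>1 + k\<^sub>2)\<close>, where \<open>k\<^sub>1\<^sup>2 = z\<close>, \<open>k\<^sub>2\<^sup>2 = - z\<close> and both \<open>k\<^sub>j\<close> lie in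
  the upper half-plane.  It does not vanish for nonreal \<open>z\<close>, so Green's function yields a bounded
  resolvent.

  At energy \<open>0\<close> the function \<open>y\<^sub>0 = x / (\<bar>x\<bar> ^ 3 + 3)\<close> spans the kernel, and the only candidates \<open>u\<close>
  for \<open>A u = y\<^sub>0\<close> tend to \<open>1 / 6\<close> or grow at infinity, hence there is no Jordan chain.  But the bounded
  candidate, cut off slowly, shows that \<open>y\<^sub>0\<close> lies in the closure of the range of \<open>A\<close>.  For an operator
  similar to a self-adjoint one, the kernel meets the closure of the range only in \<open>0\<close>.\<close>

text \<open>The form weighted with \<open>sgn\<close>, for which \<open>A\<close> is symmetric, is
  indefinite, so symmetry does not exclude nonreal spectrum and every nonreal \<open>z\<close> needs
  an explicit resolvent. The half-lines see the energies \<open>z\<close> and \<open>- z\<close>;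
  hence the poles of the two logarithmic derivatives are \<open>- 1 / z\<close> and
  \<open>1 / z\<close> and cancel, leaving the Wronskian of the problem without potential. The pole
  of \<open>m\<close> at \<open>k = 0\<close> reflects that the decaying solution of energy
  \<open>0\<close> vanishes at the origin, so that its odd extension is an eigenfunction. Two
  obstacles shape the proof. Elements of the domain are classes with weak derivatives, so arguments
  about differential equations first need a continuously differentiable representative. The factor
  \<open>sgn\<close> jumps at \<open>0\<close>, so second derivatives exist in general only off
  \<open>0\<close>, and the statements about derivatives admit that exceptional point. Decay at
  infinity is never derived pointwise for an unknown solution: a Wronskian that is constant and
  integrable on a half-line must vanish.\<close>

section \<open>Test functions\<close>

text \<open>\<open>test_function\<close> asks that all iterates \<open>(deriv ^^ k) \<phi>\<close>
  be differentiable, a form unsuited to products. Peeling off the first derivative gives an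
  induction in which the function varies, and closure under sums, products and affine substitutions
  follows.\<close>

primrec differentiable_times :: "nat \<Rightarrow> (real \<Rightarrow> real) \<Rightarrow> bool" where
  "differentiable_times 0 f \<longleftrightarrow> True"
| "differentiable_times (Suc n) f \<longleftrightarrow>
     (\<forall>x. f field_differentiable at x) \<and> differentiable_times n (deriv f)"

lemma differentiable_times_funpow_deriv:
  "differentiable_times (Suc k) f \<Longrightarrow> (deriv ^^ k) f field_differentiable at x"
proof (induction k arbitrary: f)
  case (Suc k)
  then have "(deriv ^^ k) (deriv f) field_differentiable at x"
    by simp
  then show ?case
    by (simp add: funpow_swap1)
qed simp

lemma differentiable_times_SucD: "differentiable_times (Suc n) f \<Longrightarrow> differentiable_times n f"
  by (induction n arbitrary: f) auto

lemma differentiable_times_SucI: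
  assumes "\<And>x. (f has_field_derivative f' x) (at x)" "differentiable_times n f'"
  shows "differentiable_times (Suc n) f"
proof -
  have "deriv f = f'"
    using assms(1) by (auto intro: DERIV_imp_deriv)
  then show ?thesis
    using assms by (auto simp: field_differentiable_def)
qed

lemma differentiable_times_add:
  "differentiable_times n f \<Longrightarrow> differentiable_times n g \<Longrightarrow> differentiable_times n (\<lambda>x. f x + g x)"
proof (induction n arbitrary: f g)
  case (Suc n)
  show ?case
  proof (rule differentiable_times_SucI)
    show "((\<lambda>x. f x + g x) has_field_derivative deriv f x + deriv g x) (at x)" for x
      using Suc.prems by (intro derivative_intros) (auto simp: DERIV_deriv_iff_field_differentiable)
  qed (use Suc in auto)
qed simp

lemma differentiable_times_mult:
  "differentiable_times n f \<Longrightarrow> differentiable_times n g \<Longrightarrow> differentiable_times n (\<lambda>x. f x * g x)"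
proof (induction n arbitrary: f g)
  case (Suc n)
  show ?case
  proof (rule differentiable_times_SucI)
    show "((\<lambda>x. f x * g x) has_field_derivative f x * deriv g x + deriv f x * g x) (at x)" for x
      using Suc.prems by (intro DERIV_mult') (auto simp: DERIV_deriv_iff_field_differentiable)
    have "differentiable_times n f" "differentiable_times n g"
      using Suc.prems by (auto intro: differentiable_times_SucD simp del: differentiable_times.simps)
    then show "differentiable_times n (\<lambda>x. f x * deriv g x + deriv f x * g x)"
      using Suc by (intro differentiable_times_add Suc.IH) auto
  qed
qed simp

lemma differentiable_times_const: "differentiable_times n (\<lambda>x. c)"
proof (induction n arbitrary: c)
  case (Suc n)
  show ?case
    by (rule differentiable_times_SucI[where f' = "\<lambda>x. 0"]) (auto simp: Suc)
qed simp

lemma differentiable_times_affine: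
  "differentiable_times n f \<Longrightarrow> differentiable_times n (\<lambda>x. f (a * x + b))"
proof (induction n arbitrary: f)
  case (Suc n)
  show ?case
  proof (rule differentiable_times_SucI)
    show "((\<lambda>x. f (a * x + b)) has_field_derivative deriv f (a * x + b) * a) (at x)" for x
      using Suc.prems
      by (intro DERIV_chain2[where f = f]) (auto simp: DERIV_deriv_iff_field_differentiable intro!: derivative_eq_intros)
    show "differentiable_times n (\<lambda>x. deriv f (a * x + b) * a)"
      using Suc by (intro differentiable_times_mult differentiable_times_const) auto
  qed
qed simp

section \<open>Functions flat at the origin and smooth bumps\<close>

definition flat_exp :: "real poly \<Rightarrow> real \<Rightarrow> real" where
  "flat_exp P x = (if 0 < x then poly P (inverse x) * exp (- inverse x) else 0)"

lemma poly_div_exp_tendsto_0: "((\<lambda>y::real. poly P y * exp (- y)) \<longlongrightarrow> 0) at_top"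
proof -
  have "((\<lambda>y. \<Sum>i\<le>degree P. coeff P i * (y ^ i / exp y)) \<longlongrightarrow> (\<Sum>i\<le>degree P. coeff P i * 0)) at_top"
    by (intro tendsto_intros tendsto_power_div_exp_0)
  then show ?thesis
    by (simp add: poly_altdef exp_minus field_simps sum_distrib_left sum_distrib_right sum_divide_distrib)
qed

text \<open>With \<open>y = 1 / x\<close>, the derivative of \<open>P(y) exp (- y)\<close> in
  \<open>x\<close> is \<open>y\<^sup>2 (P(y) - P'(y)) exp (- y)\<close>. The family is thus closed
  under differentiation, which is why a polynomial is carried along: one induction over all
  \<open>P\<close> then gives smoothness.\<close>

lemma flat_exp_has_derivative:
  "(flat_exp P has_field_derivative flat_exp ([:0, 0, 1:] * (P - pderiv P)) x) (at x)"
proof -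
  consider "x < 0" | "x = 0" | "0 < x"
    by linarith
  then show ?thesis
  proof cases
    case 1
    have "((\<lambda>x. 0) has_field_derivative 0) (at x)"
      by simp
    then have "(flat_exp P has_field_derivative 0) (at x)"
      by (rule has_field_derivative_transform_within_open[where S = "{..<0}"])
        (use 1 in \<open>auto simp: flat_exp_def\<close>)
    then show ?thesis
      using 1 by (simp add: flat_exp_def)
  next
    case 2
    have "((\<lambda>h. flat_exp P h / h) \<longlongrightarrow> 0) (at_right 0)"
    proof -
      \<comment> \<open>Dividing by \<open>h\<close> multiplies the polynomial in
        \<open>1 / h\<close> by its variable, so the difference quotient at \<open>0\<close> is
        again a polynomial times a decaying exponential.\<close>
      have "((\<lambda>h. poly (pCons 0 P) (inverse h) * exp (- inverse h)) \<longlongrightarrow> 0) (at_right (0::real))"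
        by (rule filterlim_compose[OF poly_div_exp_tendsto_0 filterlim_inverse_at_top_right])
      then show ?thesis
        by (rule Lim_transform_eventually)
          (auto simp: flat_exp_def eventually_at_filter field_simps)
    qed
    moreover have "((\<lambda>h. flat_exp P h / h) \<longlongrightarrow> 0) (at_left 0)"
      by (rule tendsto_eventually) (auto simp: flat_exp_def eventually_at_filter)
    ultimately have "((\<lambda>h. flat_exp P h / h) \<longlongrightarrow> 0) (at 0)"
      by (simp add: filterlim_split_at)
    then show ?thesis
      using 2 by (simp add: DERIV_def flat_exp_def)
  next
    case 3
    have "((\<lambda>x. poly P (inverse x) * exp (- inverse x)) has_field_derivative
        flat_exp ([:0, 0, 1:] * (P - pderiv P)) x) (at x)"
      using 3 by (auto intro!: derivative_eq_intros DERIV_chain2[OF poly_DERIV]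
          simp: flat_exp_def field_simps power2_eq_square)
    then show ?thesis
      by (rule has_field_derivative_transform_within_open[where S = "{0<..}"])
        (use 3 in \<open>auto simp: flat_exp_def\<close>)
  qed
qed

lemma differentiable_times_flat_exp: "differentiable_times n (flat_exp P)"
proof (induction n arbitrary: P)
  case (Suc n)
  show ?case
    by (rule differentiable_times_SucI[OF flat_exp_has_derivative Suc])
qed simp

text \<open>The factor \<open>Suc n\<close> steepens both flanks:
  \<open>exp (- 1 / ((n + 1) y))\<close> tends to \<open>1\<close> for each \<open>y > 0\<close>.
  The bumps stay between \<open>0\<close> and \<open>1\<close> and tend to the indicator of the open
  interval, as dominated convergence requires.\<close>

definition bump :: "real \<Rightarrow> real \<Rightarrow> nat \<Rightarrow> real \<Rightarrow> real" where
  "bump a b n x = flat_exp 1 (real (Suc n) * (x - a)) * flat_exp 1 (real (Suc n) * (b - x))"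

lemma test_functionI:
  assumes "\<And>n. differentiable_times n \<phi>" "\<And>x. x \<notin> {a..b} \<Longrightarrow> \<phi> x = 0"
  shows "test_function \<phi>"
proof -
  have "{x. \<phi> x \<noteq> 0} \<subseteq> {a..b}"
    using assms(2) by blast
  then have "bounded {x. \<phi> x \<noteq> 0}"
    by (rule bounded_subset[rotated]) simp
  moreover have "(deriv ^^ k) \<phi> field_differentiable at x" for k x
    by (rule differentiable_times_funpow_deriv) (rule assms(1))
  ultimately show ?thesis
    by (simp add: test_function_def)
qed

lemma differentiable_times_bump: "differentiable_times m (bump a b n)"
proof -
  have "bump a b n = (\<lambda>x. flat_exp 1 (real (Suc n) * x + - real (Suc n) * a)
      * flat_exp 1 (- real (Suc n) * x + real (Suc n) * b))"
    by (rule ext) (simp add: bump_def algebra_simps)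
  then show ?thesis
    by (simp only:) (intro differentiable_times_mult differentiable_times_affine differentiable_times_flat_exp)
qed

lemma bump_eq_0: "x \<notin> {a<..<b} \<Longrightarrow> bump a b n x = 0"
  by (auto simp: bump_def flat_exp_def zero_less_mult_iff)

lemma bump_pos: "x \<in> {a<..<b} \<Longrightarrow> 0 < bump a b n x"
  by (auto simp: bump_def flat_exp_def zero_less_mult_iff)

lemma bump_bounds: "0 \<le> bump a b n x" "bump a b n x \<le> 1"
proof -
  have *: "0 \<le> flat_exp 1 y" "flat_exp 1 y \<le> 1" for y
    by (auto simp: flat_exp_def)
  show "0 \<le> bump a b n x" "bump a b n x \<le> 1"
    unfolding bump_def using * by (auto intro!: mult_nonneg_nonneg mult_le_one simp del: of_nat_Suc)
qed

lemma test_function_bump: "test_function (bump a b n)"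
  by (rule test_functionI[where a = a and b = b])
    (auto simp: differentiable_times_bump intro: bump_eq_0)

lemma bump_tendsto: "(\<lambda>n. bump a b n x) \<longlonglongrightarrow> indicator {a<..<b} x"
proof (cases "x \<in> {a<..<b}")
  case True
  have *: "(\<lambda>n. flat_exp 1 (real (Suc n) * y)) \<longlonglongrightarrow> 1" if "0 < y" for y
  proof -
    have "(\<lambda>n. exp (- (inverse (real (Suc n)) * inverse y))) \<longlonglongrightarrow> exp (- (0 * inverse y))"
      by (intro tendsto_intros LIMSEQ_inverse_real_of_nat)
    moreover have "flat_exp 1 (real (Suc n) * y) = exp (- (inverse (real (Suc n)) * inverse y))" for n
      using that by (auto simp: flat_exp_def zero_less_mult_iff simp del: of_nat_Suc)
    ultimately show ?thesis
      by simp
  qed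
  have "(\<lambda>n. bump a b n x) \<longlonglongrightarrow> 1 * 1"
    unfolding bump_def by (intro tendsto_mult *) (use True in auto)
  then show ?thesis
    using True by simp
qed (simp add: bump_eq_0)

section \<open>Derivatives, supports and bounds of test functions\<close>

lemma test_function_has_derivative:
  "test_function \<phi> \<Longrightarrow> (\<phi> has_field_derivative deriv \<phi> x) (at x)"
  unfolding test_function_def DERIV_deriv_iff_field_differentiable
  by (metis funpow_0)

lemma test_function_deriv:
  assumes "test_function \<phi>"
  shows "test_function (deriv \<phi>)"
proof -
  have "{x. deriv \<phi> x \<noteq> 0} \<subseteq> closure {x. \<phi> x \<noteq> 0}"
  proof (rule subsetI, rule ccontr)
    fix x assume x: "x \<in> {x. deriv \<phi> x \<noteq> 0}" "x \<notin> closure {x. \<phi> x \<noteq> 0}"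
    have "((\<lambda>x. 0) has_field_derivative 0) (at x)"
      by simp
    then have "(\<phi> has_field_derivative 0) (at x)"
      by (rule has_field_derivative_transform_within_open[where S = "- closure {x. \<phi> x \<noteq> 0}"])
        (use x closure_subset[of "{x. \<phi> x \<noteq> 0}"] in auto)
    then show False
      using x by (auto dest: DERIV_imp_deriv)
  qed
  then have "bounded {x. deriv \<phi> x \<noteq> 0}"
    using assms by (intro bounded_subset[OF compact_imp_bounded]) (auto simp: test_function_def)
  moreover have "(deriv ^^ k) (deriv \<phi>) field_differentiable at x" for k x
  proof -
    have "(deriv ^^ Suc k) \<phi> field_differentiable at x"
      using assms unfolding test_function_def by blast
    then show ?thesis
      by (simp only: funpow_Suc_right o_apply)
  qed
  ultimately show ?thesis
    by (simp add: test_function_def)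
qed

lemma test_function_continuous: "test_function \<phi> \<Longrightarrow> continuous_on A \<phi>"
  using test_function_has_derivative DERIV_continuous_on[of A \<phi> "deriv \<phi>"]
  by (meson has_field_derivative_at_within)

lemma test_function_support:
  assumes "test_function \<phi>"
  obtains M where "0 < M" "\<And>x. x \<notin> {-M..M} \<Longrightarrow> \<phi> x = 0"
proof -
  have "bounded {x. \<phi> x \<noteq> 0}"
    using assms by (intro bounded_subset[OF compact_imp_bounded closure_subset]) (auto simp: test_function_def)
  then obtain M where M: "0 < M" "\<forall>x\<in>{x. \<phi> x \<noteq> 0}. norm x \<le> M"
    using bounded_pos by blast
  have "\<phi> x = 0" if "x \<notin> {-M..M}" for x
  proof (rule ccontr)
    assume "\<phi> x \<noteq> 0"
    then have "\<bar>x\<bar> \<le> M"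
      using M(2) by simp
    then show False
      using that by (simp add: abs_le_iff)
  qed
  then show ?thesis
    using that M(1) by blast
qed

lemma test_function_bounded:
  assumes "test_function \<phi>"
  obtains B where "0 < B" "\<And>x. \<bar>\<phi> x\<bar> \<le> B"
proof -
  obtain M where M: "0 < M" "\<And>x. x \<notin> {-M..M} \<Longrightarrow> \<phi> x = 0"
    using test_function_support[OF assms] by blast
  have "compact (\<phi> ` {-M..M})"
    by (intro compact_continuous_image test_function_continuous[OF assms] compact_Icc)
  then have "bounded (\<phi> ` {-M..M})"
    by (rule compact_imp_bounded)
  then obtain B where B: "0 < B" "\<forall>y\<in>\<phi> ` {-M..M}. norm y \<le> B"
    using bounded_pos by blast
  have "\<bar>\<phi> x\<bar> \<le> B" for x
  proof (cases "x \<in> {-M..M}")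
    case True
    then have "norm (\<phi> x) \<le> B"
      using B(2) by blast
    then show ?thesis
      by simp
  qed (use M(2)[of x] B(1) in simp)
  then show ?thesis
    using that B(1) by blast
qed

section \<open>Regularity of weak derivatives\<close>

lemma square_integrable_bounded_support:
  assumes "f \<in> borel_measurable borel" "\<And>x. cmod (f x) \<le> B" "\<And>x. x \<notin> {a..b} \<Longrightarrow> f x = 0"
  shows "square_integrable f"
proof -
  have "integrable lborel (\<lambda>x. (cmod (f x))\<^sup>2)"
  proof (rule integrableI_bounded_set[where A = "{a..b}" and B = "B\<^sup>2"])
    show "AE x \<in> {a..b} in lborel. norm ((cmod (f x))\<^sup>2) \<le> B\<^sup>2"
      using assms(2) by (auto intro!: power_mono)
  qed (use assms in \<open>auto simp: emeasure_lborel_Icc_eq\<close>)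
  then show ?thesis
    using assms(1) by (simp add: square_integrable_def)
qed

lemma square_integrable_test_function:
  assumes "test_function \<phi>"
  shows "square_integrable (\<lambda>x. complex_of_real (\<phi> x))"
proof -
  obtain M where M: "\<And>x. x \<notin> {-M..M} \<Longrightarrow> \<phi> x = 0"
    using test_function_support[OF assms] by blast
  obtain B where "\<And>x. \<bar>\<phi> x\<bar> \<le> B"
    using test_function_bounded[OF assms] by blast
  moreover have "(\<lambda>x. complex_of_real (\<phi> x)) \<in> borel_measurable borel"
    by (intro borel_measurable_continuous_onI continuous_intros test_function_continuous assms)
  ultimately show ?thesis
    by (intro square_integrable_bounded_support[where B = B and a = "-M" and b = M]) (auto simp: M)
qed

lemma square_integrable_indicator: "square_integrable (\<lambda>x. complex_of_real (indicator {a..b} x))"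
  by (rule square_integrable_bounded_support[where B = 1 and a = a and b = b])
    (auto simp: indicator_def)

lemma square_integrable_cnj: "square_integrable f \<Longrightarrow> square_integrable (\<lambda>x. cnj (f x))"
  by (auto simp: square_integrable_def)

lemma integrable_mult_square_integrable:
  "square_integrable f \<Longrightarrow> square_integrable g \<Longrightarrow> integrable lborel (\<lambda>x. f x * g x)"
  using integrable_mult_cnj[of f "\<lambda>x. cnj (g x)"] square_integrable_cnj[of g] by simp

lemma square_integrable_imp_set_integrable:
  assumes "square_integrable f"
  shows "set_integrable lborel {a..b} f"
  using integrable_mult_square_integrable[OF square_integrable_indicator[of a b] assms]
  by (simp add: set_integrable_def scaleR_conv_of_real)

text \<open>Stated for local integrability, because constants and primitives, which are in general
  not square integrable, are also paired with test functions.\<close>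

lemma set_integrable_mult_test_function:
  assumes f: "\<And>a b. set_integrable lborel {a..b::real} (f :: real \<Rightarrow> complex)" and \<phi>: "test_function \<phi>"
  shows "integrable lborel (\<lambda>x. complex_of_real (\<phi> x) * f x)"
proof -
  obtain M where M: "\<And>x. x \<notin> {-M..M} \<Longrightarrow> \<phi> x = 0"
    using test_function_support[OF \<phi>] by blast
  obtain B where B: "0 < B" "\<And>x. \<bar>\<phi> x\<bar> \<le> B"
    using test_function_bounded[OF \<phi>] by blast
  have [measurable]: "\<phi> \<in> borel_measurable borel"
    by (intro borel_measurable_continuous_onI test_function_continuous \<phi>)
  have eq: "(\<lambda>x. complex_of_real (\<phi> x) * f x) = (\<lambda>x. complex_of_real (\<phi> x) * (indicator {-M..M} x *\<^sub>R f x))"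
    using M by (auto simp: indicator_def fun_eq_iff)
  have int: "integrable lborel (\<lambda>x. indicator {-M..M} x *\<^sub>R f x)"
    using f[of "-M" M] by (simp add: set_integrable_def)
  have [measurable]: "(\<lambda>x. indicator {-M..M} x *\<^sub>R f x) \<in> borel_measurable borel"
    using borel_measurable_integrable[OF int] by simp
  show ?thesis
    unfolding eq
  proof (rule Bochner_Integration.integrable_bound)
    show "integrable lborel (\<lambda>x. B *\<^sub>R (indicator {-M..M} x *\<^sub>R f x))"
      using int by (intro integrable_scaleR_right)
    show "AE x in lborel. norm (complex_of_real (\<phi> x) * (indicator {-M..M} x *\<^sub>R f x))
        \<le> norm (B *\<^sub>R (indicator {-M..M} x *\<^sub>R f x))"
      using B by (auto intro!: mult_right_mono simp: norm_mult indicator_def)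
  qed measurable
qed

text \<open>The sets over which \<open>f\<close> integrates to zero form a Dynkin system, and the
  open intervals are an intersection-stable generator of the Borel sets. The integral over the whole
  line is a separate assumption, since complements are taken in \<open>UNIV\<close>, which is no
  bounded interval.\<close>

lemma AE_zero_if_interval_integrals_zero:
  fixes f :: "real \<Rightarrow> complex"
  assumes int: "integrable lborel f"
    and zero: "\<And>a b. (LINT x:{a<..<b}|lborel. f x) = 0" and zeroU: "integral\<^sup>L lborel f = 0"
  shows "AE x in lborel. f x = 0"
proof -
  have borel: "sets borel = sigma_sets UNIV (range (\<lambda>(a, b). {a<..<b :: real}))"
  proof -
    have "(\<lambda>(a, b). box a b) = (\<lambda>(a, b). {a<..<b :: real})"
      by (auto simp: fun_eq_iff)
    then show ?thesis
      by (simp add: borel_eq_box)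
  qed
  have "(LINT x:A|lborel. f x) = 0" if A: "A \<in> sigma_sets UNIV (range (\<lambda>(a, b). {a<..<b :: real}))" for A
  proof (rule sigma_sets_induct_disjoint[OF _ _ A])
    show "Int_stable (range (\<lambda>(a, b). {a<..<b :: real}))"
      by (auto simp: Int_stable_def)
    show "range (\<lambda>(a, b). {a<..<b :: real}) \<subseteq> Pow UNIV"
      by simp
  next
    fix A assume "A \<in> sigma_sets UNIV (range (\<lambda>(a, b). {a<..<b :: real}))" "(LINT x:A|lborel. f x) = 0"
    then have "A \<in> sets lborel" 
      by (simp add: borel)
    then have "(LINT x:A \<union> (UNIV - A)|lborel. f x) = (LINT x:A|lborel. f x) + (LINT x:UNIV-A|lborel. f x)"
      using int by (intro set_integral_Un) (auto simp: set_integrable_def intro!: integrable_mult_indicator)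
    then show "(LINT x:UNIV-A|lborel. f x) = 0"
      using \<open>(LINT x:A|lborel. f x) = 0\<close> zeroU by (simp add: set_lebesgue_integral_def)
  next
    fix A :: "nat \<Rightarrow> real set"
    assume A: "disjoint_family A" "range A \<subseteq> sigma_sets UNIV (range (\<lambda>(a, b). {a<..<b :: real}))"
      "\<And>i. (LINT x:A i|lborel. f x) = 0"
    then have "A i \<in> sets lborel" for i
      by (auto simp: borel)
    then have "(LINT x:(\<Union>i. A i)|lborel. f x) = (\<Sum>i. LINT x:A i|lborel. f x)"
      using int A(1)
      by (intro lebesgue_integral_countable_add)
        (auto simp: set_integrable_def disjoint_family_on_def intro!: integrable_mult_indicator)
    then show "(LINT x:(\<Union>i. A i)|lborel. f x) = 0"
      by (simp add: A)
  qed (use zero in \<open>auto simp: set_lebesgue_integral_def\<close>)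
  then have "(LINT x:A|lborel. f x) = 0" if "A \<in> sets lborel" for A
    using that by (simp add: borel)
  then show ?thesis
    by (rule sigma_finite_measure.density_zero[OF lborel.sigma_finite_measure_axioms int])
qed

text \<open>The fundamental lemma of the calculus of variations. Bumps approximate indicators of
  intervals, so all interval integrals of \<open>f\<close> vanish by dominated convergence.\<close>

lemma AE_zero_if_test_function_integrals_zero:
  fixes f :: "real \<Rightarrow> complex"
  assumes f: "\<And>a b. set_integrable lborel {a..b} f"
    and zero: "\<And>\<phi>. test_function \<phi> \<Longrightarrow> (LINT x|lborel. complex_of_real (\<phi> x) * f x) = 0"
  shows "AE x in lborel. f x = 0"
proof -
  have int: "integrable lborel (\<lambda>x. indicator {a<..<b} x *\<^sub>R f x)" for a b
    using set_integrable_subset[OF f[of a b], of "{a<..<b}"]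
    by (auto simp: set_integrable_def greaterThanLessThan_subseteq_atLeastAtMost_iff)
  have interval: "(LINT x:{a<..<b}|lborel. f x) = 0" for a b
  proof -
    have [measurable]: "(\<lambda>x. indicator {a<..<b} x *\<^sub>R f x) \<in> borel_measurable borel"
      using borel_measurable_integrable[OF int] by simp
    have [measurable]: "bump a b n \<in> borel_measurable borel" for n
      by (intro borel_measurable_continuous_onI test_function_continuous test_function_bump)
    have eq: "(\<lambda>x. complex_of_real (bump a b n x) * f x)
        = (\<lambda>x. complex_of_real (bump a b n x) * (indicator {a<..<b} x *\<^sub>R f x))" for n
      using bump_eq_0 by (force simp: indicator_def fun_eq_iff)
    have "(\<lambda>n. LINT x|lborel. complex_of_real (bump a b n x) * (indicator {a<..<b} x *\<^sub>R f x))
        \<longlonglongrightarrow> (LINT x|lborel. indicator {a<..<b} x *\<^sub>R f x)"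
    proof (rule integral_dominated_convergence)
      show "integrable lborel (\<lambda>x. norm (indicator {a<..<b} x *\<^sub>R f x))"
        by (intro integrable_norm int)
      show "AE x in lborel. norm (complex_of_real (bump a b n x) * (indicator {a<..<b} x *\<^sub>R f x))
          \<le> norm (indicator {a<..<b} x *\<^sub>R f x)" for n
        using bump_bounds[of a b n] by (intro AE_I2) (auto simp: norm_mult indicator_def intro!: mult_left_le_one_le)
      have "(\<lambda>n. complex_of_real (bump a b n x) * (indicator {a<..<b} x *\<^sub>R f x))
          \<longlonglongrightarrow> complex_of_real (indicator {a<..<b} x) * (indicator {a<..<b} x *\<^sub>R f x)" for x
        by (intro tendsto_intros bump_tendsto)
      moreover have "complex_of_real (indicator {a<..<b} x) * (indicator {a<..<b} x *\<^sub>R f x)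
          = indicator {a<..<b} x *\<^sub>R f x" for x
        by (simp add: indicator_def)
      ultimately show "AE x in lborel. (\<lambda>n. complex_of_real (bump a b n x) * (indicator {a<..<b} x *\<^sub>R f x))
          \<longlonglongrightarrow> indicator {a<..<b} x *\<^sub>R f x"
        by (intro AE_I2) (simp only:)
    qed measurable
    moreover have "(LINT x|lborel. complex_of_real (bump a b n x) * (indicator {a<..<b} x *\<^sub>R f x)) = 0" for n
      by (subst eq[symmetric]) (rule zero[OF test_function_bump])
    ultimately show ?thesis
      by (simp add: set_lebesgue_integral_def LIMSEQ_const_iff)
  qed
  \<comment> \<open>\<open>f\<close> is only locally integrable, so it is truncated to
    \<open>(- n, n)\<close>; an interval meets this one in an interval again.\<close>
  have "AE x in lborel. indicator {- real n<..<real n} x *\<^sub>R f x = 0" for n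
  proof (rule AE_zero_if_interval_integrals_zero[OF int])
    fix a b
    have "(LINT x:{a<..<b}|lborel. indicator {- real n<..<real n} x *\<^sub>R f x)
        = (LINT x:{max a (- real n)<..<min b (real n)}|lborel. f x)"
      unfolding set_lebesgue_integral_def
      by (rule Bochner_Integration.integral_cong) (auto simp: indicator_def)
    then show "(LINT x:{a<..<b}|lborel. indicator {- real n<..<real n} x *\<^sub>R f x) = 0"
      by (simp add: interval)
    show "(LINT x|lborel. indicator {- real n<..<real n} x *\<^sub>R f x) = 0"
      using interval[of "- real n" "real n"] by (simp add: set_lebesgue_integral_def)
  qed
  then have "AE x in lborel. \<forall>n. indicator {- real n<..<real n} x *\<^sub>R f x = 0"
    unfolding AE_all_countable by blast
  then show ?thesis
  proof eventually_elim
    case (elim x)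
    obtain n where "\<bar>x\<bar> < real n"
      using reals_Archimedean2 by blast
    then show ?case
      using elim[rule_format, of n] by (auto simp: abs_less_iff)
  qed
qed

section \<open>Primitives of square integrable functions\<close>

text \<open>The kernel of \<open>\<integral>\<close> from \<open>0\<close> to \<open>x\<close>, with the sign convention for \<open>x < 0\<close>.\<close>

definition signed_interval :: "real \<Rightarrow> real \<Rightarrow> real" where
  "signed_interval x t = (if 0 \<le> t \<and> t \<le> x then 1 else if x \<le> t \<and> t < 0 then - 1 else 0)"

text \<open>The integral from \<open>0\<close> to \<open>x\<close> is written over the whole line
  against a jointly measurable kernel, so that integration by parts against a test function becomes
  an application of Fubini.\<close>

definition primitive :: "(real \<Rightarrow> complex) \<Rightarrow> real \<Rightarrow> complex" where
  "primitive g x = (LINT t|lborel. complex_of_real (signed_interval x t) * g t)"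

lemma measurable_signed_interval [measurable]:
  "(\<lambda>p. signed_interval (fst p) (snd p)) \<in> borel_measurable (borel \<Otimes>\<^sub>M borel)"
  unfolding signed_interval_def by measurable

lemma measurable_signed_interval2 [measurable]: "signed_interval x \<in> borel_measurable borel"
  unfolding signed_interval_def by measurable

lemma integrable_signed_interval_mult:
  assumes "square_integrable g"
  shows "integrable lborel (\<lambda>t. complex_of_real (signed_interval x t) * g t)"
  by (intro integrable_mult_square_integrable assms
      square_integrable_bounded_support[where B = 1 and a = "- \<bar>x\<bar>" and b = "\<bar>x\<bar>"])
    (auto simp: signed_interval_def)

lemma primitive_diff:
  assumes g: "square_integrable g" and "x \<le> y"
  shows "primitive g y - primitive g x = (LINT t:{x..y}|lborel. g t)"
proof -
  have [measurable]: "g \<in> borel_measurable borel"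
    using g by (simp add: square_integrable_def)
  have "primitive g y - primitive g x =
      (LINT t|lborel. complex_of_real (signed_interval y t) * g t - complex_of_real (signed_interval x t) * g t)"
    unfolding primitive_def
    by (rule Bochner_Integration.integral_diff[symmetric]) (intro integrable_signed_interval_mult g)+
  also have "\<dots> = (LINT t|lborel. indicator {x..y} t *\<^sub>R g t)"
  proof (rule integral_cong_AE)
    \<comment> \<open>Both kernels are nonzero at their end points, so the difference may disagree
      with the indicator at \<open>x\<close> or \<open>y\<close>, and only there.\<close>
    show "AE t in lborel. complex_of_real (signed_interval y t) * g t - complex_of_real (signed_interval x t) * g t
        = indicator {x..y} t *\<^sub>R g t"
      using AE_lborel_singleton[of x] AE_lborel_singleton[of y]
      by eventually_elim (use \<open>x \<le> y\<close> in \<open>auto simp: signed_interval_def indicator_def\<close>)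
  qed simp_all
  finally show ?thesis
    by (simp add: set_lebesgue_integral_def)
qed

lemma primitive_eq_integral:
  assumes g: "square_integrable g" and "-M \<le> x"
  shows "primitive g x = primitive g (-M) + integral {-M..x} g"
  using primitive_diff[OF g assms(2)]
    set_borel_integral_eq_integral(2)[OF square_integrable_imp_set_integrable[OF g], of "-M" x]
  by (simp add: algebra_simps)

lemma continuous_on_primitive:
  assumes g: "square_integrable g"
  shows "continuous_on UNIV (primitive g)"
proof -
  have "continuous_on {-M..M} (\<lambda>x. primitive g (-M) + integral {-M..x} g)" for M
    by (intro continuous_intros indefinite_integral_continuous_1
        set_borel_integral_eq_integral(1) square_integrable_imp_set_integrable g)
  then have on: "continuous_on {-M..M} (primitive g)" for M
    by (rule continuous_on_eq) (rule primitive_eq_integral[OF g, symmetric], simp)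
  have "isCont (primitive g) x" for x
    using on[of "\<bar>x\<bar> + 1"] by (rule continuous_on_interior) (auto simp: interior_atLeastAtMost_real)
  then show ?thesis
    by (simp add: continuous_at_imp_continuous_on)
qed

text \<open>Continuity is asked for at the single point \<open>x\<close>, because later integrands
  contain \<open>sgn\<close> and jump at \<open>0\<close>.\<close>

lemma primitive_has_vector_derivative:
  assumes g: "square_integrable g" and cont: "isCont g x"
  shows "(primitive g has_vector_derivative g x) (at x)"
proof -
  define M where "M = \<bar>x\<bar> + 1"
  have x: "x \<in> {-M<..<M}"
    by (auto simp: M_def)
  have "((\<lambda>u. integral {-M..u} g) has_vector_derivative g x) (at x within {-M..M} - {})"
  proof (rule integral_has_vector_derivative_continuous_at)
    show "g integrable_on {-M..M}"
      by (intro set_borel_integral_eq_integral(1) square_integrable_imp_set_integrable g)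
    show "continuous (at x within {-M..M} - {}) g"
      by (rule continuous_at_imp_continuous_at_within[OF cont])
  qed (use x in auto)
  then have "((\<lambda>u. integral {-M..u} g) has_vector_derivative g x) (at x within {-M<..<M})"
    by (rule has_vector_derivative_within_subset) (simp add: greaterThanLessThan_subseteq_atLeastAtMost_iff)
  moreover have "at x within {-M<..<M} = at x"
    by (rule at_within_open[OF x open_greaterThanLessThan])
  ultimately have "((\<lambda>u. integral {-M..u} g) has_vector_derivative g x) (at x)"
    by (simp only:)
  then have "((\<lambda>u. primitive g (-M) + integral {-M..u} g) has_vector_derivative 0 + g x) (at x)"
    by (intro has_vector_derivative_add has_vector_derivative_const)
  then have "((\<lambda>u. primitive g (-M) + integral {-M..u} g) has_vector_derivative g x) (at x)"
    by (simp only: add_0_left)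
  then show ?thesis
  proof (rule has_vector_derivative_transform_within_open[where S = "{-M<..<M}"])
    show "primitive g (-M) + integral {-M..y} g = primitive g y" if "y \<in> {-M<..<M}" for y
      using that by (intro primitive_eq_integral[OF g, symmetric]) auto
  qed (use x in auto)
qed

lemma primitive_cong_AE:
  assumes "AE x in lborel. f x = g x" "f \<in> borel_measurable borel" "g \<in> borel_measurable borel"
  shows "primitive f = primitive g"
proof
  fix x
  have [measurable]: "f \<in> borel_measurable borel" "g \<in> borel_measurable borel"
    using assms by auto
  show "primitive f x = primitive g x"
    unfolding primitive_def by (rule integral_cong_AE) (use assms(1) in auto)
qed

lemma integral_indicator_deriv_test_function:
  assumes "test_function \<phi>" "a \<le> b"
  shows "(LINT x|lborel. indicator {a..b} x * deriv \<phi> x) = \<phi> b - \<phi> a"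
proof -
  have "(LINT x|lborel. indicator {a..b} x *\<^sub>R deriv \<phi> x) = \<phi> b - \<phi> a"
    by (rule integral_FTC_atLeastAtMost)
      (use assms in \<open>auto intro!: has_real_derivative_iff_has_vector_derivative[THEN iffD1]
          has_field_derivative_at_within test_function_has_derivative test_function_continuous test_function_deriv\<close>)
  then show ?thesis
    by simp
qed

text \<open>As a function of \<open>x\<close>, the kernel is the indicator of
  \<open>t \<le> x\<close> when \<open>0 \<le> t\<close>, and minus the indicator of
  \<open>x \<le> t\<close> when \<open>t < 0\<close>. The fundamental theorem and the compact
  support give the same value in both cases.\<close>

lemma integral_deriv_test_function_signed_interval:
  assumes \<phi>: "test_function \<phi>"
  shows "(LINT x|lborel. deriv \<phi> x * signed_interval x t) = - \<phi> t"
proof -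
  obtain M where M: "\<And>x. x \<notin> {-M..M} \<Longrightarrow> \<phi> x = 0"
    using test_function_support[OF \<phi>] by blast
  obtain M' where M': "\<And>x. x \<notin> {-M'..M'} \<Longrightarrow> deriv \<phi> x = 0"
    using test_function_support[OF test_function_deriv[OF \<phi>]] by blast
  define L where "L = \<bar>t\<bar> + \<bar>M\<bar> + \<bar>M'\<bar> + 1"
  have "L \<notin> {-M..M}" "- L \<notin> {-M..M}"
    unfolding L_def atLeastAtMost_iff by arith+
  then have L: "\<phi> L = 0" "\<phi> (- L) = 0"
    using M by blast+
  have M'L: "deriv \<phi> x = 0" if "x < - L \<or> L < x" for x
  proof -
    have "x \<notin> {-M'..M'}"
      using that unfolding L_def atLeastAtMost_iff by arith
    then show ?thesis
      by (rule M')
  qed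
  have "t \<le> L" "- L \<le> t"
    unfolding L_def by arith+
  show ?thesis
  proof (cases "0 \<le> t")
    case True
    then have "(LINT x|lborel. deriv \<phi> x * signed_interval x t) = (LINT x|lborel. indicator {t..L} x * deriv \<phi> x)"
      by (intro Bochner_Integration.integral_cong) (auto simp: signed_interval_def indicator_def M'L)
    then show ?thesis
      using L by (simp add: integral_indicator_deriv_test_function[OF \<phi>] \<open>t \<le> L\<close> \<open>- L \<le> t\<close>)
  next
    case False
    then have "(LINT x|lborel. deriv \<phi> x * signed_interval x t) = (LINT x|lborel. - (indicator {-L..t} x * deriv \<phi> x))"
      by (intro Bochner_Integration.integral_cong) (auto simp: signed_interval_def indicator_def M'L)
    then show ?thesis
      using L by (simp add: integral_indicator_deriv_test_function[OF \<phi>] \<open>t \<le> L\<close> \<open>- L \<le> t\<close>)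
  qed
qed

text \<open>Integration by parts for a \<open>g\<close> that need not be continuous anywhere: after
  Fubini only \<open>\<phi>\<close> has to be differentiated.\<close>

lemma integral_deriv_test_function_primitive:
  assumes \<phi>: "test_function \<phi>" and g: "square_integrable g"
  shows "(LINT x|lborel. complex_of_real (deriv \<phi> x) * primitive g x) =
    - (LINT t|lborel. complex_of_real (\<phi> t) * g t)"
proof -
  define k where "k x t = complex_of_real (deriv \<phi> x) * (complex_of_real (signed_interval x t) * g t)" for x t
  have \<phi>': "test_function (deriv \<phi>)"
    by (rule test_function_deriv[OF \<phi>])
  obtain M where M: "\<And>x. x \<notin> {-M..M} \<Longrightarrow> deriv \<phi> x = 0"
    using test_function_support[OF \<phi>'] by blast
  obtain B where B: "0 < B" "\<And>x. \<bar>deriv \<phi> x\<bar> \<le> B"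
    using test_function_bounded[OF \<phi>'] by blast
  have [measurable]: "deriv \<phi> \<in> borel_measurable borel"
    by (intro borel_measurable_continuous_onI test_function_continuous \<phi>')
  have [measurable]: "g \<in> borel_measurable borel"
    using g by (simp add: square_integrable_def)
  have k_meas [measurable]: "(\<lambda>p. k (fst p) (snd p)) \<in> borel_measurable (lborel \<Otimes>\<^sub>M lborel)"
    unfolding k_def by measurable
  have k_int: "integrable lborel (k x)" for x
    unfolding k_def by (intro integrable_mult_right integrable_signed_interval_mult g)
  have int: "integrable lborel (\<lambda>t. indicator {-M..M} t *\<^sub>R g t)"
    using square_integrable_imp_set_integrable[OF g] by (simp add: set_integrable_def)
  define C where "C = (LINT t|lborel. norm (indicator {-M..M} t *\<^sub>R g t))"
  \<comment> \<open>\<open>deriv \<phi>\<close> vanishes for \<open>x\<close> outside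
    \<open>{-M..M}\<close>, and for \<open>x\<close> inside the kernel in \<open>t\<close> is
    supported there too. This yields the integrable majorant for Fubini.\<close>
  have le: "(LINT t|lborel. norm (k x t)) \<le> indicator {-M..M} x * (B * C)" for x
  proof (cases "x \<in> {-M..M}")
    case True
    have "(LINT t|lborel. norm (k x t)) \<le> (LINT t|lborel. B * norm (indicator {-M..M} t *\<^sub>R g t))"
    proof (rule integral_mono)
      show "norm (k x t) \<le> B * norm (indicator {-M..M} t *\<^sub>R g t)" for t
      proof -
        have "\<bar>signed_interval x t\<bar> \<le> indicator {-M..M} t"
          using True by (auto simp: signed_interval_def indicator_def)
        then show ?thesis
          using B by (auto simp: k_def norm_mult mult.assoc[symmetric] intro!: mult_mono mult_right_mono)
      qed
    qed (intro integrable_norm k_int integrable_mult_right int)+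
    then show ?thesis
      using True by (simp add: C_def)
  next
    case False
    then show ?thesis
      by (simp add: k_def M)
  qed
  have "integrable (lborel \<Otimes>\<^sub>M lborel) (\<lambda>(x, t). k x t)"
  proof (rule lborel_pair.Fubini_integrable)
    show "integrable lborel (\<lambda>x. LINT t|lborel. norm (case (x, t) of (x, t) \<Rightarrow> k x t))"
    proof (rule Bochner_Integration.integrable_bound)
      show "integrable lborel (\<lambda>x. indicator {-M..M} x * (B * C))"
        by (intro integrable_mult_left) (auto simp: emeasure_lborel_Icc_eq intro!: integrable_real_indicator)
      show "AE x in lborel. norm (LINT t|lborel. norm (case (x, t) of (x, t) \<Rightarrow> k x t))
          \<le> norm (indicator {-M..M} x * (B * C))"
      proof (rule AE_I2)
        fix x
        have "norm (LINT t|lborel. norm (k x t)) = (LINT t|lborel. norm (k x t))"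
          by simp
        also have "\<dots> \<le> norm (indicator {-M..M} x * (B * C))"
          using le[of x] by (rule order_trans) (simp add: abs_ge_self)
        finally show "norm (LINT t|lborel. norm (case (x, t) of (x, t) \<Rightarrow> k x t))
          \<le> norm (indicator {-M..M} x * (B * C))"
          by simp
      qed
    qed (use k_meas in \<open>simp add: case_prod_beta\<close>)
  qed (use k_int k_meas in \<open>simp_all add: case_prod_beta\<close>)
  then have "(LINT t|lborel. LINT x|lborel. k x t) = (LINT x|lborel. LINT t|lborel. k x t)"
    by (rule lborel_pair.Fubini_integral)
  moreover have "(LINT t|lborel. k x t) = complex_of_real (deriv \<phi> x) * primitive g x" for x
    by (simp add: k_def primitive_def)
  moreover have "(LINT x|lborel. k x t) = - (complex_of_real (\<phi> t) * g t)" for t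
  proof -
    have "(LINT x|lborel. k x t) = (LINT x|lborel. complex_of_real (deriv \<phi> x * signed_interval x t) * g t)"
      by (simp add: k_def mult.assoc)
    also have "\<dots> = complex_of_real (LINT x|lborel. deriv \<phi> x * signed_interval x t) * g t"
      by (simp only: integral_mult_left_zero integral_complex_of_real)
    finally show ?thesis
      by (simp add: integral_deriv_test_function_signed_interval[OF \<phi>])
  qed
  ultimately show ?thesis
    by simp
qed

lemma test_function_differentiable_times: "test_function \<phi> \<Longrightarrow> differentiable_times n \<phi>"
proof (induction n arbitrary: \<phi>)
  case (Suc n)
  then show ?case
    using differentiable_times_SucI[OF test_function_has_derivative[OF Suc.prems]] test_function_deriv
    by blast
qed simp

text \<open>Starting the antiderivative at the left end \<open>-M\<close> makes it vanish to the
  left of the support; to the right it equals the full integral of \<open>\<eta>\<close>, which is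
  zero by assumption. \<open>Re\<close> only returns from the complex-valued
  \<open>primitive\<close> to real test functions.\<close>

lemma test_function_antiderivative:
  assumes \<eta>: "test_function \<eta>" and "(LINT x|lborel. \<eta> x) = 0"
  obtains \<psi> where "test_function \<psi>" "deriv \<psi> = \<eta>"
proof -
  obtain M where M: "0 < M" "\<And>x. x \<notin> {-M..M} \<Longrightarrow> \<eta> x = 0"
    using test_function_support[OF \<eta>] by blast
  define P where "P = primitive (\<lambda>x. complex_of_real (\<eta> x))"
  have sq: "square_integrable (\<lambda>x. complex_of_real (\<eta> x))"
    by (rule square_integrable_test_function[OF \<eta>])
  define \<psi> where "\<psi> x = Re (P x - P (-M))" for x
  have der: "(\<psi> has_field_derivative \<eta> x) (at x)" for x
  proof -
    have "isCont \<eta> x"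
      using test_function_has_derivative[OF \<eta>] by (rule DERIV_isCont)
    then have "isCont (\<lambda>x. complex_of_real (\<eta> x)) x"
      by (intro continuous_intros)
    then have "(P has_vector_derivative complex_of_real (\<eta> x)) (at x)"
      unfolding P_def by (rule primitive_has_vector_derivative[OF sq])
    then have "((\<lambda>x. Re (P x - P (-M))) has_vector_derivative Re (complex_of_real (\<eta> x) - 0)) (at x)"
      by (intro bounded_linear.has_vector_derivative[OF bounded_linear_Re] has_vector_derivative_diff has_vector_derivative_const)
    then show ?thesis
      by (simp add: \<psi>_def[abs_def] has_real_derivative_iff_has_vector_derivative)
  qed
  have \<psi>0: "\<psi> x = 0" if "x \<notin> {-M..M}" for x
  proof (cases "x < -M")
    case True
    then have "P (-M) - P x = (LINT t:{x..-M}|lborel. complex_of_real (\<eta> t))"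
      unfolding P_def by (intro primitive_diff sq) simp
    also have "\<dots> = (LINT t:{x..-M}|lborel. 0)"
      unfolding set_lebesgue_integral_def
    proof (rule integral_cong_AE)
      show "AE t in lborel. indicator {x..-M} t *\<^sub>R complex_of_real (\<eta> t) = indicator {x..-M} t *\<^sub>R 0"
        using AE_lborel_singleton[of "-M"] by eventually_elim (auto simp: indicator_def M)
    qed (use sq in \<open>auto simp: square_integrable_def\<close>)
    finally show ?thesis
      by (simp add: \<psi>_def)
  next
    case False
    then have "P x - P (-M) = (LINT t:{-M..x}|lborel. complex_of_real (\<eta> t))"
      unfolding P_def by (intro primitive_diff sq) simp
    also have "\<dots> = (LINT t|lborel. complex_of_real (\<eta> t))"
      unfolding set_lebesgue_integral_def
      by (rule Bochner_Integration.integral_cong) (use False that in \<open>auto simp: indicator_def M\<close>)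
    finally show ?thesis
      using assms(2) by (simp add: \<psi>_def)
  qed
  have "differentiable_times n \<eta>" for n
    by (rule test_function_differentiable_times[OF \<eta>])
  then have "differentiable_times n \<psi>" for n
    using differentiable_times_SucD differentiable_times_SucI[OF der] by blast
  then have "test_function \<psi>"
    by (rule test_functionI[where a = "-M" and b = M]) (rule \<psi>0)
  moreover have "deriv \<psi> = \<eta>"
    by (rule ext) (rule DERIV_imp_deriv[OF der])
  ultimately show ?thesis
    using that by blast
qed

lemma test_function_add_scale:
  assumes "test_function f" "test_function g"
  shows "test_function (\<lambda>x. f x + c * g x)"
proof -
  obtain M N where M: "\<And>x. x \<notin> {-M..M} \<Longrightarrow> f x = 0" and N: "\<And>x. x \<notin> {-N..N} \<Longrightarrow> g x = 0"
    using test_function_support assms by metis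
  show ?thesis
  proof (rule test_functionI)
    show "differentiable_times n (\<lambda>x. f x + c * g x)" for n
      by (intro differentiable_times_add differentiable_times_mult differentiable_times_const
          test_function_differentiable_times assms)
    show "f x + c * g x = 0" if "x \<notin> {- max M N..max M N}" for x
    proof -
      have "x \<notin> {-M..M}" "x \<notin> {-N..N}"
        using that unfolding atLeastAtMost_iff by arith+
      then have "f x = 0" "g x = 0"
        using M N by blast+
      then show ?thesis
        by simp
    qed
  qed
qed

text \<open>The du Bois-Reymond lemma. The difference \<open>w\<close> of \<open>f\<close> and the
  primitive of \<open>g\<close> has weak derivative zero, so it is annihilated by all derivatives of
  test functions, that is, by all test functions of mean zero. Such a function is constant.\<close>

lemma weak_deriv_1_imp_primitive:
  assumes "has_weak_deriv 1 f g"
  obtains c where "AE x in lborel. rep_L2 f x = c + primitive (rep_L2 g) x"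
proof -
  define w where "w x = rep_L2 f x - primitive (rep_L2 g) x" for x
  define \<phi>\<^sub>0 where "\<phi>\<^sub>0 = bump 0 1 0"
  have \<phi>\<^sub>0: "test_function \<phi>\<^sub>0"
    by (simp add: \<phi>\<^sub>0_def test_function_bump)
  have int_test: "integrable lborel \<phi>" if "test_function \<phi>" for \<phi>
  proof -
    have "integrable lborel (\<lambda>x. complex_of_real (\<phi> x) * 1)"
      by (rule set_integrable_mult_test_function[OF _ that])
        (auto simp: set_integrable_def emeasure_lborel_Icc_eq intro!: integrable_real_indicator)
    then have "integrable lborel (\<lambda>x. Re (complex_of_real (\<phi> x) * 1))"
      by (rule integrable_Re)
    then show ?thesis
      by simp
  qed
  have prim: "set_integrable lborel {a..b} (primitive (rep_L2 g))" for a b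
    unfolding set_integrable_def
    by (rule borel_integrable_compact[OF compact_Icc])
      (rule continuous_on_subset[OF continuous_on_primitive[OF square_integrable_rep] subset_UNIV])
  have loc: "set_integrable lborel {a..b} w" for a b
    unfolding w_def
    by (rule set_integral_diff(1)[OF square_integrable_imp_set_integrable[OF square_integrable_rep] prim])
  have w0: "(LINT x|lborel. complex_of_real (\<eta> x) * w x) = 0"
    if \<eta>: "test_function \<eta>" "(LINT x|lborel. \<eta> x) = 0" for \<eta>
  proof -
    obtain \<psi> where \<psi>: "test_function \<psi>" "deriv \<psi> = \<eta>"
      using test_function_antiderivative[OF \<eta>] by blast
    have "(LINT x|lborel. complex_of_real (\<eta> x) * rep_L2 f x) = - (LINT x|lborel. complex_of_real (\<psi> x) * rep_L2 g x)"
      using assms \<psi> by (auto simp: has_weak_deriv_def)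
    moreover have "(LINT x|lborel. complex_of_real (\<eta> x) * primitive (rep_L2 g) x)
        = - (LINT x|lborel. complex_of_real (\<psi> x) * rep_L2 g x)"
      using integral_deriv_test_function_primitive[OF \<psi>(1) square_integrable_rep] \<psi>(2) by simp
    moreover have "(LINT x|lborel. complex_of_real (\<eta> x) * w x)
        = (LINT x|lborel. complex_of_real (\<eta> x) * rep_L2 f x) - (LINT x|lborel. complex_of_real (\<eta> x) * primitive (rep_L2 g) x)"
      unfolding w_def right_diff_distrib
      by (rule Bochner_Integration.integral_diff)
        (rule set_integrable_mult_test_function[OF _ \<eta>(1)],
          rule prim square_integrable_imp_set_integrable[OF square_integrable_rep])+
    ultimately show ?thesis
      by simp
  qed
  define N where "N = (LINT x|lborel. \<phi>\<^sub>0 x)"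
  have "N \<noteq> 0"
  proof
    assume "N = 0"
    then have "AE x in lborel. \<phi>\<^sub>0 x = 0"
      unfolding N_def using int_test[OF \<phi>\<^sub>0]
      by (subst (asm) integral_nonneg_eq_0_iff_AE) (auto simp: \<phi>\<^sub>0_def bump_bounds)
    then have "AE x in lborel. x \<notin> {0<..<1::real}"
      by eventually_elim (metis \<phi>\<^sub>0_def bump_pos less_irrefl)
    then have "emeasure lborel {x \<in> space lborel. \<not> x \<notin> {0<..<1::real}} = 0"
      by (intro emeasure_eq_0_AE) simp
    moreover have "{x \<in> space lborel. \<not> x \<notin> {0<..<1::real}} = {0<..<1}"
      by auto
    ultimately have "emeasure lborel {0<..<1::real} = 0"
      by (simp only:)
    then show False
      by simp
  qed
  \<comment> \<open>The only possible value of the constant: the average of \<open>w\<close> against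
    the bump.\<close>
  define c where "c = (LINT x|lborel. complex_of_real (\<phi>\<^sub>0 x) * w x) / N"
  have "AE x in lborel. w x - c = 0"
  proof (rule AE_zero_if_test_function_integrals_zero)
    have const: "set_integrable lborel {a..b} (\<lambda>x. c)" for a b :: real
      by (auto simp: set_integrable_def emeasure_lborel_Icc_eq intro!: integrable_real_indicator)
    then show "set_integrable lborel {a..b} (\<lambda>x. w x - c)" for a b
      by (intro set_integral_diff loc)
    fix \<phi> assume \<phi>: "test_function \<phi>"
    \<comment> \<open>Subtracting from \<open>\<phi>\<close> the multiple of
      \<open>\<phi>\<^sub>0\<close> with the same mean leaves a test function of mean zero, to which
      \<open>w0\<close> applies.\<close>
    define I where "I = (LINT x|lborel. \<phi> x)"
    have "(LINT x|lborel. \<phi> x + (- I / N) * \<phi>\<^sub>0 x) = 0"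
      using \<open>N \<noteq> 0\<close> int_test[OF \<phi>] int_test[OF \<phi>\<^sub>0] by (simp add: I_def N_def)
    then have "0 = (LINT x|lborel. complex_of_real (\<phi> x + (- I / N) * \<phi>\<^sub>0 x) * w x)"
      by (rule w0[OF test_function_add_scale[OF \<phi> \<phi>\<^sub>0], symmetric])
    also have "\<dots> = (LINT x|lborel. complex_of_real (\<phi> x) * w x + complex_of_real (- I / N) * (complex_of_real (\<phi>\<^sub>0 x) * w x))"
      by (simp add: algebra_simps)
    also have "\<dots> = (LINT x|lborel. complex_of_real (\<phi> x) * w x) - I * c"
      using set_integrable_mult_test_function[OF loc \<phi>] set_integrable_mult_test_function[OF loc \<phi>\<^sub>0]
      by (simp add: c_def)
    also have "\<dots> = (LINT x|lborel. complex_of_real (\<phi> x) * w x) - (LINT x|lborel. complex_of_real (\<phi> x) * c)"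
      by (simp add: I_def)
    also have "\<dots> = (LINT x|lborel. complex_of_real (\<phi> x) * (w x - c))"
      unfolding right_diff_distrib
      by (intro Bochner_Integration.integral_diff[symmetric] set_integrable_mult_test_function loc const \<phi>)
    finally show "(LINT x|lborel. complex_of_real (\<phi> x) * (w x - c)) = 0"
      by simp
  qed
  then have "AE x in lborel. rep_L2 f x = c + primitive (rep_L2 g) x"
    by eventually_elim (simp add: w_def algebra_simps)
  then show ?thesis
    by (rule that)
qed

section \<open>Weak derivatives and the graph of the operator\<close>

lemma square_integrable_cong_AE:
  assumes "square_integrable f" "g \<in> borel_measurable borel" "AE x in lborel. f x = g x"
  shows "square_integrable g"
proof -
  have [measurable]: "f \<in> borel_measurable borel" "g \<in> borel_measurable borel"
    using assms by (auto simp: square_integrable_def)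
  have "integrable lborel (\<lambda>x. (cmod (g x))\<^sup>2) \<longleftrightarrow> integrable lborel (\<lambda>x. (cmod (f x))\<^sup>2)"
    by (rule integrable_cong_AE) (use assms(3) in auto)
  then show ?thesis
    using assms by (simp add: square_integrable_def)
qed

lemma test_function_funpow_deriv: "test_function \<phi> \<Longrightarrow> test_function ((deriv ^^ k) \<phi>)"
  by (induction k) (auto intro: test_function_deriv)

lemma has_weak_deriv_0: "has_weak_deriv 0 f f"
  by (simp add: has_weak_deriv_def)

lemma has_weak_deriv_abs_L2:
  assumes f: "square_integrable f" and g: "square_integrable g"
  shows "has_weak_deriv k (abs_L2 f) (abs_L2 g) \<longleftrightarrow>
    (\<forall>\<phi>. test_function \<phi> \<longrightarrow>
        (LINT x|lborel. complex_of_real ((deriv ^^ k) \<phi> x) * f x) =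
        (-1) ^ k * (LINT x|lborel. complex_of_real (\<phi> x) * g x))"
proof -
  have *: "(LINT x|lborel. complex_of_real (\<phi> x) * rep_L2 (abs_L2 h) x) = (LINT x|lborel. complex_of_real (\<phi> x) * h x)"
    if "test_function \<phi>" "square_integrable h" for \<phi> h
  proof (rule integral_cong_AE)
    have "square_integrable (\<lambda>x. complex_of_real (\<phi> x))"
      using that by (intro square_integrable_test_function)
    then have [measurable]: "(\<lambda>x. complex_of_real (\<phi> x)) \<in> borel_measurable borel"
      "h \<in> borel_measurable borel" "rep_L2 (abs_L2 h) \<in> borel_measurable borel"
      using that square_integrable_rep[of "abs_L2 h"] by (auto simp: square_integrable_def)
    show "(\<lambda>x. complex_of_real (\<phi> x) * rep_L2 (abs_L2 h) x) \<in> borel_measurable lborel"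
      "(\<lambda>x. complex_of_real (\<phi> x) * h x) \<in> borel_measurable lborel"
      by measurable
    show "AE x in lborel. complex_of_real (\<phi> x) * rep_L2 (abs_L2 h) x = complex_of_real (\<phi> x) * h x"
      using rep_L2_abs_L2[OF that(2)] by eventually_elim simp
  qed
  show ?thesis
    unfolding has_weak_deriv_def using *[OF _ f] *[OF _ g] test_function_funpow_deriv by simp
qed

lemma has_weak_deriv_2I:
  assumes "has_weak_deriv 1 f g" "has_weak_deriv 1 g h"
  shows "has_weak_deriv 2 f h"
  using assms test_function_deriv by (auto simp: has_weak_deriv_def numeral_2_eq_2)

text \<open>Membership in \<open>sobolev 2\<close> yields the first and the second derivative
  independently of each other; testing with \<open>deriv \<phi>\<close> in the first-order identity
  ties them together.\<close>

lemma has_weak_deriv_2D: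
  assumes "has_weak_deriv 1 f g" "has_weak_deriv 2 f h"
  shows "has_weak_deriv 1 g h"
  unfolding has_weak_deriv_def
proof (intro allI impI)
  fix \<phi> assume \<phi>: "test_function \<phi>"
  have "(LINT x|lborel. complex_of_real (deriv (deriv \<phi>) x) * rep_L2 f x)
      = - (LINT x|lborel. complex_of_real (deriv \<phi> x) * rep_L2 g x)"
    using assms(1) test_function_deriv[OF \<phi>] by (simp add: has_weak_deriv_def)
  moreover have "(LINT x|lborel. complex_of_real (deriv (deriv \<phi>) x) * rep_L2 f x)
      = (LINT x|lborel. complex_of_real (\<phi> x) * rep_L2 h x)"
    using assms(2) \<phi> by (simp add: has_weak_deriv_def numeral_2_eq_2)
  ultimately show "(LINT x|lborel. complex_of_real ((deriv ^^ 1) \<phi> x) * rep_L2 g x)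
      = (- 1) ^ 1 * (LINT x|lborel. complex_of_real (\<phi> x) * rep_L2 h x)"
    by simp
qed

lemma op_A_I:
  assumes "has_weak_deriv 1 y y'" "has_weak_deriv 1 y' y''"
    and "AE x in lborel. rep_L2 z x =
           complex_of_real (sgn x) * (- rep_L2 y'' x + complex_of_real (potential x) * rep_L2 y x)"
  shows "(y, z) \<in> op_A"
proof -
  have "\<exists>g. has_weak_deriv k y g" if "k \<le> 2" for k
  proof -
    have "k = 0 \<or> k = 1 \<or> k = 2"
      using that by auto
    then show ?thesis
      using has_weak_deriv_0 has_weak_deriv_2I[OF assms(1,2)] assms(1) by blast
  qed
  then show ?thesis
    using has_weak_deriv_2I[OF assms(1,2)] assms(3) by (auto simp: op_A_def sobolev_def)
qed

lemma has_weak_deriv_1_C1: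
  assumes "square_integrable f" "square_integrable g" "continuous_on UNIV g"
    and f: "\<And>x. (f has_vector_derivative g x) (at x)"
  shows "has_weak_deriv 1 (abs_L2 f) (abs_L2 g)"
proof -
  have f_cont: "continuous_on A f" for A
    using f by (meson continuous_at_imp_continuous_on has_vector_derivative_continuous)
  have "(LINT x|lborel. complex_of_real (deriv \<phi> x) * f x) = - (LINT x|lborel. complex_of_real (\<phi> x) * g x)"
    if \<phi>: "test_function \<phi>" for \<phi>
  proof -
    note \<phi>' = test_function_deriv[OF \<phi>]
    obtain M1 where M1: "0 < M1" "\<And>x. x \<notin> {-M1..M1} \<Longrightarrow> \<phi> x = 0"
      using test_function_support[OF \<phi>] by blast
    obtain M2 where M2: "0 < M2" "\<And>x. x \<notin> {-M2..M2} \<Longrightarrow> deriv \<phi> x = 0"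
      using test_function_support[OF \<phi>'] by blast
    define M where "M = M1 + M2"
    have M: "\<phi> M = 0" "\<phi> (- M) = 0"
      using M1 M2(1) by (auto simp: M_def)
    have vanish: "\<phi> x = 0" "deriv \<phi> x = 0" if "x \<notin> {-M..M}" for x
      using that M1(1) M2(1) by (auto intro!: M1(2) M2(2) simp: M_def)
    have "(LINT x|lborel. indicator {-M..M} x *\<^sub>R (complex_of_real (deriv \<phi> x) * f x + complex_of_real (\<phi> x) * g x))
        = complex_of_real (\<phi> M) * f M - complex_of_real (\<phi> (- M)) * f (- M)"
    proof (rule integral_FTC_atLeastAtMost)
      show "- M \<le> M"
        using M1(1) M2(1) by (simp add: M_def)
      show "((\<lambda>x. complex_of_real (\<phi> x) * f x) has_vector_derivative
          complex_of_real (deriv \<phi> x) * f x + complex_of_real (\<phi> x) * g x) (at x within {- M..M})" for x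
      proof -
        have "((\<lambda>x. complex_of_real (\<phi> x)) has_vector_derivative complex_of_real (deriv \<phi> x)) (at x)"
          by (rule bounded_linear.has_vector_derivative[OF bounded_linear_of_real])
            (simp add: has_real_derivative_iff_has_vector_derivative[symmetric] test_function_has_derivative[OF \<phi>])
        from has_vector_derivative_mult[OF this f[of x]] show ?thesis
          by (rule has_vector_derivative_at_within[OF has_vector_derivative_eq_rhs]) (rule add.commute)
      qed
      show "continuous_on {-M..M} (\<lambda>x. complex_of_real (deriv \<phi> x) * f x + complex_of_real (\<phi> x) * g x)"
        by (intro continuous_intros f_cont test_function_continuous \<phi> \<phi>' continuous_on_subset[OF assms(3)]) auto
    qed
    also have "\<dots> = 0"
      by (simp add: M)
    also have "(\<lambda>x. indicator {-M..M} x *\<^sub>R (complex_of_real (deriv \<phi> x) * f x + complex_of_real (\<phi> x) * g x))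
        = (\<lambda>x. complex_of_real (deriv \<phi> x) * f x + complex_of_real (\<phi> x) * g x)"
      by (auto simp: fun_eq_iff indicator_def vanish)
    finally show ?thesis
      using assms(1,2)
      by (subst (asm) Bochner_Integration.integral_add)
        (auto intro!: integrable_mult_square_integrable square_integrable_test_function \<phi> \<phi>'
          simp: eq_neg_iff_add_eq_0)
  qed
  then show ?thesis
    by (simp add: has_weak_deriv_abs_L2 assms)
qed

lemma C2_imp_op_A:
  assumes "square_integrable f" "square_integrable f'" "square_integrable f''" "square_integrable g"
    and f: "\<And>x. (f has_vector_derivative f' x) (at x)"
    and f': "\<And>x. (f' has_vector_derivative f'' x) (at x)"
    and "continuous_on UNIV f''"
    and g: "\<And>x. g x = complex_of_real (sgn x) * (- f'' x + complex_of_real (potential x) * f x)"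
  shows "(abs_L2 f, abs_L2 g) \<in> op_A"
proof (rule op_A_I)
  have "continuous_on UNIV f'"
    using f' by (meson continuous_at_imp_continuous_on has_vector_derivative_continuous)
  then show "has_weak_deriv 1 (abs_L2 f) (abs_L2 f')"
    by (intro has_weak_deriv_1_C1 assms)
  show "has_weak_deriv 1 (abs_L2 f') (abs_L2 f'')"
    by (intro has_weak_deriv_1_C1 assms)
  show "AE x in lborel. rep_L2 (abs_L2 g) x = complex_of_real (sgn x) *
      (- rep_L2 (abs_L2 f'') x + complex_of_real (potential x) * rep_L2 (abs_L2 f) x)"
    using rep_L2_abs_L2[OF assms(1)] rep_L2_abs_L2[OF assms(3)] rep_L2_abs_L2[OF assms(4)]
    by eventually_elim (simp add: g)
qed

text \<open>Weak equations become classical here: integrating the second weak derivative twice gives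
  a continuously differentiable representative \<open>U\<close> with derivative \<open>V\<close>.
  How often \<open>V\<close> is differentiable depends on the right-hand side, known only almost
  everywhere; hence the last clause takes any \<open>h\<close> that represents it and differentiates
  \<open>V\<close> wherever \<open>h\<close> is continuous.\<close>

lemma op_A_regular:
  assumes "(u, v) \<in> op_A"
  obtains U V where "square_integrable U" "square_integrable V" "AE x in lborel. rep_L2 u x = U x"
    "\<And>x. (U has_vector_derivative V x) (at x)" "continuous_on UNIV V"
    "\<And>h x. h \<in> borel_measurable borel \<Longrightarrow> isCont h x \<Longrightarrow>
       AE t in lborel. complex_of_real (potential t) * rep_L2 u t - complex_of_real (sgn t) * rep_L2 v t = h t \<Longrightarrow>
       (V has_vector_derivative h x) (at x)"
proof -
  have "\<exists>u'. has_weak_deriv 1 u u'"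
    using assms by (auto simp: op_A_def sobolev_def)
  then obtain u' u'' where u: "has_weak_deriv 1 u u'" "has_weak_deriv 2 u u''"
    and v: "AE x in lborel. rep_L2 v x =
           complex_of_real (sgn x) * (- rep_L2 u'' x + complex_of_real (potential x) * rep_L2 u x)"
    using assms unfolding op_A_def by blast
  obtain c where c: "AE x in lborel. rep_L2 u x = c + primitive (rep_L2 u') x"
    using weak_deriv_1_imp_primitive[OF u(1)] by blast
  obtain d where d: "AE x in lborel. rep_L2 u' x = d + primitive (rep_L2 u'') x"
    using weak_deriv_1_imp_primitive[OF has_weak_deriv_2D[OF u]] by blast
  define V where "V x = d + primitive (rep_L2 u'') x" for x
  define U where "U x = c + primitive V x" for x
  have V_cont: "continuous_on UNIV V"
    unfolding V_def by (intro continuous_intros continuous_on_primitive square_integrable_rep)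
  have V: "AE x in lborel. rep_L2 u' x = V x"
    using d by (simp add: V_def)
  have V_sq: "square_integrable V"
    using square_integrable_rep _ V
    by (rule square_integrable_cong_AE) (rule borel_measurable_continuous_onI[OF V_cont])
  have "primitive (rep_L2 u') = primitive V"
    using V square_integrable_rep[of u'] V_sq by (intro primitive_cong_AE) (auto simp: square_integrable_def)
  then have U: "AE x in lborel. rep_L2 u x = U x"
    using c by (simp add: U_def)
  have U_cont: "continuous_on UNIV U"
    unfolding U_def by (intro continuous_intros continuous_on_primitive V_sq)
  have U_sq: "square_integrable U"
    using square_integrable_rep _ U
    by (rule square_integrable_cong_AE) (rule borel_measurable_continuous_onI[OF U_cont])
  have U_deriv: "(U has_vector_derivative V x) (at x)" for x
  proof -
    have "isCont V x"
      using V_cont by (simp add: continuous_on_eq_continuous_at)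
    then have "((\<lambda>x. c + primitive V x) has_vector_derivative 0 + V x) (at x)"
      by (intro has_vector_derivative_add has_vector_derivative_const primitive_has_vector_derivative V_sq)
    then show ?thesis
      by (simp add: U_def[abs_def])
  qed
  show ?thesis
  proof (rule that[OF U_sq V_sq U U_deriv V_cont])
    fix h x
    assume h: "h \<in> borel_measurable borel" "isCont h x"
      and eq: "AE t in lborel. complex_of_real (potential t) * rep_L2 u t - complex_of_real (sgn t) * rep_L2 v t = h t"
    \<comment> \<open>Off \<open>0\<close> the square of \<open>sgn\<close> is \<open>1\<close>, so
      the equation defining \<open>op_A\<close> can be solved for the second derivative.\<close>
    have u''h: "AE t in lborel. rep_L2 u'' t = h t"
      using v eq AE_lborel_singleton[of 0]
      by eventually_elim (auto simp: sgn_if split: if_splits)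
    have h_sq: "square_integrable h"
      by (rule square_integrable_cong_AE[OF square_integrable_rep h(1) u''h])
    have "primitive (rep_L2 u'') = primitive h"
      using u''h square_integrable_rep[of u''] h(1) by (intro primitive_cong_AE) (auto simp: square_integrable_def)
    moreover have "((\<lambda>x. d + primitive h x) has_vector_derivative 0 + h x) (at x)"
      by (intro has_vector_derivative_add has_vector_derivative_const primitive_has_vector_derivative h_sq h)
    ultimately show "(V has_vector_derivative h x) (at x)"
      by (simp add: V_def[abs_def])
  qed
qed

section \<open>Solutions at energy zero\<close>

lemma integrable_even:
  fixes f F :: "real \<Rightarrow> real"
  assumes [measurable]: "f \<in> borel_measurable borel" and even: "\<And>x. f (- x) = f x" and nonneg: "\<And>x. 0 \<le> f x"
    and F: "\<And>x. 0 \<le> x \<Longrightarrow> DERIV F x :> f x" "(F \<longlongrightarrow> T) at_top"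
  shows "integrable lborel f"
proof (rule integrableI_nonneg)
  have right: "(\<integral>\<^sup>+x. ennreal (f x) * indicator {0..} x \<partial>lborel) = ennreal (T - F 0)"
    by (rule nn_integral_FTC_atLeast[OF _ F(1) _ F(2)]) (auto simp: nonneg)
  have "(\<integral>\<^sup>+x. ennreal (f x) * indicator {..0} x \<partial>lborel)
      = (\<integral>\<^sup>+x. ennreal (f (- x)) * indicator {..0} (- x) \<partial>lborel)"
    by (subst nn_integral_real_affine[where c = "-1" and t = 0]) auto
  also have "\<dots> = (\<integral>\<^sup>+x. ennreal (f x) * indicator {0..} x \<partial>lborel)"
    by (rule nn_integral_cong) (auto simp: even indicator_def)
  finally have left: "(\<integral>\<^sup>+x. ennreal (f x) * indicator {..0} x \<partial>lborel) = ennreal (T - F 0)"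
    by (simp add: right)
  have "(\<integral>\<^sup>+x. ennreal (f x) \<partial>lborel)
      \<le> (\<integral>\<^sup>+x. ennreal (f x) * indicator {0..} x + ennreal (f x) * indicator {..0} x \<partial>lborel)"
    by (rule nn_integral_mono) (auto simp: indicator_def)
  also have "\<dots> = ennreal (T - F 0) + ennreal (T - F 0)"
    by (subst nn_integral_add) (auto simp: left right)
  also have "\<dots> < \<infinity>"
    by simp
  finally show "(\<integral>\<^sup>+x. ennreal (f x) \<partial>lborel) < \<infinity>" .
qed (use nonneg in auto)

lemma integrable_inverse_square: "integrable lborel (\<lambda>x :: real. (1 / (1 + \<bar>x\<bar>))\<^sup>2)"
proof (rule integrable_even)
  show "((\<lambda>x. - 1 / (1 + x)) has_real_derivative (1 / (1 + \<bar>x\<bar>))\<^sup>2) (at x)" if "0 \<le> x" for x :: real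
    using that by (auto intro!: derivative_eq_intros simp: field_simps power2_eq_square)
  have "filterlim (\<lambda>x :: real. 1 + x) at_top at_top"
    by (rule filterlim_tendsto_add_at_top[OF tendsto_const filterlim_ident])
  then show "((\<lambda>x :: real. - 1 / (1 + x)) \<longlongrightarrow> 0) at_top"
    by (rule tendsto_divide_0[OF tendsto_const filterlim_at_top_imp_at_infinity])
qed auto

lemma integrable_exp_abs:
  assumes "0 < a"
  shows "integrable lborel (\<lambda>x :: real. exp (- (a * \<bar>x\<bar>)))"
proof (rule integrable_even)
  show "((\<lambda>x. - exp (- (a * x)) / a) has_real_derivative exp (- (a * \<bar>x\<bar>))) (at x)" if "0 \<le> x" for x :: real
    using that assms by (auto intro!: derivative_eq_intros)
  have "filterlim (\<lambda>x. a * x) at_top at_top"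
    by (rule filterlim_tendsto_pos_mult_at_top[OF tendsto_const assms filterlim_ident])
  then have "((\<lambda>x. exp (- (a * x))) \<longlongrightarrow> 0) at_top"
    by (intro filterlim_compose[OF exp_at_bot] filterlim_compose[OF filterlim_uminus_at_bot_at_top])
  then have "((\<lambda>x. - exp (- (a * x)) / a) \<longlongrightarrow> - 0 / a) at_top"
    by (intro tendsto_intros) (use assms in auto)
  then show "((\<lambda>x. - exp (- (a * x)) / a) \<longlongrightarrow> 0) at_top"
    by simp
qed auto

lemma square_integrable_of_real:
  assumes "f \<in> borel_measurable borel" "\<And>x. \<bar>f x\<bar> \<le> C / (1 + \<bar>x\<bar>)"
  shows "square_integrable (\<lambda>x. complex_of_real (f x))"
proof -
  have "integrable lborel (\<lambda>x. C\<^sup>2 * (1 / (1 + \<bar>x\<bar>))\<^sup>2)"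
    by (intro integrable_mult_right integrable_inverse_square)
  then have "integrable lborel (\<lambda>x. (f x)\<^sup>2)"
  proof (rule Bochner_Integration.integrable_bound)
    have "(f x)\<^sup>2 \<le> C\<^sup>2 * (1 / (1 + \<bar>x\<bar>))\<^sup>2" for x
      using power_mono[OF assms(2)[of x], of 2] by (simp add: power_divide)
    then show "AE x in lborel. norm ((f x)\<^sup>2) \<le> norm (C\<^sup>2 * (1 / (1 + \<bar>x\<bar>))\<^sup>2)"
      by (intro AE_I2) simp
  qed (use assms in auto)
  then show ?thesis
    using assms by (simp add: square_integrable_def)
qed

section \<open>The rational functions at energy zero and their bounds\<close>

definition tau :: "real \<Rightarrow> real" where "tau x = \<bar>x\<bar> ^ 3 + 3"

lemma tau_ge: "3 \<le> tau x" "\<bar>x\<bar> \<le> tau x" "\<bar>x\<bar>\<^sup>2 \<le> tau x" "1 + \<bar>x\<bar> \<le> tau x" "\<bar>x\<bar> + \<bar>x\<bar>\<^sup>2 \<le> tau x"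
proof -
  define r where "r = \<bar>x\<bar>"
  have r: "0 \<le> r"
    by (simp add: r_def)
  have "0 \<le> r ^ 3" "r\<^sup>2 \<le> r ^ 3 + 1" "r \<le> r ^ 3 + 1"
  proof -
    show "0 \<le> r ^ 3"
      using r by simp
    show "r\<^sup>2 \<le> r ^ 3 + 1"
    proof (cases "1 \<le> r")
      case True
      then have "r\<^sup>2 \<le> r ^ 3"
        by (rule power_increasing[rotated]) simp
      then show ?thesis
        by simp
    next
      case False
      then have "r\<^sup>2 \<le> 1"
        using r by (simp add: power_le_one)
      then show ?thesis
        using \<open>0 \<le> r ^ 3\<close> by linarith
    qed
    show "r \<le> r ^ 3 + 1"
    proof (cases "1 \<le> r")
      case True
      then have "r ^ 1 \<le> r ^ 3"
        by (rule power_increasing[rotated]) simp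
      then show ?thesis
        by simp
    next
      case False
      then show ?thesis
        using \<open>0 \<le> r ^ 3\<close> by linarith
    qed
  qed
  moreover have "r + r\<^sup>2 \<le> r ^ 3 + 1"
  proof -
    have "0 \<le> (r - 1)\<^sup>2 * (r + 1)"
      using r by simp
    then show ?thesis
      by (simp add: algebra_simps power2_eq_square power3_eq_cube)
  qed
  ultimately show "3 \<le> tau x" "\<bar>x\<bar> \<le> tau x" "\<bar>x\<bar>\<^sup>2 \<le> tau x" "1 + \<bar>x\<bar> \<le> tau x" "\<bar>x\<bar> + \<bar>x\<bar>\<^sup>2 \<le> tau x"
    by (simp_all add: tau_def r_def)
qed

lemma tau_pos [simp]: "0 < tau x" "tau x \<noteq> 0"
  using tau_ge(1)[of x] by auto

lemma abs_tau [simp]: "\<bar>tau x\<bar> = tau x"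
  by (simp add: less_imp_le)

lemma abs_le_divide_tau:
  assumes "\<bar>a\<bar> \<le> C * tau x"
  shows "\<bar>a / (tau x)\<^sup>2\<bar> \<le> C / (1 + \<bar>x\<bar>)"
proof -
  have C: "0 \<le> C"
    using assms tau_pos(1)[of x] by (smt (verit) zero_le_mult_iff)
  have "\<bar>a / (tau x)\<^sup>2\<bar> = \<bar>a\<bar> / (tau x)\<^sup>2"
    by simp
  also have "\<dots> \<le> C * tau x / (tau x)\<^sup>2"
    by (rule divide_right_mono[OF assms]) simp
  also have "\<dots> = C / tau x"
    by (simp add: power2_eq_square)
  also have "\<dots> \<le> C / (1 + \<bar>x\<bar>)"
    using C tau_ge(4)[of x] by (intro divide_left_mono) auto
  finally show ?thesis .
qed

text \<open>Confines the case distinction at \<open>0\<close> to one place: writing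
  \<open>\<bar>x\<bar> ^ 3\<close> as \<open>x * (x * \<bar>x\<bar>)\<close>, the derivatives of
  \<open>tau\<close> and of quotients by it need none.\<close>

lemma has_derivative_abs_mult: "((\<lambda>x::real. x * \<bar>x\<bar>) has_real_derivative 2 * \<bar>x\<bar>) (at x)"
proof -
  consider "x < 0" | "x = 0" | "0 < x"
    by linarith
  then show ?thesis
  proof cases
    case 1
    have "((\<lambda>x. - (x * x)) has_real_derivative 2 * \<bar>x\<bar>) (at x)"
      using 1 by (auto intro!: derivative_eq_intros)
    then show ?thesis
      by (rule has_field_derivative_transform_within_open[where S = "{..<0}"]) (use 1 in auto)
  next
    case 2
    have "((\<lambda>h::real. \<bar>h\<bar>) \<longlongrightarrow> 0) (at 0)"
      by (intro tendsto_rabs_zero tendsto_ident_at)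
    then have "((\<lambda>h::real. h * \<bar>h\<bar> / h) \<longlongrightarrow> 0) (at 0)"
      by (rule Lim_transform_eventually) (auto simp: eventually_at_filter)
    then show ?thesis
      using 2 by (simp add: DERIV_def)
  next
    case 3
    have "((\<lambda>x. x * x) has_real_derivative 2 * \<bar>x\<bar>) (at x)"
      using 3 by (auto intro!: derivative_eq_intros)
    then show ?thesis
      by (rule has_field_derivative_transform_within_open[where S = "{0<..}"]) (use 3 in auto)
  qed
qed

lemma abs_cube: "\<bar>x\<bar> ^ 3 = x * (x * \<bar>x::real\<bar>)"
  by (simp add: power3_eq_cube abs_if)

lemma tau_deriv: "(tau has_real_derivative 3 * (x * \<bar>x\<bar>)) (at x)"
proof -
  have "((\<lambda>x. x * (x * \<bar>x\<bar>) + 3) has_real_derivative 3 * (x * \<bar>x\<bar>)) (at x)"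
    using DERIV_add[OF DERIV_mult'[OF DERIV_ident has_derivative_abs_mult] DERIV_const] by simp
  then show ?thesis
    by (simp add: tau_def[abs_def] abs_cube)
qed

lemma continuous_tau [continuous_intros]: "continuous_on A tau"
  unfolding tau_def by (intro continuous_intros)

definition y0 :: "real \<Rightarrow> real" where "y0 x = x / tau x"
definition y0' :: "real \<Rightarrow> real" where "y0' x = (3 - 2 * \<bar>x\<bar> ^ 3) / (tau x)\<^sup>2"

text \<open>Since \<open>- u0'' + q u0 = \<bar>y0\<bar>\<close>, formally \<open>A u0 = y0\<close>.\<close>

definition u0 :: "real \<Rightarrow> real" where "u0 x = (\<bar>x\<bar> ^ 3 - 6) / (6 * tau x)"
definition u0' :: "real \<Rightarrow> real" where "u0' x = 9 / 2 * (x * \<bar>x\<bar>) / (tau x)\<^sup>2"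

lemma continuous_potential [continuous_intros]: "continuous_on A potential"
proof -
  have "(\<bar>x\<bar> ^ 3 + 3)\<^sup>2 \<noteq> 0" for x :: real
    using tau_pos(2)[of x] by (simp add: tau_def)
  then show ?thesis
    unfolding potential_def by (intro continuous_intros) auto
qed

lemma potential_tau: "potential x = 6 * (x ^ 4 - 6 * \<bar>x\<bar>) / (tau x)\<^sup>2"
  by (simp add: potential_def tau_def)

lemma y0_deriv: "(y0 has_real_derivative y0' x) (at x)"
proof -
  have "((\<lambda>x. x / tau x) has_real_derivative (1 * tau x - x * (3 * (x * \<bar>x\<bar>))) / (tau x * tau x)) (at x)"
    by (intro DERIV_divide DERIV_ident tau_deriv) simp
  moreover have "1 * tau x - x * (3 * (x * \<bar>x\<bar>)) = 3 - 2 * \<bar>x\<bar> ^ 3"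
    unfolding tau_def abs_cube by simp
  ultimately show ?thesis
    by (simp add: y0_def[abs_def] y0'_def power2_eq_square)
qed

text \<open>In terms of \<open>tau\<close>, \<open>\<bar>x\<bar>\<close> and
  \<open>x * \<bar>x\<bar>\<close>, the differential equations of \<open>y0\<close> and
  \<open>u0\<close> become polynomial identities once the powers of \<open>tau\<close> are
  cleared.\<close>

lemma potential_eq: "potential x = 6 * (\<bar>x\<bar> * (tau x - 9)) / (tau x)\<^sup>2"
proof -
  have "x ^ 4 = \<bar>x\<bar> * \<bar>x\<bar> ^ 3"
    by (simp add: power_Suc[symmetric] del: power_Suc)
  then show ?thesis
    by (simp add: potential_def tau_def algebra_simps)
qed

lemma y0'_deriv: "(y0' has_real_derivative potential x * y0 x) (at x)"
proof -
  have eq: "y0' = (\<lambda>x. (9 - 2 * tau x) / (tau x)\<^sup>2)"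
    by (simp add: fun_eq_iff y0'_def tau_def)
  have "((\<lambda>x. (9 - 2 * tau x) / (tau x)\<^sup>2) has_real_derivative
      ((0 - 2 * (3 * (x * \<bar>x\<bar>))) * (tau x)\<^sup>2 - (9 - 2 * tau x) * (2 * (tau x ^ 1 * (3 * (x * \<bar>x\<bar>))))) / ((tau x)\<^sup>2 * (tau x)\<^sup>2)) (at x)"
    by (rule DERIV_divide) (auto intro!: derivative_eq_intros tau_deriv)
  also have "((0 - 2 * (3 * (x * \<bar>x\<bar>))) * (tau x)\<^sup>2 - (9 - 2 * tau x) * (2 * (tau x ^ 1 * (3 * (x * \<bar>x\<bar>))))) / ((tau x)\<^sup>2 * (tau x)\<^sup>2)
    = potential x * y0 x"
    unfolding potential_eq y0_def
    by (simp add: divide_simps) (simp add: algebra_simps power2_eq_square power4_eq_xxxx)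
  finally show ?thesis
    by (simp add: eq)
qed

lemma u0_deriv: "(u0 has_real_derivative u0' x) (at x)"
proof -
  have eq: "u0 = (\<lambda>x. 1 / 6 - 3 / 2 / tau x)"
    by (auto simp: fun_eq_iff u0_def divide_simps) (simp add: tau_def)
  have "((\<lambda>x. 1 / 6 - 3 / 2 / tau x) has_real_derivative 0 - (0 * tau x - 3 / 2 * (3 * (x * \<bar>x\<bar>))) / (tau x * tau x)) (at x)"
    by (intro derivative_intros tau_deriv DERIV_divide) simp
  then show ?thesis
    by (simp add: eq u0'_def power2_eq_square)
qed

lemma u0'_deriv: "(u0' has_real_derivative potential x * u0 x - \<bar>y0 x\<bar>) (at x)"
proof -
  have xx: "x * \<bar>x\<bar> * (x * \<bar>x\<bar>) = \<bar>x\<bar> * (tau x - 3)"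
    by (simp add: tau_def abs_cube algebra_simps)
  have u0: "u0 x = (tau x - 9) / (6 * tau x)"
    by (simp add: u0_def tau_def)
  have "((\<lambda>x. 9 / 2 * (x * \<bar>x\<bar>) / (tau x)\<^sup>2) has_real_derivative
      (9 / 2 * (2 * \<bar>x\<bar>) * (tau x)\<^sup>2 - 9 / 2 * (x * \<bar>x\<bar>) * (2 * (tau x ^ 1 * (3 * (x * \<bar>x\<bar>))))) / ((tau x)\<^sup>2 * (tau x)\<^sup>2)) (at x)"
  proof (rule DERIV_divide)
    show "((\<lambda>x. (tau x)\<^sup>2) has_real_derivative 2 * (tau x ^ 1 * (3 * (x * \<bar>x\<bar>)))) (at x)"
      by (auto intro!: derivative_eq_intros tau_deriv)
  qed (rule DERIV_cmult has_derivative_abs_mult, simp_all add: has_derivative_abs_mult)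
  also have "9 / 2 * (2 * \<bar>x\<bar>) * (tau x)\<^sup>2 - 9 / 2 * (x * \<bar>x\<bar>) * (2 * (tau x ^ 1 * (3 * (x * \<bar>x\<bar>))))
      = 9 * \<bar>x\<bar> * (tau x)\<^sup>2 - 27 * tau x * (x * \<bar>x\<bar> * (x * \<bar>x\<bar>))"
    by simp
  also have "(9 * \<bar>x\<bar> * (tau x)\<^sup>2 - 27 * tau x * (x * \<bar>x\<bar> * (x * \<bar>x\<bar>))) / ((tau x)\<^sup>2 * (tau x)\<^sup>2)
      = potential x * u0 x - \<bar>y0 x\<bar>"
    unfolding xx potential_eq u0 y0_def abs_divide
    by (simp add: divide_simps) (simp add: algebra_simps power2_eq_square power4_eq_xxxx)
  finally show ?thesis
    by (simp add: u0'_def[abs_def])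
qed

lemma y0_bound: "\<bar>y0 x\<bar> \<le> 1 / (1 + \<bar>x\<bar>)"
proof -
  have "\<bar>x\<bar> * (1 + \<bar>x\<bar>) \<le> tau x"
    using tau_ge(5)[of x] by (simp add: algebra_simps power2_eq_square)
  then show ?thesis
    by (simp add: y0_def abs_divide pos_divide_le_eq pos_le_divide_eq)
qed

lemma y0'_bound: "\<bar>y0' x\<bar> \<le> 2 / (1 + \<bar>x\<bar>)"
  unfolding y0'_def by (rule abs_le_divide_tau) (simp add: tau_def abs_le_iff)

lemma potential_bound: "\<bar>potential x\<bar> \<le> 12 / (1 + \<bar>x\<bar>)"
proof -
  have "\<bar>x ^ 4 - 6 * \<bar>x\<bar>\<bar> \<le> \<bar>x\<bar> * (\<bar>x\<bar> ^ 3 + 6)"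
  proof -
    have "x ^ 4 = \<bar>x\<bar> * \<bar>x\<bar> ^ 3"
      by (simp add: power_Suc[symmetric] del: power_Suc)
    then show ?thesis
      by (simp add: abs_le_iff distrib_left)
  qed
  also have "\<dots> \<le> \<bar>x\<bar> * (2 * tau x)"
    by (intro mult_left_mono) (auto simp: tau_def)
  finally have 1: "\<bar>x ^ 4 - 6 * \<bar>x\<bar>\<bar> \<le> 2 * \<bar>x\<bar> * tau x"
    by simp
  have "\<bar>potential x\<bar> = 6 * \<bar>x ^ 4 - 6 * \<bar>x\<bar>\<bar> / (tau x)\<^sup>2"
    by (simp only: potential_tau abs_divide abs_mult abs_numeral abs_power2)
  also have "\<dots> \<le> 6 * (2 * \<bar>x\<bar> * tau x) / (tau x)\<^sup>2"
    using 1 by (intro divide_right_mono) auto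
  also have "\<dots> = 12 * \<bar>y0 x\<bar>"
    by (simp add: y0_def abs_divide power2_eq_square)
  also have "\<dots> \<le> 12 / (1 + \<bar>x\<bar>)"
    using y0_bound[of x] by simp
  finally show ?thesis .
qed

lemma u0_bound: "\<bar>u0 x\<bar> \<le> 1"
proof -
  have "\<bar>\<bar>x\<bar> ^ 3 - 6\<bar> \<le> 6 * tau x"
    by (simp add: tau_def abs_le_iff)
  then show ?thesis
    by (simp add: u0_def abs_divide abs_mult pos_divide_le_eq)
qed

lemma u0'_bound: "\<bar>u0' x\<bar> \<le> 5 / (1 + \<bar>x\<bar>)"
  unfolding u0'_def
proof (rule abs_le_divide_tau)
  have "\<bar>9 / 2 * (x * \<bar>x\<bar>)\<bar> = 9 / 2 * \<bar>x\<bar>\<^sup>2"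
    by (simp add: abs_mult power2_eq_square)
  then show "\<bar>9 / 2 * (x * \<bar>x\<bar>)\<bar> \<le> 5 * tau x"
    using tau_ge(3)[of x] tau_pos(1)[of x] by linarith
qed

lemma u0''_bound: "\<bar>potential x * u0 x - \<bar>y0 x\<bar>\<bar> \<le> 13 / (1 + \<bar>x\<bar>)"
proof -
  have "\<bar>potential x * u0 x\<bar> \<le> 12 / (1 + \<bar>x\<bar>) * 1"
    unfolding abs_mult by (intro mult_mono potential_bound u0_bound) auto
  then show ?thesis
    using y0_bound[of x] by (simp add: abs_le_iff add_divide_distrib[symmetric]) (smt (verit) add_divide_distrib)
qed

section \<open>The kernel\<close>

lemma norm_abs_L2_integral:
  assumes "square_integrable f"
  shows "(LINT x|lborel. (cmod (f x))\<^sup>2) = (norm (abs_L2 f))\<^sup>2"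
proof -
  have "ennreal (LINT x|lborel. (cmod (f x))\<^sup>2) = ennreal ((norm (abs_L2 f))\<^sup>2)"
    using norm_abs_L2[OF assms] assms by (subst (asm) nn_integral_eq_integral) (auto simp: square_integrable_def)
  then show ?thesis
    by (simp add: ennreal_inj)
qed

lemma abs_L2_eq_0_iff:
  assumes "square_integrable f"
  shows "abs_L2 f = 0 \<longleftrightarrow> (AE x in lborel. f x = 0)"
proof
  assume "abs_L2 f = 0"
  then have "abs_L2 f = abs_L2 (\<lambda>x. 0)"
    by (simp add: zero_L2_def)
  then have "AE x in lborel. f x = rep_L2 (abs_L2 (\<lambda>x. 0)) x"
    using rep_L2_abs_L2[OF assms] by (simp add: eq_commute)
  then show "AE x in lborel. f x = 0"
    using rep_L2_abs_L2[OF square_integrable_0] by eventually_elim simp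
next
  assume "AE x in lborel. f x = 0"
  then show "abs_L2 f = 0"
    unfolding zero_L2_def by (intro abs_L2_eqI assms square_integrable_0)
qed

lemma scaleC_abs_L2: "square_integrable f \<Longrightarrow> c *\<^sub>C abs_L2 f = abs_L2 (\<lambda>x. c * f x)"
  by (rule scaleC_L2.abs_eq) (simp add: eq_L2_def)

text \<open>As \<open>T\<close> is its own adjoint, its kernel is orthogonal to its range.
  \<open>S y\<close> lies in that kernel, and it is the limit of the elements \<open>S (g n)\<close>
  of the range; so it is orthogonal to itself.\<close>

lemma self_adjoint_similar_closure_range:
  assumes T: "self_adjoint T" "similar_operators A T"
    and y: "(y, 0) \<in> A" and fg: "\<And>n. (f n, g n) \<in> A" and lim: "g \<longlonglongrightarrow> y"
  shows "y = 0"
proof -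
  obtain S S' where S: "bounded_clinear S" "bounded_clinear S'" "\<And>x. S' (S x) = x" "\<And>x. S (S' x) = x"
    and T_eq: "T = {(x, S y) | x y. (S' x, y) \<in> A}"
    using T(2) by (auto simp: similar_operators_def)
  have S_0: "S 0 = 0" and S'_0: "S' 0 = 0"
    using S(1,2) by (auto simp: bounded_clinear_def bounded_linear.linear linear_0)
  have "(S y, S 0) \<in> T"
    using y S(3) by (auto simp: T_eq)
  then have "(S y, 0) \<in> adjoint_operator T"
    using T(1) by (simp add: self_adjoint_def S_0)
  moreover have "(S (f n), S (g n)) \<in> T" for n
    using fg S(3) by (auto simp: T_eq)
  ultimately have "cinner (S (g n)) (S y) = cinner (S (f n)) 0" for n
    by (auto simp: adjoint_operator_def)
  moreover have "cinner x 0 = 0" for x :: 'a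
    using cinner_scaleC_left[of 0 "0 :: 'a" x] cinner_commute[of x 0] complex_vector.scale_zero_left[of "0 :: 'a"]
    by simp
  ultimately have "inner (S (g n)) (S y) = 0" for n
    by (simp only: inner_cinner zero_complex.sel)
  moreover have "(\<lambda>n. S (g n)) \<longlonglongrightarrow> S y"
    using S(1) by (intro bounded_linear.tendsto[OF _ lim]) (simp add: bounded_clinear_def)
  then have "(\<lambda>n. inner (S (g n)) (S y)) \<longlonglongrightarrow> inner (S y) (S y)"
    by (intro tendsto_inner tendsto_const)
  ultimately have "inner (S y) (S y) = 0"
    by (simp add: LIMSEQ_const_iff)
  then show "y = 0"
    using S(3)[of y] S'_0 by simp
qed

text \<open>The exceptional point serves Wronskians, whose differential equation jumps at
  \<open>0\<close>, and quotients by \<open>y0\<close>, which vanishes there.\<close>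

lemma constant_if_derivative_zero:
  fixes f :: "real \<Rightarrow> complex"
  assumes "continuous_on UNIV f" "\<And>x. x \<noteq> 0 \<Longrightarrow> (f has_vector_derivative 0) (at x)"
  shows "f x = f y"
  by (rule has_derivative_zero_unique_strong_convex[where S = UNIV and K = "{0}"])
    (use assms in \<open>auto simp: has_vector_derivative_def\<close>)

text \<open>Substitute for decay at infinity: a Wronskian of square integrable functions is merely
  integrable, but being constant on a set of infinite measure it must vanish.\<close>

lemma constant_set_integrable_imp_0:
  fixes c :: complex and A :: "real set"
  assumes "set_integrable lborel A (\<lambda>x. c)" "A \<in> sets borel" "emeasure lborel A = \<infinity>"
  shows "c = 0"
proof (rule ccontr)
  assume "c \<noteq> 0"
  have "integrable lborel (\<lambda>x. norm (indicator A x *\<^sub>R c) / cmod c)"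
    using assms(1) by (intro integrable_divide integrable_norm) (simp add: set_integrable_def)
  then have "integrable lborel (indicator A :: real \<Rightarrow> real)"
    using \<open>c \<noteq> 0\<close> by simp
  then show False
    using assms by (simp add: integrable_indicator_iff)
qed

lemma emeasure_lborel_halfline:
  "emeasure lborel {a :: real..} = \<infinity>" "emeasure lborel {..a :: real} = \<infinity>"
proof -
  have *: "emeasure lborel A = \<infinity>" if "A \<in> sets borel" and sub: "\<And>n. \<exists>b. {b..b + real n} \<subseteq> A" for A
  proof -
    have "of_nat n \<le> emeasure lborel A" for n
    proof -
      obtain b where "{b..b + real n} \<subseteq> A"
        using sub by blast
      then have "emeasure lborel {b..b + real n} \<le> emeasure lborel A"
        using that(1) by (intro emeasure_mono) auto
      then show ?thesis
        by (simp add: emeasure_lborel_Icc_eq ennreal_of_nat_eq_real_of_nat)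
    qed
    then have "\<not> emeasure lborel A < top"
      using ennreal_Ex_less_of_nat[of "emeasure lborel A"] not_le by blast
    then show ?thesis
      by (metis infinity_ennreal_def top.not_eq_extremum)
  qed
  show "emeasure lborel {a..} = \<infinity>"
    by (rule *) (auto intro!: exI[of _ a])
  show "emeasure lborel {..a} = \<infinity>"
  proof (rule *)
    show "\<exists>b. {b..b + real n} \<subseteq> {..a}" for n
      by (rule exI[of _ "a - real n"]) auto
  qed simp
qed

section \<open>The eigenfunction and its uniqueness\<close>

definition Y0 :: L2 where "Y0 = abs_L2 (\<lambda>x. complex_of_real (y0 x))"

lemma has_vector_derivative_of_real:
  "(f has_real_derivative f') (at x) \<Longrightarrow>
    ((\<lambda>x. complex_of_real (f x)) has_vector_derivative complex_of_real f') (at x)"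
  by (rule bounded_linear.has_vector_derivative[OF bounded_linear_of_real])
    (simp add: has_real_derivative_iff_has_vector_derivative)

lemma continuous_y0 [continuous_intros]: "continuous_on A y0"
  by (rule DERIV_continuous_on[OF has_field_derivative_at_within[OF y0_deriv]])

lemma continuous_y0' [continuous_intros]: "continuous_on A y0'"
  by (rule DERIV_continuous_on[OF has_field_derivative_at_within[OF y0'_deriv]])

lemma continuous_u0 [continuous_intros]: "continuous_on A u0"
  by (rule DERIV_continuous_on[OF has_field_derivative_at_within[OF u0_deriv]])

lemma continuous_u0' [continuous_intros]: "continuous_on A u0'"
  by (rule DERIV_continuous_on[OF has_field_derivative_at_within[OF u0'_deriv]])

lemma square_integrable_continuous_of_real:
  assumes "continuous_on UNIV f" "\<And>x. \<bar>f x\<bar> \<le> C / (1 + \<bar>x\<bar>)"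
  shows "square_integrable (\<lambda>x. complex_of_real (f x))"
  using assms by (intro square_integrable_of_real borel_measurable_continuous_onI)

lemma square_integrable_y0: "square_integrable (\<lambda>x. complex_of_real (y0 x))"
  by (rule square_integrable_continuous_of_real[OF continuous_y0 y0_bound])

lemma square_integrable_y0': "square_integrable (\<lambda>x. complex_of_real (y0' x))"
  by (rule square_integrable_continuous_of_real[OF continuous_y0' y0'_bound])

lemma Y0_nonzero: "Y0 \<noteq> 0"
proof
  assume "Y0 = 0"
  then have "AE x in lborel. complex_of_real (y0 x) = 0"
    by (simp add: Y0_def abs_L2_eq_0_iff[OF square_integrable_y0])
  then have "AE x in lborel :: real measure. False"
    using AE_lborel_singleton[of 0] by eventually_elim (simp add: y0_def)
  then show False
    by (simp add: ae_filter_eq_bot_iff eventually_False)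
qed

lemma potential_mult_y0_bound: "\<bar>potential x * y0 x\<bar> \<le> 12 / (1 + \<bar>x\<bar>)"
proof -
  have "\<bar>potential x\<bar> * \<bar>y0 x\<bar> \<le> 12 / (1 + \<bar>x\<bar>) * 1"
    using y0_bound[of x] by (intro mult_mono potential_bound) (auto intro: order_trans)
  then show ?thesis
    by (simp add: abs_mult)
qed

lemma Y0_in_kernel: "(c *\<^sub>C Y0, 0) \<in> op_A"
proof -
  have "(abs_L2 (\<lambda>x. c * complex_of_real (y0 x)), abs_L2 (\<lambda>x. 0)) \<in> op_A"
  proof (rule C2_imp_op_A[where f' = "\<lambda>x. c * complex_of_real (y0' x)"
        and f'' = "\<lambda>x. c * complex_of_real (potential x * y0 x)"])
    show "square_integrable (\<lambda>x. c * complex_of_real (potential x * y0 x))"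
      by (rule square_integrable_scale, rule square_integrable_continuous_of_real[OF _ potential_mult_y0_bound])
        (intro continuous_intros)
    show "((\<lambda>x. c * complex_of_real (y0 x)) has_vector_derivative c * complex_of_real (y0' x)) (at x)"
      "((\<lambda>x. c * complex_of_real (y0' x)) has_vector_derivative c * complex_of_real (potential x * y0 x)) (at x)" for x
      by (intro has_vector_derivative_mult_right has_vector_derivative_of_real y0_deriv y0'_deriv)+
    show "continuous_on UNIV (\<lambda>x. c * complex_of_real (potential x * y0 x))"
      by (intro continuous_intros)
  qed (auto intro: square_integrable_scale square_integrable_y0 square_integrable_y0' square_integrable_0)
  then show ?thesis
    by (simp add: Y0_def scaleC_abs_L2 square_integrable_y0 zero_L2_def)
qed

text \<open>Off \<open>0\<close> the quotient \<open>D / y0\<close> has derivative zero. This alone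
  would allow different constants on the two half-lines; they agree because the Wronskian at
  \<open>0\<close> forces \<open>D 0 = 0\<close>, so that the quotient extends continuously across
  the simple zero of \<open>y0\<close>.\<close>

lemma multiple_of_y0_if_wronskian_zero:
  assumes D: "\<And>x. (D has_vector_derivative D' x) (at x)"
    and W: "\<And>x. D x * complex_of_real (y0' x) - D' x * complex_of_real (y0 x) = 0"
  obtains c where "\<And>x. D x = c * complex_of_real (y0 x)"
proof -
  have D_0: "D 0 = 0"
    using W[of 0] by (simp add: y0_def y0'_def tau_def)
  \<comment> \<open>Since \<open>y0 x = x / tau x\<close>, the quotient is \<open>D x / x\<close>
    times \<open>tau x\<close>; it tends to \<open>D' 0 * tau 0\<close>, and
    \<open>tau 0 = 3\<close>.\<close>
  define F where "F x = (if x = 0 then 3 * D' 0 else D x / complex_of_real (y0 x))" for x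
  have F_deriv: "(F has_vector_derivative 0) (at x)" if "x \<noteq> 0" for x
  proof -
    have y0: "y0 x \<noteq> 0"
      using that by (simp add: y0_def)
    have "((\<lambda>x. D x / complex_of_real (y0 x)) has_vector_derivative
        (D' x * complex_of_real (y0 x) - D x * complex_of_real (y0' x)) / (complex_of_real (y0 x))\<^sup>2) (at x)"
    proof -
      have "((\<lambda>x. complex_of_real (inverse (y0 x))) has_vector_derivative complex_of_real (- (inverse (y0 x) * y0' x * inverse (y0 x)))) (at x)"
        using y0 by (intro has_vector_derivative_of_real DERIV_inverse' y0_deriv)
      from has_vector_derivative_mult[OF D[of x] this] show ?thesis
        using y0 by (simp add: divide_inverse power2_eq_square algebra_simps)
    qed
    moreover have "D' x * complex_of_real (y0 x) - D x * complex_of_real (y0' x) = 0"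
      using W[of x] by simp
    ultimately have "((\<lambda>x. D x / complex_of_real (y0 x)) has_vector_derivative 0) (at x)"
      by simp
    then show ?thesis
      by (rule has_vector_derivative_transform_within_open[where S = "- {0}"])
        (use that in \<open>auto simp: F_def\<close>)
  qed
  have "isCont F 0"
  proof -
    have "((\<lambda>h. (D (0 + h) - D 0) /\<^sub>R h) \<longlongrightarrow> D' 0) (at 0)"
    proof (rule LIM_zero_cancel, rule tendsto_norm_zero_cancel)
      have "((\<lambda>h. norm (D (0 + h) - D 0 - h *\<^sub>R D' 0) / norm h) \<longlongrightarrow> 0) (at 0)"
        using D[of 0] by (simp add: has_vector_derivative_def has_derivative_at)
      then show "((\<lambda>h. norm ((D (0 + h) - D 0) /\<^sub>R h - D' 0)) \<longlongrightarrow> 0) (at 0)"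
      proof (rule Lim_transform_eventually)
        have "norm (D (0 + h) - D 0 - h *\<^sub>R D' 0) / norm h = norm ((D (0 + h) - D 0) /\<^sub>R h - D' 0)" if "h \<noteq> 0" for h
        proof -
          have "(D (0 + h) - D 0) /\<^sub>R h - D' 0 = (D (0 + h) - D 0 - h *\<^sub>R D' 0) /\<^sub>R h"
            using that by (simp add: scaleR_diff_right)
          then show ?thesis
            by (simp add: divide_inverse mult.commute)
        qed
        then show "\<forall>\<^sub>F h in at 0. norm (D (0 + h) - D 0 - h *\<^sub>R D' 0) / norm h = norm ((D (0 + h) - D 0) /\<^sub>R h - D' 0)"
          by (simp add: eventually_at_filter)
      qed
    qed
    then have "((\<lambda>h. (D (0 + h) - D 0) /\<^sub>R h * complex_of_real (tau h)) \<longlongrightarrow> D' 0 * complex_of_real (tau 0)) (at 0)"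
      using continuous_tau[of UNIV] by (intro tendsto_intros) (auto simp: continuous_on_def)
    then have "(F \<longlongrightarrow> D' 0 * complex_of_real (tau 0)) (at 0)"
      by (rule Lim_transform_eventually)
        (auto simp: eventually_at_filter F_def D_0 y0_def scaleR_conv_of_real field_simps)
    then show ?thesis
      by (simp add: isCont_def F_def tau_def mult.commute)
  qed
  moreover have "isCont F x" if "x \<noteq> 0" for x
    using F_deriv[OF that] by (rule has_vector_derivative_continuous)
  ultimately have "continuous_on UNIV F"
    by (metis continuous_at_imp_continuous_on)
  then have F: "F x = F 0" for x
    by (rule constant_if_derivative_zero) (rule F_deriv)
  have "D x = F 0 * complex_of_real (y0 x)" for x
  proof (cases "x = 0")
    case True
    then show ?thesis
      by (simp add: D_0 y0_def)
  next
    case False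
    then show ?thesis
      using F[of x] by (simp add: F_def y0_def field_simps split: if_splits)
  qed
  then show ?thesis
    by (rule that)
qed

lemma wronskian_y0_constant:
  assumes D: "\<And>x. (D has_vector_derivative D' x) (at x)"
    and D': "\<And>x. (D' has_vector_derivative complex_of_real (potential x) * D x) (at x)"
  shows "D x * complex_of_real (y0' x) - D' x * complex_of_real (y0 x) =
    D z * complex_of_real (y0' z) - D' z * complex_of_real (y0 z)"
proof (rule constant_if_derivative_zero)
  have der: "((\<lambda>x. D x * complex_of_real (y0' x) - D' x * complex_of_real (y0 x)) has_vector_derivative 0) (at x)" for x
  proof -
    have "((\<lambda>x. D x * complex_of_real (y0' x) - D' x * complex_of_real (y0 x)) has_vector_derivative
      (D x * complex_of_real (potential x * y0 x) + D' x * complex_of_real (y0' x)) -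
      (D' x * complex_of_real (y0' x) + complex_of_real (potential x) * D x * complex_of_real (y0 x))) (at x)"
      by (intro has_vector_derivative_diff has_vector_derivative_mult D D' has_vector_derivative_of_real y0_deriv y0'_deriv)
    then show ?thesis
      by (simp add: algebra_simps)
  qed
  then show "continuous_on UNIV (\<lambda>x. D x * complex_of_real (y0' x) - D' x * complex_of_real (y0 x))"
    by (meson continuous_at_imp_continuous_on has_vector_derivative_continuous)
  show "((\<lambda>x. D x * complex_of_real (y0' x) - D' x * complex_of_real (y0 x)) has_vector_derivative 0) (at x)" for x
    by (rule der)
qed

lemma inverse_bound_le_square: "1 / tau x \<le> 2 * (1 / (1 + \<bar>x\<bar>))\<^sup>2"
proof -
  have "(1 + \<bar>x\<bar>)\<^sup>2 \<le> 2 * tau x"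
    using tau_ge(4,5)[of x] by (simp add: power2_sum)
  then show ?thesis
    by (simp add: divide_simps)
qed

lemma integrable_of_square_bound:
  assumes "f \<in> borel_measurable borel" "\<And>x. cmod (f x) \<le> C * (1 / (1 + \<bar>x\<bar>))\<^sup>2"
  shows "integrable lborel f"
proof (rule Bochner_Integration.integrable_bound)
  show "integrable lborel (\<lambda>x. C * (1 / (1 + \<bar>x\<bar>))\<^sup>2)"
    by (intro integrable_mult_right integrable_inverse_square)
  show "AE x in lborel. norm (f x) \<le> norm (C * (1 / (1 + \<bar>x\<bar>))\<^sup>2)"
    unfolding real_norm_def by (intro AE_I2 order_trans[OF assms(2) abs_ge_self])
qed (use assms(1) in simp)

lemma multiple_of_Y0:
  assumes "AE x in lborel. rep_L2 u x = c * complex_of_real (y0 x)"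
  shows "u = c *\<^sub>C Y0"
proof -
  have "u = abs_L2 (rep_L2 u)"
    by (simp add: abs_L2_rep_L2)
  also have "\<dots> = abs_L2 (\<lambda>x. c * complex_of_real (y0 x))"
    by (intro abs_L2_eqI square_integrable_rep square_integrable_scale square_integrable_y0 assms)
  also have "\<dots> = c *\<^sub>C Y0"
    by (simp add: Y0_def scaleC_abs_L2 square_integrable_y0)
  finally show ?thesis .
qed

lemma integrable_constant_imp_0:
  fixes c :: complex
  assumes "integrable lborel f" "\<And>x :: real. f x = c"
  shows "c = 0"
proof (rule constant_set_integrable_imp_0[where A = UNIV])
  have "f = (\<lambda>x. c)"
    by (rule ext) (rule assms(2))
  then show "set_integrable lborel (UNIV :: real set) (\<lambda>x. c)"
    using assms(1) by (simp add: set_integrable_def)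
qed auto

lemma integrable_wronskian_y0:
  assumes "square_integrable U" "square_integrable V"
  shows "integrable lborel (\<lambda>x. U x * complex_of_real (y0' x) - V x * complex_of_real (y0 x))"
  by (intro Bochner_Integration.integrable_diff integrable_mult_square_integrable assms square_integrable_y0 square_integrable_y0')

text \<open>The case \<open>a = 0\<close> computes the kernel, and \<open>a \<noteq> 0\<close> excludes a Jordan chain, since
  \<open>u0\<close> is not square integrable.\<close>

lemma op_A_solution:
  assumes "(u, a *\<^sub>C Y0) \<in> op_A"
  obtains c where "a = 0" "u = c *\<^sub>C Y0"
proof -
  have Y0_rep: "AE x in lborel. rep_L2 (a *\<^sub>C Y0) x = a * complex_of_real (y0 x)"
    unfolding Y0_def scaleC_abs_L2[OF square_integrable_y0]
    by (intro rep_L2_abs_L2 square_integrable_scale square_integrable_y0)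
  show ?thesis
  proof (rule op_A_regular[OF assms])
    fix U V
    assume UV: "square_integrable U" "square_integrable V" "AE x in lborel. rep_L2 u x = U x"
        "\<And>x. (U has_vector_derivative V x) (at x)"
      and V_deriv: "\<And>h x. h \<in> borel_measurable borel \<Longrightarrow> isCont h x \<Longrightarrow>
         AE t in lborel. complex_of_real (potential t) * rep_L2 u t - complex_of_real (sgn t) * rep_L2 (a *\<^sub>C Y0) t = h t \<Longrightarrow>
         (V has_vector_derivative h x) (at x)"
    have U_cont: "continuous_on UNIV U"
      using UV(4) by (meson continuous_at_imp_continuous_on has_vector_derivative_continuous)
    have V: "(V has_vector_derivative complex_of_real (potential x) * U x - a * complex_of_real \<bar>y0 x\<bar>) (at x)" for x
    proof -
      have cont: "continuous_on UNIV (\<lambda>x. complex_of_real (potential x) * U x - a * complex_of_real \<bar>y0 x\<bar>)"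
        by (intro continuous_intros U_cont)
      show ?thesis
      proof (rule V_deriv)
        show "(\<lambda>x. complex_of_real (potential x) * U x - a * complex_of_real \<bar>y0 x\<bar>) \<in> borel_measurable borel"
          by (rule borel_measurable_continuous_onI[OF cont])
        show "isCont (\<lambda>x. complex_of_real (potential x) * U x - a * complex_of_real \<bar>y0 x\<bar>) x"
          using cont by (simp add: continuous_on_eq_continuous_at)
        have sgn_y0: "complex_of_real (sgn t) * complex_of_real (y0 t) = complex_of_real \<bar>y0 t\<bar>" for t
          by (simp add: y0_def sgn_if abs_divide)
        show "AE t in lborel. complex_of_real (potential t) * rep_L2 u t - complex_of_real (sgn t) * rep_L2 (a *\<^sub>C Y0) t
            = complex_of_real (potential t) * U t - a * complex_of_real \<bar>y0 t\<bar>"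
          using Y0_rep UV(3) by eventually_elim (simp add: mult.left_commute sgn_y0)
      qed
    qed
    \<comment> \<open>Subtracting the explicit particular solution \<open>a * u0\<close> leaves a
      solution of the homogeneous equation, which can be compared with \<open>y0\<close>.\<close>
    define D where "D x = U x - a * complex_of_real (u0 x)" for x
    define D' where "D' x = V x - a * complex_of_real (u0' x)" for x
    have D: "(D has_vector_derivative D' x) (at x)" for x
      unfolding D_def[abs_def] D'_def
      by (intro has_vector_derivative_diff UV has_vector_derivative_mult_right has_vector_derivative_of_real u0_deriv)
    have D': "(D' has_vector_derivative complex_of_real (potential x) * D x) (at x)" for x
    proof -
      have "(D' has_vector_derivative (complex_of_real (potential x) * U x - a * complex_of_real \<bar>y0 x\<bar>)
          - a * complex_of_real (potential x * u0 x - \<bar>y0 x\<bar>)) (at x)"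
        unfolding D'_def[abs_def]
        by (intro has_vector_derivative_diff V has_vector_derivative_mult_right has_vector_derivative_of_real u0'_deriv)
      then show ?thesis
        by (simp add: D_def algebra_simps)
    qed
    \<comment> \<open>\<open>D\<close> is not known to be square integrable, as \<open>u0\<close>
      does not decay. Its Wronskian with \<open>y0\<close> is nevertheless integrable:
      \<open>y0'\<close> decays quadratically, and so does the product of \<open>u0'\<close> and
      \<open>y0\<close>.\<close>
    have u0_int: "integrable lborel (\<lambda>x. a * complex_of_real (u0 x * y0' x - u0' x * y0 x))"
    proof (intro integrable_mult_right integrable_of_square_bound[where C = 13])
      have "continuous_on UNIV (\<lambda>x. complex_of_real (u0 x * y0' x - u0' x * y0 x))"
        by (intro continuous_intros)
      then show "(\<lambda>x. complex_of_real (u0 x * y0' x - u0' x * y0 x)) \<in> borel_measurable borel"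
        by (rule borel_measurable_continuous_onI)
      fix x
      have "\<bar>y0' x\<bar> \<le> 2 * (1 / tau x)"
      proof -
        have "\<bar>3 - 2 * \<bar>x\<bar> ^ 3\<bar> \<le> 2 * tau x"
          by (simp add: tau_def abs_le_iff)
        then have "\<bar>y0' x\<bar> \<le> 2 * tau x / (tau x)\<^sup>2"
          by (simp add: y0'_def abs_divide divide_right_mono)
        then show ?thesis
          by (simp add: power2_eq_square)
      qed
      then have y0': "\<bar>y0' x\<bar> \<le> 4 * (1 / (1 + \<bar>x\<bar>))\<^sup>2"
        using inverse_bound_le_square[of x] by linarith
      have "\<bar>u0 x * y0' x\<bar> \<le> 1 * (4 * (1 / (1 + \<bar>x\<bar>))\<^sup>2)"
        unfolding abs_mult by (intro mult_mono u0_bound y0') auto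
      moreover have "\<bar>u0' x * y0 x\<bar> \<le> 5 / (1 + \<bar>x\<bar>) * (1 / (1 + \<bar>x\<bar>))"
        unfolding abs_mult by (intro mult_mono u0'_bound y0_bound) auto
      then have "\<bar>u0' x * y0 x\<bar> \<le> 5 * (1 / (1 + \<bar>x\<bar>))\<^sup>2"
        by (simp add: power2_eq_square)
      ultimately have "\<bar>u0 x * y0' x - u0' x * y0 x\<bar> \<le> 13 * (1 / (1 + \<bar>x\<bar>))\<^sup>2"
        using zero_le_power2[of "1 / (1 + \<bar>x\<bar>)"] by linarith
      then show "cmod (complex_of_real (u0 x * y0' x - u0' x * y0 x)) \<le> 13 * (1 / (1 + \<bar>x\<bar>))\<^sup>2"
        by (simp only: norm_of_real)
    qed
    have "integrable lborel (\<lambda>x. D x * complex_of_real (y0' x) - D' x * complex_of_real (y0 x))"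
      using Bochner_Integration.integrable_diff[OF integrable_wronskian_y0[OF UV(1,2)] u0_int]
      by (simp add: D_def D'_def algebra_simps)
    then have "D z * complex_of_real (y0' z) - D' z * complex_of_real (y0 z) = 0" for z
      by (rule integrable_constant_imp_0) (rule wronskian_y0_constant[OF D D'])
    then obtain c where c: "\<And>x. D x = c * complex_of_real (y0 x)"
      using multiple_of_y0_if_wronskian_zero[OF D] by blast
    have "a = 0"
    proof -
      have a_u0: "square_integrable (\<lambda>x. a * complex_of_real (u0 x))"
        using square_integrable_diff[OF UV(1) square_integrable_scale[OF square_integrable_y0, of c]]
        by (simp add: c[symmetric] D_def)
      \<comment> \<open>Now \<open>U\<close> is \<open>a * u0\<close> plus a multiple of
        \<open>y0\<close>, so \<open>a * u0\<close> is square integrable. From \<open>3\<close> on,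
        \<open>u0\<close> is at least \<open>1 / 10\<close>, as \<open>u0 3 = 7 / 60\<close> and
        \<open>u0\<close> increases there; hence the constant \<open>a\<^sup>2 / 100\<close> is
        dominated on a half-line.\<close>
      have "integrable lborel (\<lambda>x. indicator {3::real..} x *\<^sub>R (a\<^sup>2 / 100))"
      proof (rule Bochner_Integration.integrable_bound)
        show "integrable lborel (\<lambda>x. (cmod (a * complex_of_real (u0 x)))\<^sup>2)"
          using a_u0 by (simp add: square_integrable_def)
        show "AE x in lborel. norm (indicator {3::real..} x *\<^sub>R (a\<^sup>2 / 100)) \<le> norm ((cmod (a * complex_of_real (u0 x)))\<^sup>2)"
        proof (rule AE_I2)
          fix x :: real
          have "1 / 100 \<le> (u0 x)\<^sup>2" if "3 \<le> x"
          proof -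
            have "3 ^ 3 \<le> x ^ 3"
              using that by (intro power_mono) auto
            then have "1 / 10 \<le> u0 x"
              using that by (simp add: u0_def tau_def field_simps)
            then have "(1 / 10)\<^sup>2 \<le> (u0 x)\<^sup>2"
              by (intro power_mono) auto
            then show ?thesis
              by (simp add: power2_eq_square)
          qed
          then have "(cmod a)\<^sup>2 * (1 / 100) \<le> (cmod a)\<^sup>2 * (u0 x)\<^sup>2" if "3 \<le> x"
            using that by (intro mult_left_mono) auto
          then show "norm (indicator {3::real..} x *\<^sub>R (a\<^sup>2 / 100)) \<le> norm ((cmod (a * complex_of_real (u0 x)))\<^sup>2)"
            by (auto simp: indicator_def norm_mult norm_divide norm_power power_mult_distrib)
        qed
      qed simp
      then have "a\<^sup>2 / 100 = 0"
        by (intro constant_set_integrable_imp_0[where A = "{3..}"])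
          (auto simp: set_integrable_def emeasure_lborel_halfline)
      then show ?thesis
        by simp
    qed
    moreover from this have "u = c *\<^sub>C Y0"
      using UV(3) c by (intro multiple_of_Y0) (simp add: D_def)
    ultimately show ?thesis
      by (rule that)
  qed
qed

section \<open>Simplicity of the eigenvalue zero\<close>

lemma op_shift_0: "op_shift T 0 = T"
  by (auto simp: op_shift_def complex_vector.scale_zero_left)

lemma kernel_op_A: "op_kernel op_A = range (\<lambda>c. c *\<^sub>C Y0)"
proof -
  have "u \<in> range (\<lambda>c. c *\<^sub>C Y0)" if "(u, 0) \<in> op_A" for u
    using op_A_solution[of u 0] that by (auto simp: complex_vector.scale_zero_left)
  then show ?thesis
    using Y0_in_kernel by (auto simp: op_kernel_def)
qed

lemma simple_eigenvalue_0: "simple_eigenvalue op_A 0"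
proof -
  have "cdim (op_kernel op_A) = cdim (complex_vector.span {Y0})"
    by (simp add: kernel_op_A complex_vector.span_singleton)
  also have "\<dots> = 1"
    using Y0_nonzero by (subst complex_vector.dim_span_eq_card_independent) auto
  finally have "cdim (op_kernel op_A) = 1" .
  moreover have "op_kernel op_A = op_kernel (op_A O op_A)"
  proof
    have "(0, 0) \<in> op_A"
      using Y0_in_kernel[of 0] by (simp add: complex_vector.scale_zero_left)
    then show "op_kernel op_A \<subseteq> op_kernel (op_A O op_A)"
      by (auto simp: op_kernel_def)
    show "op_kernel (op_A O op_A) \<subseteq> op_kernel op_A"
    proof
      fix x assume "x \<in> op_kernel (op_A O op_A)"
      then obtain y where y: "(x, y) \<in> op_A" "y \<in> op_kernel op_A"
        by (auto simp: op_kernel_def)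
      then obtain a where "y = a *\<^sub>C Y0"
        by (auto simp: kernel_op_A)
      then have "(x, a *\<^sub>C Y0) \<in> op_A"
        using y(1) by simp
      then show "x \<in> op_kernel op_A"
        by (rule op_A_solution) (auto simp: kernel_op_A)
    qed
  qed
  ultimately show ?thesis
    by (simp add: simple_eigenvalue_def op_shift_0)
qed

section \<open>The closure of the range\<close>

text \<open>A rational cutoff suffices in place of a compactly supported one: \<open>u0\<close> is
  bounded, so a factor of order \<open>N / x\<^sup>2\<close> makes it square integrable, and the
  derivatives are explicit. The transition happens at the scale \<open>sqrt N\<close>, so each
  derivative becomes small as \<open>N\<close> grows.\<close>

definition cutoff :: "real \<Rightarrow> real \<Rightarrow> real" where "cutoff N x = N / (N + x\<^sup>2)"
definition cutoff' :: "real \<Rightarrow> real \<Rightarrow> real" where "cutoff' N x = - 2 * N * x / (N + x\<^sup>2)\<^sup>2"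
definition cutoff'' :: "real \<Rightarrow> real \<Rightarrow> real" where "cutoff'' N x = N * (6 * x\<^sup>2 - 2 * N) / (N + x\<^sup>2) ^ 3"

lemma one_plus_abs_le: "1 + \<bar>x\<bar> \<le> 2 * (1 + x\<^sup>2)" "\<bar>x\<bar> * (1 + \<bar>x\<bar>) \<le> 2 * (1 + x\<^sup>2)" for x :: real
proof -
  have "0 \<le> (\<bar>x\<bar> - 1)\<^sup>2"
    by simp
  then have "2 * \<bar>x\<bar> \<le> 1 + x\<^sup>2"
    by (simp add: power2_diff)
  then show "1 + \<bar>x\<bar> \<le> 2 * (1 + x\<^sup>2)" "\<bar>x\<bar> * (1 + \<bar>x\<bar>) \<le> 2 * (1 + x\<^sup>2)"
    by (auto simp: distrib_left power2_eq_square[symmetric] abs_mult_self_eq) (smt (verit) zero_le_power2)+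
qed

context
  fixes N :: real
  assumes N: "1 \<le> N"
begin

lemma cutoff_denominator: "1 + x\<^sup>2 \<le> N + x\<^sup>2" "0 < N + x\<^sup>2" "N + x\<^sup>2 \<noteq> 0" "N \<le> N + x\<^sup>2"
proof -
  show "1 + x\<^sup>2 \<le> N + x\<^sup>2" "N \<le> N + x\<^sup>2"
    using N by auto
  show "0 < N + x\<^sup>2"
    using N by (intro add_pos_nonneg) auto
  then show "N + x\<^sup>2 \<noteq> 0"
    by simp
qed

lemma cutoff_deriv: "(cutoff N has_real_derivative cutoff' N x) (at x)"
  unfolding cutoff_def[abs_def] cutoff'_def
  by (rule derivative_eq_intros refl cutoff_denominator)+ (simp add: power2_eq_square)

lemma cutoff'_deriv: "(cutoff' N has_real_derivative cutoff'' N x) (at x)"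
  unfolding cutoff'_def[abs_def] cutoff''_def
  by (rule derivative_eq_intros refl cutoff_denominator power_not_zero)+
    (simp add: divide_simps cutoff_denominator(3),
      simp add: algebra_simps power2_eq_square power3_eq_cube power4_eq_xxxx)

lemma continuous_cutoff: "continuous_on A (cutoff N)" "continuous_on A (cutoff' N)" "continuous_on A (cutoff'' N)"
  unfolding cutoff_def[abs_def] cutoff'_def[abs_def] cutoff''_def[abs_def]
  using cutoff_denominator(3) by (intro continuous_intros; simp)+

lemma cutoff_bounds: "0 \<le> cutoff N x" "cutoff N x \<le> 1" "cutoff N x \<le> 2 * N / (1 + \<bar>x\<bar>)" "1 - cutoff N x \<le> x\<^sup>2 / N"
proof -
  note d = cutoff_denominator[of x]
  show "0 \<le> cutoff N x" "cutoff N x \<le> 1"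
    using N d(4) by (simp_all add: cutoff_def divide_le_eq_1_pos[OF d(2)])
  have "cutoff N x \<le> N / (1 + x\<^sup>2)"
    unfolding cutoff_def using N d(1) by (intro divide_left_mono mult_pos_pos d(2) add_pos_nonneg) auto
  also have "\<dots> = 2 * N / (2 * (1 + x\<^sup>2))"
    by (rule mult_divide_mult_cancel_left[symmetric]) simp
  also have "\<dots> \<le> 2 * N / (1 + \<bar>x\<bar>)"
    using N one_plus_abs_le(1)[of x] by (intro divide_left_mono) (auto intro!: mult_pos_pos add_pos_nonneg)
  finally show "cutoff N x \<le> 2 * N / (1 + \<bar>x\<bar>)" .
  have "1 - cutoff N x = (N + x\<^sup>2 - N) / (N + x\<^sup>2)"
    unfolding cutoff_def diff_divide_distrib divide_self[OF d(3)] ..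
  then have "1 - cutoff N x = x\<^sup>2 / (N + x\<^sup>2)"
    by simp
  also have "\<dots> \<le> x\<^sup>2 / N"
    using N d(4) by (intro divide_left_mono mult_pos_pos d(2)) auto
  finally show "1 - cutoff N x \<le> x\<^sup>2 / N" .
qed

lemma cutoff'_le: "\<bar>cutoff' N x\<bar> \<le> 2 * \<bar>x\<bar> / (N + x\<^sup>2)"
proof -
  note d = cutoff_denominator[of x]
  have "\<bar>cutoff' N x\<bar> = 2 * \<bar>x\<bar> * N / (N + x\<^sup>2)\<^sup>2"
    using N by (simp add: cutoff'_def abs_mult abs_divide)
  also have "\<dots> \<le> 2 * \<bar>x\<bar> * (N + x\<^sup>2) / (N + x\<^sup>2)\<^sup>2"
    using d by (intro divide_right_mono mult_left_mono) auto
  also have "\<dots> = 2 * \<bar>x\<bar> / (N + x\<^sup>2)"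
    using d by (simp add: power2_eq_square)
  finally show ?thesis .
qed

lemma cutoff''_le: "\<bar>cutoff'' N x\<bar> \<le> 6 / (N + x\<^sup>2)"
proof -
  note d = cutoff_denominator[of x]
  have "\<bar>6 * x\<^sup>2 - 2 * N\<bar> \<le> 6 * (N + x\<^sup>2)"
    using N zero_le_power2[of x] by (simp add: abs_le_iff)
  then have "N * \<bar>6 * x\<^sup>2 - 2 * N\<bar> \<le> (N + x\<^sup>2) * (6 * (N + x\<^sup>2))"
    using N d by (intro mult_mono) auto
  then have "\<bar>cutoff'' N x\<bar> \<le> (N + x\<^sup>2) * (6 * (N + x\<^sup>2)) / (N + x\<^sup>2) ^ 3"
    using N d by (simp add: cutoff''_def abs_mult abs_divide divide_right_mono)
  also have "\<dots> = 6 / (N + x\<^sup>2)"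
    using d(3) by (simp add: power3_eq_cube del: distrib_left_numeral)
  finally show ?thesis .
qed

text \<open>Two kinds of bounds are needed: bounds independent of \<open>N\<close>, which provide
  square integrable majorants, and bounds of order \<open>1 / N\<close> at a fixed point, which give
  pointwise convergence. The second derivative below is treated in the same way.\<close>

lemma cutoff'_bound: "\<bar>cutoff' N x\<bar> \<le> 4 / (1 + \<bar>x\<bar>)" "\<bar>cutoff' N x\<bar> \<le> 2 * \<bar>x\<bar> / N" "\<bar>cutoff' N x\<bar> \<le> 4"
proof -
  note d = cutoff_denominator[of x]
  have "2 * \<bar>x\<bar> / (N + x\<^sup>2) \<le> 2 * \<bar>x\<bar> / (1 + x\<^sup>2)"
    using d(1) by (intro divide_left_mono mult_pos_pos d(2) add_pos_nonneg) auto
  also have "\<dots> \<le> 4 / (1 + \<bar>x\<bar>)"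
    using one_plus_abs_le(2)[of x] by (simp add: field_simps add_pos_nonneg)
  finally show 1: "\<bar>cutoff' N x\<bar> \<le> 4 / (1 + \<bar>x\<bar>)"
    using cutoff'_le[of x] by simp
  have "4 / (1 + \<bar>x\<bar>) \<le> 4"
    by (simp add: field_simps)
  then show "\<bar>cutoff' N x\<bar> \<le> 4"
    using 1 by simp
  have "2 * \<bar>x\<bar> / (N + x\<^sup>2) \<le> 2 * \<bar>x\<bar> / N"
    using N d(4) by (intro divide_left_mono mult_pos_pos d(2)) auto
  then show "\<bar>cutoff' N x\<bar> \<le> 2 * \<bar>x\<bar> / N"
    using cutoff'_le[of x] by simp
qed

lemma cutoff''_bound: "\<bar>cutoff'' N x\<bar> \<le> 12 / (1 + \<bar>x\<bar>)" "\<bar>cutoff'' N x\<bar> \<le> 6 / N"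
proof -
  note d = cutoff_denominator[of x]
  have "6 / (N + x\<^sup>2) \<le> 6 / (1 + x\<^sup>2)"
    using d(1) by (intro divide_left_mono mult_pos_pos d(2) add_pos_nonneg) auto
  also have "\<dots> \<le> 12 / (1 + \<bar>x\<bar>)"
    using one_plus_abs_le(1)[of x] by (simp add: field_simps add_pos_nonneg)
  finally show "\<bar>cutoff'' N x\<bar> \<le> 12 / (1 + \<bar>x\<bar>)"
    using cutoff''_le[of x] by simp
  have "6 / (N + x\<^sup>2) \<le> 6 / N"
    using N d(4) by (intro divide_left_mono mult_pos_pos d(2)) auto
  then show "\<bar>cutoff'' N x\<bar> \<le> 6 / N"
    using cutoff''_le[of x] by simp
qed

end

text \<open>Applied to \<open>u0 * cutoff N\<close>, the operator gives \<open>y0 * cutoff N\<close>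
  plus terms in which the cutoff is differentiated. Those tend to zero in the mean: after one
  derivative of the cutoff, the decaying \<open>u0'\<close> appears, and two derivatives compensate
  for the bounded \<open>u0\<close>.\<close>

lemma Y0_in_closure_range_op_A:
  obtains f g where "\<And>n :: nat. (f n, g n) \<in> op_A" "g \<longlonglongrightarrow> Y0"
proof -
  \<comment> \<open>The part of the second derivative of \<open>u0 * cutoff N\<close> in which the
    cutoff is differentiated.\<close>
  define R where "R N x = 2 * (u0' x * cutoff' N x) + u0 x * cutoff'' N x" for N x
  define F where "F N x = u0 x * cutoff N x" for N x
  define F' where "F' N x = u0' x * cutoff N x + u0 x * cutoff' N x" for N x
  define F'' where "F'' N x = (potential x * u0 x - \<bar>y0 x\<bar>) * cutoff N x + R N x" for N x
  define G where "G N x = y0 x * cutoff N x - sgn x * R N x" for N x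
  have D: "0 \<le> 1 / (1 + \<bar>x\<bar>)" "1 / (1 + \<bar>x\<bar>) \<le> 1" for x :: real
    by auto
  \<comment> \<open>\<open>52 = 2 * (5 * 4) + 12\<close>, from the bounds on \<open>u0'\<close>,
    \<open>cutoff'\<close> and \<open>cutoff''\<close>; the term with \<open>y0\<close> adds
    \<open>1\<close> in \<open>G_bound\<close> below, hence the \<open>53\<close> there.\<close>
  have R_bound: "\<bar>R N x\<bar> \<le> 52 / (1 + \<bar>x\<bar>)" and R_lim: "\<bar>R N x\<bar> \<le> (20 * \<bar>x\<bar> + 6) / N" if N: "1 \<le> N" for N x
  proof -
    have "\<bar>u0' x * cutoff' N x\<bar> \<le> 5 / (1 + \<bar>x\<bar>) * 4"
      unfolding abs_mult by (intro mult_mono u0'_bound cutoff'_bound(3)[OF N]) auto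
    moreover have "\<bar>u0 x * cutoff'' N x\<bar> \<le> 1 * (12 / (1 + \<bar>x\<bar>))"
      unfolding abs_mult by (intro mult_mono u0_bound cutoff''_bound(1)[OF N]) auto
    ultimately show "\<bar>R N x\<bar> \<le> 52 / (1 + \<bar>x\<bar>)"
      unfolding R_def by (simp add: abs_le_iff)
    have "\<bar>u0' x\<bar> \<le> 5"
      by (rule order_trans[OF u0'_bound]) (simp add: pos_divide_le_eq)
    then have "\<bar>u0' x * cutoff' N x\<bar> \<le> 5 * (2 * \<bar>x\<bar> / N)"
      unfolding abs_mult by (intro mult_mono cutoff'_bound(2)[OF N]) auto
    moreover have "\<bar>u0 x * cutoff'' N x\<bar> \<le> 1 * (6 / N)"
      unfolding abs_mult by (intro mult_mono u0_bound cutoff''_bound(2)[OF N]) auto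
    moreover have "(20 * \<bar>x\<bar> + 6) / N = 2 * (5 * (2 * \<bar>x\<bar> / N)) + 1 * (6 / N)"
      by (simp add: add_divide_distrib)
    ultimately show "\<bar>R N x\<bar> \<le> (20 * \<bar>x\<bar> + 6) / N"
      unfolding R_def by linarith
  qed
  have G_diff: "\<bar>G N x - y0 x\<bar> \<le> \<bar>y0 x\<bar> * (1 - cutoff N x) + \<bar>R N x\<bar>" if N: "1 \<le> N" for N x
  proof -
    have "G N x - y0 x = - (y0 x * (1 - cutoff N x)) - sgn x * R N x"
      by (simp add: G_def algebra_simps)
    moreover have "\<bar>sgn x * R N x\<bar> \<le> \<bar>R N x\<bar>"
      by (simp add: abs_mult sgn_if)
    moreover have "\<bar>y0 x * (1 - cutoff N x)\<bar> = \<bar>y0 x\<bar> * (1 - cutoff N x)"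
      using cutoff_bounds(2)[OF N, of x] by (simp add: abs_mult)
    ultimately show ?thesis
      by linarith
  qed
  have G_bound: "\<bar>G N x - y0 x\<bar> \<le> 53 / (1 + \<bar>x\<bar>)" if N: "1 \<le> N" for N x
  proof -
    have "\<bar>y0 x\<bar> * (1 - cutoff N x) \<le> 1 / (1 + \<bar>x\<bar>) * 1"
      using cutoff_bounds(1,2)[OF N, of x] by (intro mult_mono y0_bound) auto
    moreover have "53 / (1 + \<bar>x\<bar>) = 1 / (1 + \<bar>x\<bar>) * 1 + 52 / (1 + \<bar>x\<bar>)"
      by (simp add: add_divide_distrib[symmetric])
    ultimately show ?thesis
      using G_diff[OF N, of x] R_bound[OF N, of x] by linarith
  qed
  have R_cont: "continuous_on UNIV (R N)" if N: "1 \<le> N" for N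
    unfolding R_def by (intro continuous_intros continuous_cutoff[OF N])
  have F_sq: "square_integrable (\<lambda>x. complex_of_real (F N x))" if N: "1 \<le> N" for N
  proof (rule square_integrable_continuous_of_real)
    show "continuous_on UNIV (F N)"
      unfolding F_def by (intro continuous_intros continuous_cutoff[OF N])
    show "\<bar>F N x\<bar> \<le> 2 * N / (1 + \<bar>x\<bar>)" for x
    proof -
      have "\<bar>u0 x\<bar> * \<bar>cutoff N x\<bar> \<le> 1 * (2 * N / (1 + \<bar>x\<bar>))"
        using cutoff_bounds[OF N, of x] by (intro mult_mono u0_bound) auto
      then show ?thesis
        by (simp add: F_def abs_mult)
    qed
  qed
  have F'_sq: "square_integrable (\<lambda>x. complex_of_real (F' N x))" if N: "1 \<le> N" for N
  proof (rule square_integrable_continuous_of_real)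
    show "continuous_on UNIV (F' N)"
      unfolding F'_def by (intro continuous_intros continuous_cutoff[OF N])
    show "\<bar>F' N x\<bar> \<le> 9 / (1 + \<bar>x\<bar>)" for x
    proof -
      have "\<bar>u0' x * cutoff N x\<bar> \<le> 5 / (1 + \<bar>x\<bar>) * 1"
        using cutoff_bounds[OF N, of x] unfolding abs_mult by (intro mult_mono u0'_bound) auto
      moreover have "\<bar>u0 x * cutoff' N x\<bar> \<le> 1 * (4 / (1 + \<bar>x\<bar>))"
        unfolding abs_mult by (intro mult_mono u0_bound cutoff'_bound(1)[OF N]) auto
      moreover have "9 / (1 + \<bar>x\<bar>) = 5 / (1 + \<bar>x\<bar>) * 1 + 1 * (4 / (1 + \<bar>x\<bar>))"
        by (simp add: add_divide_distrib[symmetric])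
      ultimately show ?thesis
        unfolding F'_def by linarith
    qed
  qed
  have F''_cont: "continuous_on UNIV (F'' N)" if N: "1 \<le> N" for N
    unfolding F''_def by (intro continuous_intros continuous_cutoff[OF N] R_cont[OF N])
  have F''_sq: "square_integrable (\<lambda>x. complex_of_real (F'' N x))" if N: "1 \<le> N" for N
  proof (rule square_integrable_continuous_of_real[OF F''_cont[OF N]])
    show "\<bar>F'' N x\<bar> \<le> 65 / (1 + \<bar>x\<bar>)" for x
    proof -
      have "\<bar>(potential x * u0 x - \<bar>y0 x\<bar>) * cutoff N x\<bar> \<le> 13 / (1 + \<bar>x\<bar>) * 1"
        using cutoff_bounds[OF N, of x] unfolding abs_mult[of _ "cutoff N x"] by (intro mult_mono u0''_bound) auto
      moreover have "65 / (1 + \<bar>x\<bar>) = 13 / (1 + \<bar>x\<bar>) * 1 + 52 / (1 + \<bar>x\<bar>)"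
        by (simp add: add_divide_distrib[symmetric])
      ultimately show ?thesis
        unfolding F''_def using R_bound[OF N, of x] by linarith
    qed
  qed
  have G_meas: "G N \<in> borel_measurable borel" if N: "1 \<le> N" for N
  proof -
    have [measurable]: "y0 \<in> borel_measurable borel" "cutoff N \<in> borel_measurable borel" "R N \<in> borel_measurable borel"
      by (auto intro!: borel_measurable_continuous_onI continuous_y0 continuous_cutoff[OF N] R_cont[OF N])
    show ?thesis
      unfolding G_def by measurable
  qed
  have diff_sq: "square_integrable (\<lambda>x. complex_of_real (G N x - y0 x))" if N: "1 \<le> N" for N
    by (rule square_integrable_of_real[OF _ G_bound[OF N]])
      (intro borel_measurable_diff G_meas[OF N] borel_measurable_continuous_onI continuous_y0)
  have G_sq: "square_integrable (\<lambda>x. complex_of_real (G N x))" if N: "1 \<le> N" for N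
    using square_integrable_add[OF diff_sq[OF N] square_integrable_y0] by simp
  define f where "f n = abs_L2 (\<lambda>x. complex_of_real (F (real (Suc n)) x))" for n
  define g where "g n = abs_L2 (\<lambda>x. complex_of_real (G (real (Suc n)) x))" for n
  have "(f n, g n) \<in> op_A" for n
  proof -
    define N where "N = real (Suc n)"
    have N: "1 \<le> N"
      by (simp add: N_def)
    show ?thesis
      unfolding f_def g_def N_def[symmetric]
    proof (rule C2_imp_op_A[OF F_sq[OF N] F'_sq[OF N] F''_sq[OF N] G_sq[OF N]])
      fix x
      show "((\<lambda>x. complex_of_real (F N x)) has_vector_derivative complex_of_real (F' N x)) (at x)"
        unfolding F_def F'_def
        by (rule has_vector_derivative_of_real, rule DERIV_cong, rule DERIV_mult[OF u0_deriv cutoff_deriv[OF N]])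
          (simp add: algebra_simps)
      show "((\<lambda>x. complex_of_real (F' N x)) has_vector_derivative complex_of_real (F'' N x)) (at x)"
        unfolding F'_def F''_def R_def
        by (rule has_vector_derivative_of_real, rule DERIV_cong,
            rule DERIV_add[OF DERIV_mult[OF u0'_deriv cutoff_deriv[OF N]] DERIV_mult[OF u0_deriv cutoff'_deriv[OF N]]])
          (simp add: algebra_simps)
      have "sgn x * \<bar>y0 x\<bar> = y0 x"
        by (simp add: y0_def abs_divide sgn_if)
      then have "sgn x * \<bar>y0 x\<bar> * cutoff N x - sgn x * R N x = G N x"
        by (simp add: G_def)
      then have "G N x = sgn x * (- F'' N x + potential x * F N x)"
        by (simp add: F_def F''_def algebra_simps)
      then show "complex_of_real (G N x) =
         complex_of_real (sgn x) * (- complex_of_real (F'' N x) + complex_of_real (potential x) * complex_of_real (F N x))"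
        by simp
    next
      show "continuous_on UNIV (\<lambda>x. complex_of_real (F'' N x))"
        by (intro continuous_intros F''_cont[OF N])
    qed
  qed
  moreover have "g \<longlonglongrightarrow> Y0"
  proof -
    have "(\<lambda>n. LINT x|lborel. (cmod (complex_of_real (G (real (Suc n)) x - y0 x)))\<^sup>2) \<longlonglongrightarrow> integral\<^sup>L lborel (\<lambda>x :: real. 0 :: real)"
    proof (rule integral_dominated_convergence)
      show "integrable lborel (\<lambda>x :: real. 53\<^sup>2 * (1 / (1 + \<bar>x\<bar>))\<^sup>2)"
        by (intro integrable_mult_right integrable_inverse_square)
      fix n
      define N where "N = real (Suc n)"
      have N: "1 \<le> N"
        by (simp add: N_def)
      show "(\<lambda>x. (cmod (complex_of_real (G (real (Suc n)) x - y0 x)))\<^sup>2) \<in> borel_measurable lborel"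
        using diff_sq[OF N] unfolding N_def square_integrable_def by (intro borel_measurable_integrable) simp
      show "AE x in lborel. norm ((cmod (complex_of_real (G (real (Suc n)) x - y0 x)))\<^sup>2) \<le> 53\<^sup>2 * (1 / (1 + \<bar>x\<bar>))\<^sup>2"
      proof (rule AE_I2)
        fix x
        have "\<bar>G N x - y0 x\<bar>\<^sup>2 \<le> (53 / (1 + \<bar>x\<bar>))\<^sup>2"
          by (rule power_mono[OF G_bound[OF N]]) simp
        then show "norm ((cmod (complex_of_real (G (real (Suc n)) x - y0 x)))\<^sup>2) \<le> 53\<^sup>2 * (1 / (1 + \<bar>x\<bar>))\<^sup>2"
          unfolding N_def[symmetric] norm_of_real by (simp add: power_divide)
      qed
    next
      show "AE x in lborel. (\<lambda>n. (cmod (complex_of_real (G (real (Suc n)) x - y0 x)))\<^sup>2) \<longlonglongrightarrow> 0"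
      proof (rule AE_I2)
        fix x
        have "(\<lambda>n. (x\<^sup>2 + 20 * \<bar>x\<bar> + 6) * inverse (real (Suc n))) \<longlonglongrightarrow> (x\<^sup>2 + 20 * \<bar>x\<bar> + 6) * 0"
          by (intro tendsto_intros LIMSEQ_inverse_real_of_nat)
        then have lim: "(\<lambda>n. (x\<^sup>2 + 20 * \<bar>x\<bar> + 6) / real (Suc n)) \<longlonglongrightarrow> 0"
          by (simp only: divide_inverse mult_zero_right)
        have "(\<lambda>n. G (real (Suc n)) x - y0 x) \<longlonglongrightarrow> 0"
        proof (rule Lim_null_comparison[OF always_eventually lim], rule allI)
          fix n
          define N where "N = real (Suc n)"
          have N: "1 \<le> N"
            by (simp add: N_def)
          have "\<bar>y0 x\<bar> \<le> 1"
            using y0_bound[of x] D(2)[of x] by linarith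
          then have "\<bar>y0 x\<bar> * (1 - cutoff N x) \<le> 1 * (x\<^sup>2 / N)"
            using cutoff_bounds[OF N, of x] by (intro mult_mono) auto
          then have "\<bar>G N x - y0 x\<bar> \<le> x\<^sup>2 / N + (20 * \<bar>x\<bar> + 6) / N"
            using G_diff[OF N, of x] R_lim[OF N, of x] by linarith
          then show "norm (G (real (Suc n)) x - y0 x) \<le> (x\<^sup>2 + 20 * \<bar>x\<bar> + 6) / real (Suc n)"
            unfolding N_def[symmetric] by (simp add: add_divide_distrib add.assoc)
        qed
        then have "(\<lambda>n. (cmod (complex_of_real (G (real (Suc n)) x - y0 x)))\<^sup>2) \<longlonglongrightarrow> (cmod (complex_of_real 0))\<^sup>2"
          by (intro tendsto_intros)
        then show "(\<lambda>n. (cmod (complex_of_real (G (real (Suc n)) x - y0 x)))\<^sup>2) \<longlonglongrightarrow> 0"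
          by simp
      qed
    qed simp
    moreover have "(LINT x|lborel. (cmod (complex_of_real (G (real (Suc n)) x - y0 x)))\<^sup>2) = (norm (g n - Y0))\<^sup>2" for n
    proof -
      have N: "1 \<le> real (Suc n)"
        by simp
      have "g n - Y0 = abs_L2 (\<lambda>x. complex_of_real (G (real (Suc n)) x - y0 x))"
        unfolding g_def Y0_def by (subst minus_abs_L2[OF G_sq[OF N] square_integrable_y0]) simp
      then show ?thesis
        using norm_abs_L2_integral[OF diff_sq[OF N]] by simp
    qed
    ultimately have "(\<lambda>n. (norm (g n - Y0))\<^sup>2) \<longlonglongrightarrow> 0"
      by simp
    then have "(\<lambda>n. sqrt ((norm (g n - Y0))\<^sup>2)) \<longlonglongrightarrow> sqrt 0"
      by (rule tendsto_real_sqrt)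
    then have "(\<lambda>n. norm (g n - Y0)) \<longlonglongrightarrow> 0"
      by simp
    then show ?thesis
      by (simp add: LIM_zero_cancel tendsto_norm_zero_iff)
  qed
  ultimately show ?thesis
    by (rule that)
qed

lemma op_A_not_similar_self_adjoint: "\<not> (\<exists>T. self_adjoint T \<and> similar_operators op_A T)"
proof
  assume "\<exists>T. self_adjoint T \<and> similar_operators op_A T"
  then obtain T where T: "self_adjoint T" "similar_operators op_A T"
    by blast
  have Y0: "(Y0, 0) \<in> op_A"
    using Y0_in_kernel[of 1] by (simp add: complex_vector.scale_one)
  show False
  proof (rule Y0_in_closure_range_op_A)
    fix f g
    assume fg: "\<And>n :: nat. (f n, g n) \<in> op_A" "g \<longlonglongrightarrow> Y0"
    have "Y0 = 0"
      by (rule self_adjoint_similar_closure_range[OF T Y0 fg])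
    then show False
      using Y0_nonzero by blast
  qed
qed

section \<open>Integral operators with exponentially decaying kernel\<close>

lemma integrable_exp_dist:
  assumes "0 < a"
  shows "integrable lborel (\<lambda>t :: real. exp (- (a * \<bar>x - t\<bar>)))"
proof -
  have "integrable lborel (\<lambda>t. (\<lambda>y :: real. exp (- (a * \<bar>y\<bar>))) (x + (- 1) * t))"
    by (subst lborel_integrable_real_affine_iff) (auto intro: integrable_exp_abs assms)
  then show ?thesis
    by simp
qed

text \<open>The total mass of the convolution kernel that dominates the integral operators below,
  and thus a factor in their norm bound. It equals \<open>2 / a\<close> for
  \<open>0 < a\<close>.\<close>

definition exp_mass :: "real \<Rightarrow> real" where
  "exp_mass a = (LINT t|lborel. exp (- (a * \<bar>t\<bar>)))"

lemma exp_mass_nonneg: "0 \<le> exp_mass a"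
  by (simp add: exp_mass_def)

lemma nn_integral_exp_dist:
  assumes "0 < a"
  shows "(\<integral>\<^sup>+t. ennreal (exp (- (a * \<bar>x - t\<bar>))) \<partial>lborel) = ennreal (exp_mass a)"
proof -
  have "(\<integral>\<^sup>+t. ennreal (exp (- (a * \<bar>x - t\<bar>))) \<partial>lborel) = ennreal (LINT t|lborel. exp (- (a * \<bar>x - t\<bar>)))"
    by (rule nn_integral_eq_integral[OF integrable_exp_dist[OF assms]]) auto
  also have "(LINT t|lborel. exp (- (a * \<bar>x - t\<bar>))) = exp_mass a"
    unfolding exp_mass_def by (subst lborel_integral_real_affine[where c = "- 1" and t = x]) auto
  finally show ?thesis .
qed

lemma square_integrable_exp_bound:
  assumes "0 < a" "f \<in> borel_measurable borel" "\<And>t. cmod (f t) \<le> K * exp (- (a * \<bar>x - t\<bar>))"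
  shows "square_integrable f"
proof -
  have "integrable lborel (\<lambda>t. (cmod (f t))\<^sup>2)"
  proof (rule Bochner_Integration.integrable_bound)
    show "integrable lborel (\<lambda>t. K\<^sup>2 * exp (- (2 * a * \<bar>x - t\<bar>)))"
      using assms(1) by (intro integrable_mult_right integrable_exp_dist) simp
    have "(cmod (f t))\<^sup>2 \<le> K\<^sup>2 * exp (- (2 * a * \<bar>x - t\<bar>))" for t
    proof -
      have "(cmod (f t))\<^sup>2 \<le> (K * exp (- (a * \<bar>x - t\<bar>)))\<^sup>2"
        by (rule power_mono[OF assms(3)]) simp
      also have "\<dots> = K\<^sup>2 * exp (- (2 * a * \<bar>x - t\<bar>))"
        by (simp add: power_mult_distrib exp_double[symmetric])
      finally show ?thesis .
    qed
    then show "AE t in lborel. norm ((cmod (f t))\<^sup>2) \<le> norm (K\<^sup>2 * exp (- (2 * a * \<bar>x - t\<bar>)))"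
      by (intro AE_I2) simp
  qed (use assms(2) in simp)
  then show ?thesis
    using assms(2) by (simp add: square_integrable_def)
qed

text \<open>Abstracts what Green's function and its derivative in the first variable have in common.
  Domination by a convolution kernel gives boundedness without any smoothness, so the jump of the
  derivative on the diagonal does no harm.\<close>

locale exp_kernel =
  fixes k :: "real \<Rightarrow> real \<Rightarrow> complex" and K a :: real
  assumes measurable_kernel: "(\<lambda>p. k (fst p) (snd p)) \<in> borel_measurable (borel \<Otimes>\<^sub>M borel)"
    and a: "0 < a"
    and kernel_bound: "\<And>x t. cmod (k x t) \<le> K * exp (- (a * \<bar>x - t\<bar>))"
begin

lemma K_nonneg: "0 \<le> K"
  using order_trans[OF norm_ge_zero kernel_bound[of 0 0]] by simp

lemma measurable_kernel_section: "k x \<in> borel_measurable borel"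
proof -
  have "(\<lambda>t. (\<lambda>p. k (fst p) (snd p)) (x, t)) \<in> borel_measurable borel"
    by (rule measurable_compose[OF _ measurable_kernel]) simp
  then show ?thesis
    by simp
qed

lemma integrable_kernel_mult:
  assumes "square_integrable g"
  shows "integrable lborel (\<lambda>t. k x t * g t)"
  by (intro integrable_mult_square_integrable assms
      square_integrable_exp_bound[OF a measurable_kernel_section kernel_bound])

definition int_op :: "(real \<Rightarrow> complex) \<Rightarrow> real \<Rightarrow> complex" where
  "int_op g x = (LINT t|lborel. k x t * g t)"

lemma measurable_kernel_mult:
  assumes "g \<in> borel_measurable borel"
  shows "(\<lambda>p. k (fst p) (snd p) * g (snd p)) \<in> borel_measurable (borel \<Otimes>\<^sub>M borel)"
  by (intro borel_measurable_times measurable_kernel measurable_compose[OF measurable_snd assms])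

lemma measurable_int_op:
  assumes "g \<in> borel_measurable borel"
  shows "int_op g \<in> borel_measurable borel"
proof -
  have "(\<lambda>x. LINT t|lborel. k x t * g t) \<in> borel_measurable borel"
    using measurable_kernel_mult[OF assms]
    by (intro lborel.borel_measurable_lebesgue_integral) (simp add: case_prod_beta measurable_lborel2 cong: measurable_cong_sets)
  then show ?thesis
    by (simp add: int_op_def[abs_def])
qed

text \<open>The Schur test. The exponential \<open>e\<close> is split as the square of
  \<open>d\<close>; Cauchy-Schwarz puts one factor \<open>d\<close> on each side, and Tonelli
  integrates the remaining \<open>e\<close> in the other variable. Each of the two integrations
  contributes one \<open>exp_mass a\<close>.\<close>

lemma nn_integral_int_op:
  assumes g: "square_integrable g"
  shows "(\<integral>\<^sup>+x. ennreal ((cmod (int_op g x))\<^sup>2) \<partial>lborel)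
    \<le> ennreal ((K * exp_mass a)\<^sup>2) * (\<integral>\<^sup>+t. ennreal ((cmod (g t))\<^sup>2) \<partial>lborel)"
proof -
  have [measurable]: "g \<in> borel_measurable borel"
    using g by (simp add: square_integrable_def)
  define e where "e x t = exp (- (a * \<bar>x - t\<bar>))" for x t :: real
  define d where "d x t = exp (- (a / 2 * \<bar>x - t\<bar>))" for x t :: real
  have d_nonneg: "0 \<le> d x t" for x t
    by (simp add: d_def)
  have d_sq: "(d x t)\<^sup>2 = e x t" for x t
    by (simp add: d_def e_def exp_double[symmetric])
  have [measurable]: "e x \<in> borel_measurable borel" "d x \<in> borel_measurable borel" for x
    unfolding e_def d_def by measurable
  have pointwise: "ennreal ((cmod (int_op g x))\<^sup>2) \<le>
      ennreal (K\<^sup>2 * exp_mass a) * (\<integral>\<^sup>+t. ennreal (e x t * (cmod (g t))\<^sup>2) \<partial>lborel)" for x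
  proof -
    have "ennreal (cmod (int_op g x)) \<le> (\<integral>\<^sup>+t. ennreal (norm (k x t * g t)) \<partial>lborel)"
      unfolding int_op_def by (rule integral_norm_bound_ennreal[OF integrable_kernel_mult[OF g]])
    also have "\<dots> \<le> (\<integral>\<^sup>+t. ennreal K * (ennreal (d x t) * ennreal (d x t * cmod (g t))) \<partial>lborel)"
    proof (rule nn_integral_mono)
      fix t
      have "norm (k x t * g t) \<le> K * e x t * cmod (g t)"
        using kernel_bound[of x t] by (simp add: e_def norm_mult mult_right_mono)
      also have "\<dots> = K * (d x t * (d x t * cmod (g t)))"
        by (simp add: d_sq[symmetric] power2_eq_square)
      finally have "ennreal (norm (k x t * g t)) \<le> ennreal (K * (d x t * (d x t * cmod (g t))))"
        by (rule ennreal_leI)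
      then show "ennreal (norm (k x t * g t)) \<le> ennreal K * (ennreal (d x t) * ennreal (d x t * cmod (g t)))"
        using K_nonneg by (simp add: ennreal_mult d_def)
    qed
    also have "\<dots> = ennreal K * (\<integral>\<^sup>+t. ennreal (d x t) * ennreal (d x t * cmod (g t)) \<partial>lborel)"
      by (rule nn_integral_cmult) simp
    finally have "(ennreal (cmod (int_op g x)))\<^sup>2 \<le> (ennreal K * (\<integral>\<^sup>+t. ennreal (d x t) * ennreal (d x t * cmod (g t)) \<partial>lborel))\<^sup>2"
      by (rule power_mono) simp
    also have "\<dots> = (ennreal K)\<^sup>2 * (\<integral>\<^sup>+t. ennreal (d x t) * ennreal (d x t * cmod (g t)) \<partial>lborel)\<^sup>2"
      by (rule power_mult_distrib)
    also have "\<dots> \<le> (ennreal K)\<^sup>2 * ((\<integral>\<^sup>+t. (ennreal (d x t))\<^sup>2 \<partial>lborel) * (\<integral>\<^sup>+t. (ennreal (d x t * cmod (g t)))\<^sup>2 \<partial>lborel))"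
      by (intro mult_left_mono Cauchy_Schwarz_nn_integral) auto
    also have "(\<integral>\<^sup>+t. (ennreal (d x t))\<^sup>2 \<partial>lborel) = ennreal (exp_mass a)"
    proof -
      have "(\<integral>\<^sup>+t. (ennreal (d x t))\<^sup>2 \<partial>lborel) = (\<integral>\<^sup>+t. ennreal (e x t) \<partial>lborel)"
        by (rule nn_integral_cong) (simp add: ennreal_power d_nonneg d_sq)
      then show ?thesis
        using nn_integral_exp_dist[OF a, of x] by (simp add: e_def)
    qed
    also have "(\<integral>\<^sup>+t. (ennreal (d x t * cmod (g t)))\<^sup>2 \<partial>lborel) = (\<integral>\<^sup>+t. ennreal (e x t * (cmod (g t))\<^sup>2) \<partial>lborel)"
      by (rule nn_integral_cong) (simp add: ennreal_power d_sq[symmetric] power_mult_distrib d_nonneg)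
    finally show ?thesis
      using K_nonneg exp_mass_nonneg[of a] by (simp add: ennreal_power ennreal_mult mult.assoc)
  qed
  have "(\<integral>\<^sup>+x. ennreal ((cmod (int_op g x))\<^sup>2) \<partial>lborel)
      \<le> (\<integral>\<^sup>+x. ennreal (K\<^sup>2 * exp_mass a) * (\<integral>\<^sup>+t. ennreal (e x t * (cmod (g t))\<^sup>2) \<partial>lborel) \<partial>lborel)"
    by (rule nn_integral_mono) (rule pointwise)
  also have "\<dots> = ennreal (K\<^sup>2 * exp_mass a) * (\<integral>\<^sup>+x. (\<integral>\<^sup>+t. ennreal (e x t * (cmod (g t))\<^sup>2) \<partial>lborel) \<partial>lborel)"
    by (rule nn_integral_cmult) (simp add: e_def)
  also have "(\<integral>\<^sup>+x. (\<integral>\<^sup>+t. ennreal (e x t * (cmod (g t))\<^sup>2) \<partial>lborel) \<partial>lborel)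
      = (\<integral>\<^sup>+t. (\<integral>\<^sup>+x. ennreal (e x t * (cmod (g t))\<^sup>2) \<partial>lborel) \<partial>lborel)"
    by (rule lborel_pair.Fubini') (simp add: e_def case_prod_beta)
  also have "\<dots> = (\<integral>\<^sup>+t. ennreal (exp_mass a) * ennreal ((cmod (g t))\<^sup>2) \<partial>lborel)"
  proof (rule nn_integral_cong)
    fix t
    have "(\<integral>\<^sup>+x. ennreal (e x t * (cmod (g t))\<^sup>2) \<partial>lborel) = (\<integral>\<^sup>+x. ennreal (exp (- (a * \<bar>t - x\<bar>))) * ennreal ((cmod (g t))\<^sup>2) \<partial>lborel)"
      by (rule nn_integral_cong) (simp add: e_def ennreal_mult abs_minus_commute)
    also have "\<dots> = (\<integral>\<^sup>+x. ennreal (exp (- (a * \<bar>t - x\<bar>))) \<partial>lborel) * ennreal ((cmod (g t))\<^sup>2)"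
      by (rule nn_integral_multc) simp
    finally show "(\<integral>\<^sup>+x. ennreal (e x t * (cmod (g t))\<^sup>2) \<partial>lborel) = ennreal (exp_mass a) * ennreal ((cmod (g t))\<^sup>2)"
      by (simp only: nn_integral_exp_dist[OF a])
  qed
  also have "\<dots> = ennreal (exp_mass a) * (\<integral>\<^sup>+t. ennreal ((cmod (g t))\<^sup>2) \<partial>lborel)"
    by (rule nn_integral_cmult) simp
  also have "ennreal (K\<^sup>2 * exp_mass a) * (ennreal (exp_mass a) * (\<integral>\<^sup>+t. ennreal ((cmod (g t))\<^sup>2) \<partial>lborel))
      = ennreal ((K * exp_mass a)\<^sup>2) * (\<integral>\<^sup>+t. ennreal ((cmod (g t))\<^sup>2) \<partial>lborel)"
  proof -
    have "ennreal (K\<^sup>2 * exp_mass a) * ennreal (exp_mass a) = ennreal ((K * exp_mass a)\<^sup>2)"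
      using exp_mass_nonneg[of a] K_nonneg by (subst ennreal_mult[symmetric]) (auto simp: power2_eq_square algebra_simps)
    then show ?thesis
      by (simp only: mult.assoc[symmetric])
  qed
  finally show ?thesis .
qed

lemma square_integrable_int_op:
  assumes g: "square_integrable g"
  shows "square_integrable (int_op g)"
proof (rule square_integrable_nn_integral_finite)
  show "int_op g \<in> borel_measurable lborel"
    using measurable_int_op g by (simp add: square_integrable_def)
  show "(\<integral>\<^sup>+x. ennreal ((cmod (int_op g x))\<^sup>2) \<partial>lborel) < \<infinity>"
    by (rule le_less_trans[OF nn_integral_int_op[OF g]]) (simp add: norm_abs_L2[OF g] ennreal_mult_less_top)
qed

lemma norm_int_op:
  assumes g: "square_integrable g"
  shows "norm (abs_L2 (int_op g)) \<le> K * exp_mass a * norm (abs_L2 g)"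
proof (rule power2_le_imp_le)
  have "ennreal ((norm (abs_L2 (int_op g)))\<^sup>2) \<le> ennreal ((K * exp_mass a)\<^sup>2) * ennreal ((norm (abs_L2 g))\<^sup>2)"
    using nn_integral_int_op[OF g] by (simp only: norm_abs_L2[OF g] norm_abs_L2[OF square_integrable_int_op[OF g]])
  also have "\<dots> = ennreal ((K * exp_mass a * norm (abs_L2 g))\<^sup>2)"
    by (simp add: ennreal_mult[symmetric] power_mult_distrib)
  finally show "(norm (abs_L2 (int_op g)))\<^sup>2 \<le> (K * exp_mass a * norm (abs_L2 g))\<^sup>2"
    by (simp add: ennreal_le_iff)
  show "0 \<le> K * exp_mass a * norm (abs_L2 g)"
    using K_nonneg exp_mass_nonneg[of a] by simp
qed

lemma int_op_cong_AE:
  assumes "square_integrable f" "square_integrable g" "AE t in lborel. f t = g t"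
  shows "int_op f = int_op g"
proof
  fix x
  show "int_op f x = int_op g x"
    unfolding int_op_def
  proof (rule integral_cong_AE)
    show "AE t in lborel. k x t * f t = k x t * g t"
      using assms(3) by eventually_elim simp
  qed (intro borel_measurable_integrable integrable_kernel_mult assms)+
qed

lemma int_op_add:
  "square_integrable f \<Longrightarrow> square_integrable g \<Longrightarrow> int_op (\<lambda>t. f t + g t) x = int_op f x + int_op g x"
  by (simp add: int_op_def distrib_left integrable_kernel_mult)

lemma int_op_scale: "int_op (\<lambda>t. c * f t) x = c * int_op f x"
  unfolding int_op_def mult.left_commute[of _ c] by (rule integral_mult_right_zero)

lemma exp_kernel_norm: "exp_kernel (\<lambda>x t. complex_of_real (cmod (k x t))) K a"
proof
  show "(\<lambda>p. complex_of_real (cmod (k (fst p) (snd p)))) \<in> borel_measurable (borel \<Otimes>\<^sub>M borel)"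
    by (rule measurable_compose[OF measurable_kernel])
      (intro borel_measurable_continuous_onI continuous_intros)
qed (use a kernel_bound in auto)

text \<open>Moves the operator onto the other factor, so that weak derivatives of
  \<open>int_op g\<close> reduce to statements about the kernel with its second variable
  fixed.\<close>

lemma integral_mult_int_op:
  assumes \<eta>: "square_integrable \<eta>" and g: "square_integrable g"
  shows "(LINT x|lborel. \<eta> x * int_op g x) = (LINT t|lborel. (LINT x|lborel. \<eta> x * k x t) * g t)"
    and "integrable lborel (\<lambda>t. (LINT x|lborel. \<eta> x * k x t) * g t)"
proof -
  have \<eta>_meas: "\<eta> \<in> borel_measurable borel" and g_meas: "g \<in> borel_measurable borel"
    using assms by (auto simp: square_integrable_def)
  define k2 where "k2 x t = \<eta> x * (k x t * g t)" for x t
  have meas: "(\<lambda>p. k2 (fst p) (snd p)) \<in> borel_measurable (borel \<Otimes>\<^sub>M borel)"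
    unfolding k2_def
    by (intro borel_measurable_times[OF measurable_compose[OF measurable_fst \<eta>_meas]] measurable_kernel_mult[OF g_meas])
  have sets_eq: "sets (lborel \<Otimes>\<^sub>M lborel) = sets (borel \<Otimes>\<^sub>M borel :: (real \<times> real) measure)"
    by (intro sets_pair_measure_cong) auto
  have meas': "(\<lambda>p. k2 (fst p) (snd p)) \<in> borel_measurable (lborel \<Otimes>\<^sub>M lborel)"
    using meas measurable_cong_sets[OF sets_eq refl] by blast
  \<comment> \<open>The kernel of absolute values satisfies the same bounds, so its operator applied
    to \<open>\<bar>g\<bar>\<close> is square integrable; paired with
    \<open>\<bar>\<eta>\<bar>\<close> it gives the absolute integrability that Fubini asks
    for.\<close>
  interpret abs_kernel: exp_kernel "\<lambda>x t. complex_of_real (cmod (k x t))" K a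
    by (rule exp_kernel_norm)
  have abs_g: "square_integrable (\<lambda>t. complex_of_real (cmod (g t)))"
    and abs_\<eta>: "square_integrable (\<lambda>t. complex_of_real (cmod (\<eta> t)))"
    using g \<eta> by (auto simp: square_integrable_def)
  have "integrable (lborel \<Otimes>\<^sub>M lborel) (\<lambda>(x, t). k2 x t)"
  proof (rule lborel_pair.Fubini_integrable)
    have "integrable lborel (\<lambda>x. complex_of_real (cmod (\<eta> x)) * abs_kernel.int_op (\<lambda>t. complex_of_real (cmod (g t))) x)"
      by (rule integrable_mult_square_integrable[OF abs_\<eta> abs_kernel.square_integrable_int_op[OF abs_g]])
    then have "integrable lborel (\<lambda>x. Re (complex_of_real (cmod (\<eta> x)) * abs_kernel.int_op (\<lambda>t. complex_of_real (cmod (g t))) x))"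
      by (rule integrable_Re)
    also have "(\<lambda>x. Re (complex_of_real (cmod (\<eta> x)) * abs_kernel.int_op (\<lambda>t. complex_of_real (cmod (g t))) x))
        = (\<lambda>x. LINT t|lborel. norm (case (x, t) of (x, t) \<Rightarrow> k2 x t))"
    proof
      fix x
      have "abs_kernel.int_op (\<lambda>t. complex_of_real (cmod (g t))) x = complex_of_real (LINT t|lborel. cmod (k x t) * cmod (g t))"
        unfolding abs_kernel.int_op_def of_real_mult[symmetric] by (rule integral_complex_of_real)
      then show "Re (complex_of_real (cmod (\<eta> x)) * abs_kernel.int_op (\<lambda>t. complex_of_real (cmod (g t))) x)
        = (LINT t|lborel. norm (case (x, t) of (x, t) \<Rightarrow> k2 x t))"
        by (simp add: k2_def norm_mult)
    qed
    finally show "integrable lborel (\<lambda>x. LINT t|lborel. norm (case (x, t) of (x, t) \<Rightarrow> k2 x t))" .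
    show "(\<lambda>(x, t). k2 x t) \<in> borel_measurable (lborel \<Otimes>\<^sub>M lborel)"
      using meas' by (simp add: case_prod_beta)
    show "AE x in lborel. integrable lborel (\<lambda>t. case (x, t) of (x, t) \<Rightarrow> k2 x t)"
      by (simp add: k2_def integrable_kernel_mult[OF g])
  qed
  note int = this
  have inner: "(LINT x|lborel. k2 x t) = (LINT x|lborel. \<eta> x * k x t) * g t" for t
    by (simp add: k2_def mult.assoc[symmetric])
  have "(LINT t|lborel. LINT x|lborel. k2 x t) = (LINT x|lborel. LINT t|lborel. k2 x t)"
    by (rule lborel_pair.Fubini_integral[OF int])
  moreover have "(LINT t|lborel. k2 x t) = \<eta> x * int_op g x" for x
    by (simp add: k2_def int_op_def)
  ultimately show "(LINT x|lborel. \<eta> x * int_op g x) = (LINT t|lborel. (LINT x|lborel. \<eta> x * k x t) * g t)"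
    by (simp add: inner)
  show "integrable lborel (\<lambda>t. (LINT x|lborel. \<eta> x * k x t) * g t)"
    using lborel_pair.integrable_snd[OF int] by (simp add: inner)
qed

end

section \<open>Green's function\<close>

text \<open>The integrand is the derivative of \<open>\<phi> * F\<close>, and the support of
  \<open>\<phi>\<close> removes the boundary term at infinity. \<open>F\<close> need not be
  differentiable at \<open>0\<close>, because it will also be the derivative of a solution. The
  half-lines \<open>t \<le> x\<close> and \<open>x < t\<close> follow the case distinction in
  Green's kernel.\<close>

lemma integral_halfline_test_function:
  assumes \<phi>: "test_function \<phi>" and F_cont: "continuous_on UNIV F"
    and F: "\<forall>x. x \<noteq> 0 \<longrightarrow> (F has_vector_derivative F' x) (at x)"
    and F'_int: "\<And>a b. set_integrable lborel {a..b} F'"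
  shows "integrable lborel (\<lambda>x. complex_of_real (deriv \<phi> x) * F x + complex_of_real (\<phi> x) * F' x)"
    and "(LINT x|lborel. indicator {t..} x *\<^sub>R (complex_of_real (deriv \<phi> x) * F x + complex_of_real (\<phi> x) * F' x)) = - (complex_of_real (\<phi> t) * F t)"
    and "(LINT x|lborel. indicator {..<t} x *\<^sub>R (complex_of_real (deriv \<phi> x) * F x + complex_of_real (\<phi> x) * F' x)) = complex_of_real (\<phi> t) * F t"
proof -
  define H where "H x = complex_of_real (deriv \<phi> x) * F x + complex_of_real (\<phi> x) * F' x" for x
  note \<phi>' = test_function_deriv[OF \<phi>]
  have F_int: "set_integrable lborel {a..b} F" for a b
    unfolding set_integrable_def
    by (rule borel_integrable_compact[OF compact_Icc continuous_on_subset[OF F_cont subset_UNIV]])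
  have H_int: "integrable lborel H"
    unfolding H_def
    by (intro Bochner_Integration.integrable_add set_integrable_mult_test_function F_int F'_int \<phi> \<phi>')
  then show "integrable lborel (\<lambda>x. complex_of_real (deriv \<phi> x) * F x + complex_of_real (\<phi> x) * F' x)"
    by (simp add: H_def[abs_def])
  obtain M1 where M1: "0 < M1" "\<And>x. x \<notin> {-M1..M1} \<Longrightarrow> \<phi> x = 0"
    using test_function_support[OF \<phi>] by blast
  obtain M2 where M2: "0 < M2" "\<And>x. x \<notin> {-M2..M2} \<Longrightarrow> deriv \<phi> x = 0"
    using test_function_support[OF \<phi>'] by blast
  have FTC: "(LINT x|lborel. indicator {a..b} x *\<^sub>R H x) = complex_of_real (\<phi> b) * F b - complex_of_real (\<phi> a) * F a"
    if "a \<le> b" for a b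
  proof -
    have "(H has_integral complex_of_real (\<phi> b) * F b - complex_of_real (\<phi> a) * F a) {a..b}"
    proof (rule fundamental_theorem_of_calculus_interior_strong[of "{0}"])
      show "continuous_on {a..b} (\<lambda>x. complex_of_real (\<phi> x) * F x)"
        by (intro continuous_intros test_function_continuous[OF \<phi>] continuous_on_subset[OF F_cont]) auto
      show "((\<lambda>x. complex_of_real (\<phi> x) * F x) has_vector_derivative H x) (at x)" if "x \<in> {a<..<b} - {0}" for x
      proof -
        have "((\<lambda>x. complex_of_real (\<phi> x) * F x) has_vector_derivative
            complex_of_real (\<phi> x) * F' x + complex_of_real (deriv \<phi> x) * F x) (at x)"
          using that by (intro has_vector_derivative_mult has_vector_derivative_of_real test_function_has_derivative[OF \<phi>] F[rule_format]) auto
        then show ?thesis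
          by (simp add: H_def add.commute)
      qed
    qed (use that in auto)
    then have "integral {a..b} H = complex_of_real (\<phi> b) * F b - complex_of_real (\<phi> a) * F a"
      by (rule integral_unique)
    moreover have "set_integrable lborel {a..b} H"
      using H_int unfolding set_integrable_def by (intro integrable_mult_indicator) auto
    ultimately show ?thesis
      using set_borel_integral_eq_integral(2)[of "{a..b}" H] by (simp add: set_lebesgue_integral_def)
  qed
  define L where "L = M1 + M2 + \<bar>t\<bar>"
  have L: "- L \<le> t" "t \<le> L" "M1 < L" "M2 < L \<or> True"
    using M1(1) M2(1) unfolding L_def by arith+
  have ends: "\<phi> L = 0" "\<phi> (- L) = 0"
    using L(3) M1 by auto
  have outside: "H x = 0" if "x \<notin> {-L..L}" for x
  proof -
    have "x \<notin> {-M1..M1}" "x \<notin> {-M2..M2}"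
      using that M1(1) M2(1) unfolding L_def atLeastAtMost_iff by arith+
    then have "\<phi> x = 0" "deriv \<phi> x = 0"
      using M1(2) M2(2) by blast+
    then show ?thesis
      by (simp add: H_def)
  qed
  have "(LINT x|lborel. indicator {t..} x *\<^sub>R H x) = (LINT x|lborel. indicator {t..L} x *\<^sub>R H x)"
    by (rule Bochner_Integration.integral_cong) (use outside L(1) in \<open>auto simp: indicator_def\<close>)
  then show "(LINT x|lborel. indicator {t..} x *\<^sub>R (complex_of_real (deriv \<phi> x) * F x + complex_of_real (\<phi> x) * F' x)) = - (complex_of_real (\<phi> t) * F t)"
    using FTC[OF L(2)] ends by (simp add: H_def)
  have H_meas: "H \<in> borel_measurable borel"
    using borel_measurable_integrable[OF H_int] by simp
  have "(LINT x|lborel. indicator {..<t} x *\<^sub>R H x) = (LINT x|lborel. indicator {-L..t} x *\<^sub>R H x)"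
  proof (rule integral_cong_AE)
    show "AE x in lborel. indicator {..<t} x *\<^sub>R H x = indicator {-L..t} x *\<^sub>R H x"
      using AE_lborel_singleton[of t]
      by eventually_elim (use outside L(2) in \<open>auto simp: indicator_def\<close>)
  qed (use H_meas in auto)
  then show "(LINT x|lborel. indicator {..<t} x *\<^sub>R (complex_of_real (deriv \<phi> x) * F x + complex_of_real (\<phi> x) * F' x)) = complex_of_real (\<phi> t) * F t"
    using FTC[OF L(1)] ends by (simp add: H_def)
qed

section \<open>Representatives of sums and differences in the operator\<close>

lemma rep_L2_add: "AE x in lborel. rep_L2 (f + g) x = rep_L2 f x + rep_L2 g x"
proof -
  have "f + g = abs_L2 (\<lambda>x. rep_L2 f x + rep_L2 g x)"
    using plus_L2.abs_eq[of "rep_L2 f" "rep_L2 g"]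
    by (simp add: eq_L2_def square_integrable_rep abs_L2_rep_L2)
  then show ?thesis
    using rep_L2_abs_L2[OF square_integrable_add[OF square_integrable_rep square_integrable_rep]] by metis
qed

lemma rep_L2_scaleC: "AE x in lborel. rep_L2 (c *\<^sub>C f) x = c * rep_L2 f x"
proof -
  have "c *\<^sub>C f = abs_L2 (\<lambda>x. c * rep_L2 f x)"
    using scaleC_abs_L2[OF square_integrable_rep, of c f] by (simp add: abs_L2_rep_L2)
  then show ?thesis
    using rep_L2_abs_L2[OF square_integrable_scale[OF square_integrable_rep]] by metis
qed

lemma rep_L2_diff: "AE x in lborel. rep_L2 (f - g) x = rep_L2 f x - rep_L2 g x"
proof -
  have "f - g = abs_L2 (\<lambda>x. rep_L2 f x - rep_L2 g x)"
    using minus_abs_L2[OF square_integrable_rep square_integrable_rep, of f g] by (simp add: abs_L2_rep_L2)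
  then show ?thesis
    using rep_L2_abs_L2[OF square_integrable_diff[OF square_integrable_rep square_integrable_rep]] by metis
qed

lemma has_weak_deriv_diff:
  assumes "has_weak_deriv k f g" "has_weak_deriv k f' g'"
  shows "has_weak_deriv k (f - f') (g - g')"
proof -
  have *: "(LINT x|lborel. complex_of_real (\<phi> x) * rep_L2 (f - f') x) =
      (LINT x|lborel. complex_of_real (\<phi> x) * rep_L2 f x) - (LINT x|lborel. complex_of_real (\<phi> x) * rep_L2 f' x)"
    if \<phi>: "test_function \<phi>" for \<phi> f f'
  proof -
    have \<phi>_sq: "square_integrable (\<lambda>x. complex_of_real (\<phi> x))"
      by (rule square_integrable_test_function[OF \<phi>])
    have int: "integrable lborel (\<lambda>x. complex_of_real (\<phi> x) * rep_L2 h x)" for h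
      by (rule integrable_mult_square_integrable[OF \<phi>_sq square_integrable_rep])
    have "(LINT x|lborel. complex_of_real (\<phi> x) * rep_L2 (f - f') x)
        = (LINT x|lborel. complex_of_real (\<phi> x) * rep_L2 f x - complex_of_real (\<phi> x) * rep_L2 f' x)"
    proof (rule integral_cong_AE)
      show "AE x in lborel. complex_of_real (\<phi> x) * rep_L2 (f - f') x = complex_of_real (\<phi> x) * rep_L2 f x - complex_of_real (\<phi> x) * rep_L2 f' x"
        using rep_L2_diff[of f f'] by eventually_elim (simp add: right_diff_distrib)
    qed (use int[THEN borel_measurable_integrable] in \<open>auto intro: borel_measurable_diff\<close>)
    also have "\<dots> = (LINT x|lborel. complex_of_real (\<phi> x) * rep_L2 f x) - (LINT x|lborel. complex_of_real (\<phi> x) * rep_L2 f' x)"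
      by (rule Bochner_Integration.integral_diff[OF int int])
    finally show ?thesis .
  qed
  show ?thesis
    using assms by (simp add: has_weak_deriv_def * test_function_funpow_deriv right_diff_distrib)
qed

lemma op_A_diff:
  assumes "(y, z) \<in> op_A" "(y', z') \<in> op_A"
  shows "(y - y', z - z') \<in> op_A"
proof -
  obtain w w' where w: "has_weak_deriv 2 y w" "has_weak_deriv 2 y' w'"
    and z: "AE x in lborel. rep_L2 z x =
           complex_of_real (sgn x) * (- rep_L2 w x + complex_of_real (potential x) * rep_L2 y x)"
    and z': "AE x in lborel. rep_L2 z' x =
           complex_of_real (sgn x) * (- rep_L2 w' x + complex_of_real (potential x) * rep_L2 y' x)"
    using assms unfolding op_A_def by blast
  have "y - y' \<in> sobolev 2"
    using assms has_weak_deriv_diff unfolding op_A_def sobolev_def by blast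
  moreover have "AE x in lborel. rep_L2 (z - z') x =
           complex_of_real (sgn x) * (- rep_L2 (w - w') x + complex_of_real (potential x) * rep_L2 (y - y') x)"
    using z z' rep_L2_diff[of z z'] rep_L2_diff[of w w'] rep_L2_diff[of y y']
  proof eventually_elim
    case (elim x)
    show ?case
      unfolding elim by (simp add: algebra_simps)
  qed
  ultimately show ?thesis
    using has_weak_deriv_diff[OF w] by (auto simp: op_A_def)
qed

lemma continuous_imp_set_integrable:
  fixes f :: "real \<Rightarrow> complex"
  shows "continuous_on UNIV f \<Longrightarrow> set_integrable lborel {a..b} f"
  unfolding set_integrable_def
  by (rule borel_integrable_compact[OF compact_Icc continuous_on_subset[OF _ subset_UNIV]])

section \<open>Green's kernel built from two decaying solutions\<close>

text \<open>\<open>p\<close> and \<open>s\<close> solve \<open>A y = z y\<close> and decay at \<open>\<infinity>\<close> and at \<open>- \<infinity>\<close>, respectively.  The equation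
  is required only for \<open>x \<noteq> 0\<close>, because its coefficient jumps at \<open>0\<close>.\<close>

locale decaying_solutions =
  fixes z :: complex and p p' s s' :: "real \<Rightarrow> complex" and h :: "real \<Rightarrow> real" and W :: complex and C a :: real
  assumes p: "\<And>x. (p has_vector_derivative p' x) (at x)" and p'_cont: "continuous_on UNIV p'"
    and s: "\<And>x. (s has_vector_derivative s' x) (at x)" and s'_cont: "continuous_on UNIV s'"
    and p': "\<And>x. x \<noteq> 0 \<Longrightarrow> (p' has_vector_derivative (complex_of_real (potential x) - z * complex_of_real (sgn x)) * p x) (at x)"
    and s': "\<And>x. x \<noteq> 0 \<Longrightarrow> (s' has_vector_derivative (complex_of_real (potential x) - z * complex_of_real (sgn x)) * s x) (at x)"
    and wronskian: "\<And>x. p' x * s x - p x * s' x = W" and W: "W \<noteq> 0"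
    and bounds: "\<And>x. cmod (p x) \<le> C * exp (- h x)" "\<And>x. cmod (p' x) \<le> C * exp (- h x)"
      "\<And>x. cmod (s x) \<le> C * exp (h x)" "\<And>x. cmod (s' x) \<le> C * exp (h x)"
    and a: "0 < a" and h: "\<And>t x. t \<le> x \<Longrightarrow> a * (x - t) \<le> h x - h t"
begin

definition Q :: "real \<Rightarrow> complex" where
  "Q x = complex_of_real (potential x) - z * complex_of_real (sgn x)"

text \<open>Green's function without the factor \<open>- sgn t / W\<close>, which is absorbed into
  \<open>resolvent_source\<close>.\<close>

definition G :: "real \<Rightarrow> real \<Rightarrow> complex" where
  "G x t = (if t \<le> x then p x * s t else s x * p t)"

text \<open>The derivative of \<open>G\<close> in \<open>x\<close> off the diagonal; at
  \<open>x = t\<close> it jumps by the Wronskian \<open>W\<close>.\<close>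

definition G' :: "real \<Rightarrow> real \<Rightarrow> complex" where
  "G' x t = (if t \<le> x then p' x * s t else s' x * p t)"

lemma p_cont: "continuous_on A p"
  using p by (meson continuous_at_imp_continuous_on has_vector_derivative_continuous)

lemma s_cont: "continuous_on A s"
  using s by (meson continuous_at_imp_continuous_on has_vector_derivative_continuous)

lemma measurable_solutions [measurable]:
  "p \<in> borel_measurable borel" "s \<in> borel_measurable borel"
  "p' \<in> borel_measurable borel" "s' \<in> borel_measurable borel"
  by (intro borel_measurable_continuous_onI p_cont s_cont p'_cont s'_cont)+

text \<open>\<open>h\<close> is a common exponent for both solutions: \<open>p\<close> is bounded by
  \<open>exp (- h)\<close>, \<open>s\<close> by \<open>exp h\<close>, and \<open>h\<close> grows at
  rate at least \<open>a\<close>. The product therefore decays in the distance of its arguments.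
  With \<open>f\<close> and \<open>g\<close> left open, the estimate covers both \<open>G\<close>
  and \<open>G'\<close>.\<close>

lemma kernel_estimate:
  assumes "\<And>x. cmod (f x) \<le> C * exp (- h x)" "\<And>x. cmod (g x) \<le> C * exp (h x)"
  shows "cmod (if t \<le> x then f x * s t else g x * p t) \<le> C\<^sup>2 * exp (- (a * \<bar>x - t\<bar>))"
proof -
  have C: "0 \<le> C * exp y" for y
    using order_trans[OF norm_ge_zero bounds(1)[of 0]] by (simp add: zero_le_mult_iff)
  show ?thesis
  proof (cases "t \<le> x")
    case True
    have "cmod (f x) * cmod (s t) \<le> (C * exp (- h x)) * (C * exp (h t))"
      by (intro mult_mono assms bounds C) simp
    also have "\<dots> = C\<^sup>2 * exp (- (h x - h t))"
      by (simp add: power2_eq_square exp_add[symmetric])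
    also have "\<dots> \<le> C\<^sup>2 * exp (- (a * \<bar>x - t\<bar>))"
      using h[OF True] True by (intro mult_left_mono) auto
    finally show ?thesis
      using True by (simp add: norm_mult)
  next
    case False
    have "cmod (g x) * cmod (p t) \<le> (C * exp (h x)) * (C * exp (- h t))"
      by (intro mult_mono assms bounds C) simp
    also have "\<dots> = C\<^sup>2 * exp (- (h t - h x))"
      by (simp add: power2_eq_square exp_add[symmetric])
    also have "\<dots> \<le> C\<^sup>2 * exp (- (a * \<bar>x - t\<bar>))"
      using h[of x t] False by (intro mult_left_mono) auto
    finally show ?thesis
      using False by (simp add: norm_mult)
  qed
qed

sublocale kernel_G: exp_kernel G "C\<^sup>2" a
proof
  show "(\<lambda>x. G (fst x) (snd x)) \<in> borel_measurable (borel \<Otimes>\<^sub>M borel)"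
    unfolding G_def by measurable
  show "cmod (G x t) \<le> C\<^sup>2 * exp (- (a * \<bar>x - t\<bar>))" for x t
    unfolding G_def by (rule kernel_estimate[OF bounds(1,3)])
qed (rule a)

sublocale kernel_G': exp_kernel G' "C\<^sup>2" a
proof
  show "(\<lambda>x. G' (fst x) (snd x)) \<in> borel_measurable (borel \<Otimes>\<^sub>M borel)"
    unfolding G'_def by measurable
  show "cmod (G' x t) \<le> C\<^sup>2 * exp (- (a * \<bar>x - t\<bar>))" for x t
    unfolding G'_def by (rule kernel_estimate[OF bounds(2,4)])
qed (rule a)

lemma set_integrable_Q_mult:
  assumes f: "continuous_on UNIV f"
  shows "set_integrable lborel {l..r} (\<lambda>x. Q x * f x)"
proof -
  have "set_integrable lborel {l..r} (\<lambda>x. complex_of_real (potential x) * f x)"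
    by (intro continuous_imp_set_integrable continuous_intros f)
  moreover have "set_integrable lborel {l..r} (\<lambda>x. z * (complex_of_real (sgn x) * f x))"
  proof -
    have f_int: "set_integrable lborel {l..r} f"
      by (rule continuous_imp_set_integrable[OF f])
    have [measurable]: "f \<in> borel_measurable borel"
      by (rule borel_measurable_continuous_onI[OF f])
    have "set_integrable lborel {l..r} (\<lambda>x. complex_of_real (sgn x) * f x)"
      unfolding set_integrable_def
    proof (rule Bochner_Integration.integrable_bound)
      show "integrable lborel (\<lambda>x. indicator {l..r} x *\<^sub>R f x)"
        using f_int by (simp add: set_integrable_def)
      show "AE x in lborel. norm (indicator {l..r} x *\<^sub>R (complex_of_real (sgn x) * f x)) \<le> norm (indicator {l..r} x *\<^sub>R f x)"
        by (intro AE_I2) (auto simp: norm_mult sgn_if indicator_def)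
    qed measurable
    then show ?thesis
      by simp
  qed
  ultimately have "set_integrable lborel {l..r} (\<lambda>x. complex_of_real (potential x) * f x - z * (complex_of_real (sgn x) * f x))"
    by (rule set_integral_diff)
  then show ?thesis
    by (simp add: Q_def algebra_simps)
qed

lemma square_integrable_Q_mult:
  assumes "square_integrable f"
  shows "square_integrable (\<lambda>x. Q x * f x)"
proof -
  have f_meas [measurable]: "f \<in> borel_measurable borel"
    using assms by (simp add: square_integrable_def)
  have [measurable]: "potential \<in> borel_measurable borel"
    by (intro borel_measurable_continuous_onI continuous_potential)
  have Q_bound: "cmod (Q x) \<le> 12 + cmod z" for x
  proof -
    have "\<bar>potential x\<bar> \<le> 12"
      by (rule order_trans[OF potential_bound]) (simp add: pos_divide_le_eq)
    moreover have "cmod (z * complex_of_real (sgn x)) \<le> cmod z"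
      by (auto simp: norm_mult sgn_if)
    ultimately show ?thesis
      unfolding Q_def using norm_triangle_ineq4[of "complex_of_real (potential x)" "z * complex_of_real (sgn x)"] by simp
  qed
  have "integrable lborel (\<lambda>x. (cmod (Q x * f x))\<^sup>2)"
  proof (rule Bochner_Integration.integrable_bound)
    show "integrable lborel (\<lambda>x. (12 + cmod z)\<^sup>2 * (cmod (f x))\<^sup>2)"
      using assms by (simp add: square_integrable_def)
    have "(cmod (Q x * f x))\<^sup>2 \<le> (12 + cmod z)\<^sup>2 * (cmod (f x))\<^sup>2" for x
      unfolding norm_mult power_mult_distrib by (intro mult_right_mono power_mono Q_bound) auto
    then show "AE x in lborel. norm ((cmod (Q x * f x))\<^sup>2) \<le> norm ((12 + cmod z)\<^sup>2 * (cmod (f x))\<^sup>2)"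
      by (intro AE_I2) simp
    show "(\<lambda>x. (cmod (Q x * f x))\<^sup>2) \<in> borel_measurable lborel"
      unfolding Q_def by measurable
  qed
  then show ?thesis
    by (simp add: square_integrable_def Q_def)
qed

text \<open>In the sense of distributions in \<open>x\<close>: the derivative of \<open>G\<close> is
  \<open>G'\<close>, because \<open>G\<close> is continuous on the diagonal, and the derivative of
  \<open>G'\<close> is \<open>Q G\<close> plus \<open>W\<close> times the point mass at
  \<open>t\<close>, because of the jump there.\<close>

lemma integral_test_function_G:
  assumes \<phi>: "test_function \<phi>"
  shows "(LINT x|lborel. complex_of_real (deriv \<phi> x) * G x t + complex_of_real (\<phi> x) * G' x t) = 0"
    and "(LINT x|lborel. complex_of_real (deriv \<phi> x) * G' x t + complex_of_real (\<phi> x) * (Q x * G x t)) = - W * complex_of_real (\<phi> t)"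
proof -
  have split: "(LINT x|lborel. (if t \<le> x then A x * s t else B x * p t))
      = (LINT x|lborel. indicator {t..} x *\<^sub>R A x) * s t + (LINT x|lborel. indicator {..<t} x *\<^sub>R B x) * p t"
    if "integrable lborel A" "integrable lborel B" for A B
  proof -
    have "(LINT x|lborel. (if t \<le> x then A x * s t else B x * p t))
        = (LINT x|lborel. (indicator {t..} x *\<^sub>R A x) * s t + (indicator {..<t} x *\<^sub>R B x) * p t)"
      by (rule Bochner_Integration.integral_cong) (auto simp: indicator_def)
    also have "\<dots> = (LINT x|lborel. (indicator {t..} x *\<^sub>R A x) * s t) + (LINT x|lborel. (indicator {..<t} x *\<^sub>R B x) * p t)"
      using that by (intro Bochner_Integration.integral_add integrable_mult_left integrable_mult_indicator) auto
    finally show ?thesis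
      by (simp only: integral_mult_left_zero)
  qed
  have deriv: "\<forall>x. x \<noteq> 0 \<longrightarrow> (p has_vector_derivative p' x) (at x)"
    "\<forall>x. x \<noteq> 0 \<longrightarrow> (s has_vector_derivative s' x) (at x)"
    "\<forall>x. x \<noteq> 0 \<longrightarrow> (p' has_vector_derivative Q x * p x) (at x)"
    "\<forall>x. x \<noteq> 0 \<longrightarrow> (s' has_vector_derivative Q x * s x) (at x)"
    using p s p' s' by (auto simp: Q_def)
  note p_line = integral_halfline_test_function[OF \<phi> p_cont deriv(1) continuous_imp_set_integrable[OF p'_cont]]
  note s_line = integral_halfline_test_function[OF \<phi> s_cont deriv(2) continuous_imp_set_integrable[OF s'_cont]]
  note p'_line = integral_halfline_test_function[OF \<phi> p'_cont deriv(3) set_integrable_Q_mult[OF p_cont]]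
  note s'_line = integral_halfline_test_function[OF \<phi> s'_cont deriv(4) set_integrable_Q_mult[OF s_cont]]
  have "(LINT x|lborel. complex_of_real (deriv \<phi> x) * G x t + complex_of_real (\<phi> x) * G' x t)
    = (LINT x|lborel. (if t \<le> x then (complex_of_real (deriv \<phi> x) * p x + complex_of_real (\<phi> x) * p' x) * s t
        else (complex_of_real (deriv \<phi> x) * s x + complex_of_real (\<phi> x) * s' x) * p t))"
    by (rule Bochner_Integration.integral_cong) (auto simp: G_def G'_def algebra_simps)
  also have "\<dots> = 0"
    by (subst split[OF p_line(1) s_line(1)]) (simp add: p_line(2) s_line(3))
  finally show "(LINT x|lborel. complex_of_real (deriv \<phi> x) * G x t + complex_of_real (\<phi> x) * G' x t) = 0" .
  have "(LINT x|lborel. complex_of_real (deriv \<phi> x) * G' x t + complex_of_real (\<phi> x) * (Q x * G x t))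
    = (LINT x|lborel. (if t \<le> x then (complex_of_real (deriv \<phi> x) * p' x + complex_of_real (\<phi> x) * (Q x * p x)) * s t
        else (complex_of_real (deriv \<phi> x) * s' x + complex_of_real (\<phi> x) * (Q x * s x)) * p t))"
    by (rule Bochner_Integration.integral_cong) (auto simp: G_def G'_def algebra_simps)
  also have "\<dots> = - (p' t * s t - p t * s' t) * complex_of_real (\<phi> t)"
    by (subst split[OF p'_line(1) s'_line(1)], unfold p'_line(2) s'_line(3)) (simp add: algebra_simps)
  finally show "(LINT x|lborel. complex_of_real (deriv \<phi> x) * G' x t + complex_of_real (\<phi> x) * (Q x * G x t)) = - W * complex_of_real (\<phi> t)"
    by (simp only: wronskian)
qed

text \<open>Fubini transfers both identities for the kernel to the integral operators:
  \<open>u = kernel_G.int_op g\<close> satisfies \<open>u'' = Q u + W g\<close> weakly.\<close>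

lemma weak_derivs_int_op:
  assumes g: "square_integrable g"
  shows "has_weak_deriv 1 (abs_L2 (kernel_G.int_op g)) (abs_L2 (kernel_G'.int_op g))"
    and "has_weak_deriv 1 (abs_L2 (kernel_G'.int_op g)) (abs_L2 (\<lambda>x. Q x * kernel_G.int_op g x + W * g x))"
proof -
  have sq: "square_integrable (kernel_G.int_op g)" "square_integrable (kernel_G'.int_op g)"
    "square_integrable (\<lambda>x. Q x * kernel_G.int_op g x + W * g x)"
    by (intro kernel_G.square_integrable_int_op kernel_G'.square_integrable_int_op square_integrable_add
        square_integrable_Q_mult square_integrable_scale g)+
  have eq: "(LINT x|lborel. \<eta> x * kernel_G.int_op g x) + (LINT x|lborel. \<zeta> x * kernel_G'.int_op g x)
      = (LINT t|lborel. (LINT x|lborel. \<zeta> x * G' x t + \<eta> x * G x t) * g t)"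
    if \<eta>: "square_integrable \<eta>" and \<zeta>: "square_integrable \<zeta>" for \<eta> \<zeta>
  proof -
    have sec: "square_integrable (\<lambda>x. G x t)" "square_integrable (\<lambda>x. G' x t)" for t
    proof -
      have "(\<lambda>x. G x t) \<in> borel_measurable borel" "(\<lambda>x. G' x t) \<in> borel_measurable borel"
        unfolding G_def G'_def by measurable
      then show "square_integrable (\<lambda>x. G x t)" "square_integrable (\<lambda>x. G' x t)"
        using kernel_G.kernel_bound[of _ t] kernel_G'.kernel_bound[of _ t]
        by (auto intro!: square_integrable_exp_bound[OF a, where x = t and K = "C\<^sup>2"] simp: abs_minus_commute)
    qed
    have outer: "integrable lborel (\<lambda>t. (LINT x|lborel. \<eta> x * G x t) * g t)" "integrable lborel (\<lambda>t. (LINT x|lborel. \<zeta> x * G' x t) * g t)"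
      by (rule kernel_G.integral_mult_int_op(2)[OF \<eta> g] kernel_G'.integral_mult_int_op(2)[OF \<zeta> g])+
    have "(LINT t|lborel. (LINT x|lborel. \<zeta> x * G' x t + \<eta> x * G x t) * g t)
        = (LINT t|lborel. (LINT x|lborel. \<zeta> x * G' x t) * g t + (LINT x|lborel. \<eta> x * G x t) * g t)"
      by (subst Bochner_Integration.integral_add) (auto intro!: integrable_mult_square_integrable sec \<eta> \<zeta> simp: distrib_right)
    also have "\<dots> = (LINT t|lborel. (LINT x|lborel. \<zeta> x * G' x t) * g t) + (LINT t|lborel. (LINT x|lborel. \<eta> x * G x t) * g t)"
      by (rule Bochner_Integration.integral_add[OF outer(2,1)])
    finally show ?thesis
      by (simp add: kernel_G.integral_mult_int_op(1)[OF \<eta> g] kernel_G'.integral_mult_int_op(1)[OF \<zeta> g] add.commute)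
  qed
  show "has_weak_deriv 1 (abs_L2 (kernel_G.int_op g)) (abs_L2 (kernel_G'.int_op g))"
    unfolding has_weak_deriv_abs_L2[OF sq(1,2)]
  proof (intro allI impI)
    fix \<phi> assume \<phi>: "test_function \<phi>"
    note \<phi>_sq = square_integrable_test_function[OF \<phi>] square_integrable_test_function[OF test_function_deriv[OF \<phi>]]
    have "(LINT x|lborel. complex_of_real (deriv \<phi> x) * kernel_G.int_op g x) + (LINT x|lborel. complex_of_real (\<phi> x) * kernel_G'.int_op g x) = 0"
      by (subst eq[OF \<phi>_sq(2,1)]) (simp add: integral_test_function_G(1)[OF \<phi>] add.commute)
    then show "(LINT x|lborel. complex_of_real ((deriv ^^ 1) \<phi> x) * kernel_G.int_op g x)
        = (- 1) ^ 1 * (LINT x|lborel. complex_of_real (\<phi> x) * kernel_G'.int_op g x)"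
      by (simp add: eq_neg_iff_add_eq_0)
  qed
  show "has_weak_deriv 1 (abs_L2 (kernel_G'.int_op g)) (abs_L2 (\<lambda>x. Q x * kernel_G.int_op g x + W * g x))"
    unfolding has_weak_deriv_abs_L2[OF sq(2,3)]
  proof (intro allI impI)
    fix \<phi> assume \<phi>: "test_function \<phi>"
    note \<phi>_sq = square_integrable_test_function[OF \<phi>] square_integrable_test_function[OF test_function_deriv[OF \<phi>]]
    have Q\<phi>: "square_integrable (\<lambda>x. Q x * complex_of_real (\<phi> x))"
      by (rule square_integrable_Q_mult[OF \<phi>_sq(1)])
    have "(LINT x|lborel. (Q x * complex_of_real (\<phi> x)) * kernel_G.int_op g x) + (LINT x|lborel. complex_of_real (deriv \<phi> x) * kernel_G'.int_op g x)
        = (LINT t|lborel. (LINT x|lborel. complex_of_real (deriv \<phi> x) * G' x t + complex_of_real (\<phi> x) * (Q x * G x t)) * g t)"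
      by (subst eq[OF Q\<phi> \<phi>_sq(2)]) (simp add: algebra_simps)
    also have "\<dots> = (LINT t|lborel. - (complex_of_real (\<phi> t) * (W * g t)))"
      unfolding integral_test_function_G(2)[OF \<phi>] by (simp add: algebra_simps)
    also have "\<dots> = - (LINT t|lborel. complex_of_real (\<phi> t) * (W * g t))"
      by (rule integral_minus)
    finally have "(LINT x|lborel. complex_of_real (deriv \<phi> x) * kernel_G'.int_op g x)
        = - ((LINT x|lborel. complex_of_real (\<phi> x) * (Q x * kernel_G.int_op g x)) + (LINT t|lborel. complex_of_real (\<phi> t) * (W * g t)))"
      by (simp add: algebra_simps eq_neg_iff_add_eq_0)
    also have "(LINT x|lborel. complex_of_real (\<phi> x) * (Q x * kernel_G.int_op g x)) + (LINT t|lborel. complex_of_real (\<phi> t) * (W * g t))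
        = (LINT x|lborel. complex_of_real (\<phi> x) * (Q x * kernel_G.int_op g x) + complex_of_real (\<phi> x) * (W * g x))"
      by (rule Bochner_Integration.integral_add[symmetric])
        (intro integrable_mult_square_integrable \<phi>_sq square_integrable_Q_mult sq(1) square_integrable_scale g)+
    finally show "(LINT x|lborel. complex_of_real ((deriv ^^ 1) \<phi> x) * kernel_G'.int_op g x)
        = (- 1) ^ 1 * (LINT x|lborel. complex_of_real (\<phi> x) * (Q x * kernel_G.int_op g x + W * g x))"
      by (simp add: distrib_left)
  qed
qed

section \<open>Uniqueness for the resolvent equation\<close>

lemma square_integrable_half_line:
  assumes "f \<in> borel_measurable borel"
  shows "(\<And>x. cmod (f x) \<le> C * exp (- h x)) \<Longrightarrow> square_integrable (\<lambda>x. complex_of_real (indicator {0..} x) * f x)"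
    and "(\<And>x. cmod (f x) \<le> C * exp (h x)) \<Longrightarrow> square_integrable (\<lambda>x. complex_of_real (indicator {..0} x) * f x)"
proof -
  have C: "0 \<le> C"
    using order_trans[OF norm_ge_zero bounds(1)[of 0]] by (simp add: zero_le_mult_iff)
  show "square_integrable (\<lambda>x. complex_of_real (indicator {0..} x) * f x)"
    if f: "\<And>x. cmod (f x) \<le> C * exp (- h x)"
  proof (rule square_integrable_exp_bound[OF a, where x = 0 and K = "C * exp (- h 0)"])
    fix x
    have "cmod (f x) \<le> C * exp (- h 0) * exp (- (a * \<bar>0 - x\<bar>))" if "0 \<le> x"
    proof -
      have "exp (- h x) \<le> exp (- h 0 + - (a * \<bar>0 - x\<bar>))"
        using h[OF that] that by simp
      then have "C * exp (- h x) \<le> C * (exp (- h 0) * exp (- (a * \<bar>0 - x\<bar>)))"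
        unfolding exp_add by (rule mult_left_mono[OF _ C])
      then show ?thesis
        using f[of x] by (simp add: mult.assoc)
    qed
    then show "cmod (complex_of_real (indicator {0..} x) * f x) \<le> C * exp (- h 0) * exp (- (a * \<bar>0 - x\<bar>))"
      using C by (auto simp: indicator_def)
  qed (use assms in measurable)
  show "square_integrable (\<lambda>x. complex_of_real (indicator {..0} x) * f x)"
    if f: "\<And>x. cmod (f x) \<le> C * exp (h x)"
  proof (rule square_integrable_exp_bound[OF a, where x = 0 and K = "C * exp (h 0)"])
    fix x
    have "cmod (f x) \<le> C * exp (h 0) * exp (- (a * \<bar>0 - x\<bar>))" if "x \<le> 0"
    proof -
      have "exp (h x) \<le> exp (h 0 + - (a * \<bar>0 - x\<bar>))"
        using h[OF that] that by simp
      then have "C * exp (h x) \<le> C * (exp (h 0) * exp (- (a * \<bar>0 - x\<bar>)))"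
        unfolding exp_add by (rule mult_left_mono[OF _ C])
      then show ?thesis
        using f[of x] by (simp add: mult.assoc)
    qed
    then show "cmod (complex_of_real (indicator {..0} x) * f x) \<le> C * exp (h 0) * exp (- (a * \<bar>0 - x\<bar>))"
      using C by (auto simp: indicator_def)
  qed (use assms in measurable)
qed

text \<open>The Wronskian is continuous and has derivative zero off \<open>0\<close>, so it is
  constant. On \<open>A\<close> it is a combination of products of square integrable functions, and
  \<open>A\<close> has infinite measure. Only one half-line is used for each of the two comparison
  solutions, as each is controlled there.\<close>

lemma wronskian_vanishes:
  assumes UV: "square_integrable U" "square_integrable V" "\<And>x. (U has_vector_derivative V x) (at x)" "continuous_on UNIV V"
    "\<And>x. x \<noteq> 0 \<Longrightarrow> (V has_vector_derivative Q x * U x) (at x)"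
    and f: "\<And>x. (f has_vector_derivative f' x) (at x)" "continuous_on UNIV f'"
    "\<And>x. x \<noteq> 0 \<Longrightarrow> (f' has_vector_derivative Q x * f x) (at x)"
    and A: "A \<in> sets borel" "emeasure lborel A = \<infinity>"
    "square_integrable (\<lambda>x. complex_of_real (indicator A x) * f x)" "square_integrable (\<lambda>x. complex_of_real (indicator A x) * f' x)"
  shows "U x * f' x - V x * f x = 0"
proof -
  have cont: "continuous_on UNIV (\<lambda>x. U x * f' x - V x * f x)"
    using UV(3) f(1)
    by (intro continuous_intros UV(4) f(2)) (meson continuous_at_imp_continuous_on has_vector_derivative_continuous)+
  have der: "((\<lambda>x. U x * f' x - V x * f x) has_vector_derivative 0) (at x)" if "x \<noteq> 0" for x
  proof -
    have "((\<lambda>x. U x * f' x - V x * f x) has_vector_derivative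
      (U x * (Q x * f x) + V x * f' x) - (V x * f' x + Q x * U x * f x)) (at x)"
      by (intro has_vector_derivative_diff has_vector_derivative_mult UV f that)
    then show ?thesis
      by (simp add: algebra_simps)
  qed
  have const: "U y * f' y - V y * f y = U x * f' x - V x * f x" for y
    by (rule constant_if_derivative_zero[OF cont der])
  have "integrable lborel (\<lambda>y. U y * (complex_of_real (indicator A y) * f' y) - V y * (complex_of_real (indicator A y) * f y))"
    by (intro Bochner_Integration.integrable_diff integrable_mult_square_integrable UV A)
  also have "(\<lambda>y. U y * (complex_of_real (indicator A y) * f' y) - V y * (complex_of_real (indicator A y) * f y))
      = (\<lambda>y. indicator A y *\<^sub>R (U x * f' x - V x * f x))"
  proof
    fix y
    have "U y * (complex_of_real (indicator A y) * f' y) - V y * (complex_of_real (indicator A y) * f y)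
        = indicator A y *\<^sub>R (U y * f' y - V y * f y)"
      by (simp add: indicator_def)
    then show "U y * (complex_of_real (indicator A y) * f' y) - V y * (complex_of_real (indicator A y) * f y)
        = indicator A y *\<^sub>R (U x * f' x - V x * f x)"
      by (simp only: const[of y])
  qed
  finally show ?thesis
    by (intro constant_set_integrable_imp_0[OF _ A(1,2)]) (simp add: set_integrable_def)
qed

text \<open>The Wronskians of \<open>U\<close> with \<open>p\<close> and with \<open>s\<close>
  vanish, by integrability on the right and on the left half-line. As \<open>p\<close> and
  \<open>s\<close> have Wronskian \<open>W \<noteq> 0\<close>, eliminating \<open>V\<close> leaves
  \<open>U x * W = 0\<close>.\<close>

lemma homogeneous_solution_zero:
  assumes UV: "square_integrable U" "square_integrable V" "\<And>x. (U has_vector_derivative V x) (at x)" "continuous_on UNIV V"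
    "\<And>x. x \<noteq> 0 \<Longrightarrow> (V has_vector_derivative Q x * U x) (at x)"
  shows "U x = 0"
proof -
  have 1: "U x * p' x - V x * p x = 0"
    by (rule wronskian_vanishes[OF UV p p'_cont p'[folded Q_def], where A = "{0..}"])
      (auto simp: emeasure_lborel_halfline intro: square_integrable_half_line(1) bounds)
  have 2: "U x * s' x - V x * s x = 0"
    by (rule wronskian_vanishes[OF UV s s'_cont s'[folded Q_def], where A = "{..0}"])
      (auto simp: emeasure_lborel_halfline intro: square_integrable_half_line(2) bounds)
  have "U x * W = (U x * p' x - V x * p x) * s x - (U x * s' x - V x * s x) * p x"
    unfolding wronskian[of x, symmetric] by (simp add: algebra_simps)
  then show ?thesis
    using 1 2 W by simp
qed

text \<open>Off \<open>0\<close>, the equation \<open>(A - z) u = f\<close> reads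
  \<open>u'' = Q u - sgn f\<close>. The integral operator solves \<open>u'' = Q u + W g\<close>,
  which determines \<open>g\<close>.\<close>

definition resolvent_source :: "L2 \<Rightarrow> real \<Rightarrow> complex" where
  "resolvent_source f t = - (complex_of_real (sgn t) / W) * rep_L2 f t"

definition resolvent :: "L2 \<Rightarrow> L2" where
  "resolvent f = abs_L2 (kernel_G.int_op (resolvent_source f))"

lemma resolvent_source_bound: "cmod (resolvent_source f t) \<le> cmod (1 / W) * cmod (rep_L2 f t)"
  by (auto simp: resolvent_source_def norm_mult norm_divide sgn_if)

lemma square_integrable_resolvent_source: "square_integrable (resolvent_source f)"
proof -
  have [measurable]: "rep_L2 f \<in> borel_measurable borel"
    using square_integrable_rep[of f] by (simp add: square_integrable_def)
  have "integrable lborel (\<lambda>t. (cmod (resolvent_source f t))\<^sup>2)"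
  proof (rule Bochner_Integration.integrable_bound)
    show "integrable lborel (\<lambda>t. (cmod (1 / W))\<^sup>2 * (cmod (rep_L2 f t))\<^sup>2)"
      using square_integrable_rep[of f] by (intro integrable_mult_right) (simp add: square_integrable_def)
    show "AE t in lborel. norm ((cmod (resolvent_source f t))\<^sup>2) \<le> norm ((cmod (1 / W))\<^sup>2 * (cmod (rep_L2 f t))\<^sup>2)"
      using power_mono[OF resolvent_source_bound, of f _ 2] by (intro AE_I2) (simp add: power_mult_distrib)
    show "(\<lambda>t. (cmod (resolvent_source f t))\<^sup>2) \<in> borel_measurable lborel"
      unfolding resolvent_source_def by measurable
  qed
  then show ?thesis
    unfolding square_integrable_def resolvent_source_def by simp
qed

lemma norm_resolvent_source: "norm (abs_L2 (resolvent_source f)) \<le> cmod (1 / W) * norm f"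
proof (rule power2_le_imp_le)
  have f_int: "integrable lborel (\<lambda>t. (cmod (rep_L2 f t))\<^sup>2)"
    using square_integrable_rep[of f] by (simp add: square_integrable_def)
  have "(norm (abs_L2 (resolvent_source f)))\<^sup>2 = (LINT t|lborel. (cmod (resolvent_source f t))\<^sup>2)"
    by (rule norm_abs_L2_integral[OF square_integrable_resolvent_source, symmetric])
  also have "\<dots> \<le> (LINT t|lborel. (cmod (1 / W))\<^sup>2 * (cmod (rep_L2 f t))\<^sup>2)"
  proof (rule integral_mono)
    show "integrable lborel (\<lambda>t. (cmod (resolvent_source f t))\<^sup>2)"
      using square_integrable_resolvent_source[of f] by (simp add: square_integrable_def)
    show "(cmod (resolvent_source f t))\<^sup>2 \<le> (cmod (1 / W))\<^sup>2 * (cmod (rep_L2 f t))\<^sup>2" for t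
      unfolding power_mult_distrib[symmetric] by (rule power_mono[OF resolvent_source_bound]) simp
  qed (intro integrable_mult_right f_int)
  also have "\<dots> = (cmod (1 / W) * norm f)\<^sup>2"
    using norm_abs_L2_integral[OF square_integrable_rep, of f] by (simp add: abs_L2_rep_L2 power_mult_distrib)
  finally show "(norm (abs_L2 (resolvent_source f)))\<^sup>2 \<le> (cmod (1 / W) * norm f)\<^sup>2" .
qed simp

lemma bounded_clinear_resolvent: "bounded_clinear resolvent"
proof -
  note sq = square_integrable_resolvent_source
  note sq_op = kernel_G.square_integrable_int_op[OF sq]
  have add: "resolvent (f + g) = resolvent f + resolvent g" for f g
  proof -
    have "AE t in lborel. resolvent_source (f + g) t = resolvent_source f t + resolvent_source g t"
      using rep_L2_add[of f g] by eventually_elim (simp add: resolvent_source_def algebra_simps)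
    then have "kernel_G.int_op (resolvent_source (f + g)) = kernel_G.int_op (\<lambda>t. resolvent_source f t + resolvent_source g t)"
      by (intro kernel_G.int_op_cong_AE sq square_integrable_add)
    also have "\<dots> = (\<lambda>x. kernel_G.int_op (resolvent_source f) x + kernel_G.int_op (resolvent_source g) x)"
      by (rule ext) (rule kernel_G.int_op_add[OF sq sq])
    finally show ?thesis
      unfolding resolvent_def by (simp add: plus_L2.abs_eq eq_L2_def sq_op)
  qed
  have scale: "resolvent (c *\<^sub>C f) = c *\<^sub>C resolvent f" for c f
  proof -
    have "AE t in lborel. resolvent_source (c *\<^sub>C f) t = c * resolvent_source f t"
      using rep_L2_scaleC[of c f] by eventually_elim (simp add: resolvent_source_def algebra_simps)
    then have "kernel_G.int_op (resolvent_source (c *\<^sub>C f)) = kernel_G.int_op (\<lambda>t. c * resolvent_source f t)"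
      by (intro kernel_G.int_op_cong_AE sq square_integrable_scale)
    also have "\<dots> = (\<lambda>x. c * kernel_G.int_op (resolvent_source f) x)"
      by (rule ext) (rule kernel_G.int_op_scale)
    finally show ?thesis
      unfolding resolvent_def by (simp add: scaleC_abs_L2 sq_op)
  qed
  have "bounded_linear resolvent"
  proof (rule bounded_linear_intro)
    show "resolvent (f + g) = resolvent f + resolvent g" for f g
      by (rule add)
    show "resolvent (r *\<^sub>R f) = r *\<^sub>R resolvent f" for r f
      by (simp add: scaleR_scaleC scale)
    have K: "0 \<le> C\<^sup>2 * exp_mass a"
      using exp_mass_nonneg[of a] by simp
    show "norm (resolvent f) \<le> norm f * (C\<^sup>2 * exp_mass a * cmod (1 / W))" for f
    proof -
      have "norm (resolvent f) \<le> C\<^sup>2 * exp_mass a * norm (abs_L2 (resolvent_source f))"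
        unfolding resolvent_def by (rule kernel_G.norm_int_op[OF sq])
      also have "\<dots> \<le> C\<^sup>2 * exp_mass a * (cmod (1 / W) * norm f)"
        by (rule mult_left_mono[OF norm_resolvent_source K])
      finally show ?thesis
        by (simp only: mult.assoc mult.commute mult.left_commute)
    qed
  qed
  then show ?thesis
    using scale by (simp add: bounded_clinear_def)
qed

lemma resolvent_in_op_A: "(resolvent f, f + z *\<^sub>C resolvent f) \<in> op_A"
proof -
  note sq = square_integrable_resolvent_source[of f]
  let ?u = "kernel_G.int_op (resolvent_source f)"
  have u: "square_integrable ?u"
    by (rule kernel_G.square_integrable_int_op[OF sq])
  have u'': "square_integrable (\<lambda>x. Q x * ?u x + W * resolvent_source f x)"
    by (intro square_integrable_add square_integrable_Q_mult square_integrable_scale u sq)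
  show ?thesis
    unfolding resolvent_def
  proof (rule op_A_I[OF weak_derivs_int_op[OF sq]])
    show "AE x in lborel. rep_L2 (f + z *\<^sub>C abs_L2 ?u) x = complex_of_real (sgn x) *
        (- rep_L2 (abs_L2 (\<lambda>x. Q x * ?u x + W * resolvent_source f x)) x + complex_of_real (potential x) * rep_L2 (abs_L2 ?u) x)"
      using rep_L2_add[of f "z *\<^sub>C abs_L2 ?u"] rep_L2_scaleC[of z "abs_L2 ?u"] rep_L2_abs_L2[OF u] rep_L2_abs_L2[OF u'']
        AE_lborel_singleton[of 0]
    proof eventually_elim
      case (elim x)
      have "complex_of_real (sgn x) * complex_of_real (sgn x) = 1"
        using elim(5) by (simp add: sgn_if)
      then have sgn_sgn: "complex_of_real (sgn x) * (complex_of_real (sgn x) * y) = y" for y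
        by (metis mult.assoc mult_1)
      have eq: "- (Q x * ?u x + W * resolvent_source f x) + complex_of_real (potential x) * ?u x
          = complex_of_real (sgn x) * (rep_L2 f x + z * ?u x)"
        using W by (simp add: Q_def resolvent_source_def algebra_simps)
      show ?case
        unfolding elim(1-4) eq sgn_sgn ..
    qed
  qed
qed

lemma op_A_eigenvector_zero:
  assumes "(d, z *\<^sub>C d) \<in> op_A"
  shows "d = 0"
proof (rule op_A_regular[OF assms])
  fix U V
  assume UV: "square_integrable U" "square_integrable V" "AE x in lborel. rep_L2 d x = U x"
      "\<And>x. (U has_vector_derivative V x) (at x)" "continuous_on UNIV V"
    and V_deriv: "\<And>h x. h \<in> borel_measurable borel \<Longrightarrow> isCont h x \<Longrightarrow>
       AE t in lborel. complex_of_real (potential t) * rep_L2 d t - complex_of_real (sgn t) * rep_L2 (z *\<^sub>C d) t = h t \<Longrightarrow>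
       (V has_vector_derivative h x) (at x)"
  have U_cont: "isCont U x" for x
    using UV(4) by (rule has_vector_derivative_continuous)
  \<comment> \<open>\<open>Q\<close> jumps at \<open>0\<close>, so \<open>V\<close> is
    differentiated only where \<open>Q * U\<close> is continuous; the uniqueness result allows for
    this.\<close>
  have "(V has_vector_derivative Q x * U x) (at x)" if "x \<noteq> 0" for x
  proof (rule V_deriv)
    show "(\<lambda>x. Q x * U x) \<in> borel_measurable borel"
      using square_integrable_Q_mult[OF UV(1)] by (simp add: square_integrable_def)
    have "isCont potential x"
      using continuous_potential[of UNIV] by (simp add: continuous_on_eq_continuous_at)
    then show "isCont (\<lambda>x. Q x * U x) x"
      using U_cont that unfolding Q_def isCont_def by (intro tendsto_intros) auto
    show "AE t in lborel. complex_of_real (potential t) * rep_L2 d t - complex_of_real (sgn t) * rep_L2 (z *\<^sub>C d) t = Q t * U t"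
      using UV(3) rep_L2_scaleC[of z d] by eventually_elim (simp add: Q_def algebra_simps)
  qed
  then have "U x = 0" for x
    by (rule homogeneous_solution_zero[OF UV(1,2,4,5)])
  then have "AE x in lborel. rep_L2 d x = 0"
    using UV(3) by simp
  then have "abs_L2 (rep_L2 d) = 0"
    by (simp add: abs_L2_eq_0_iff[OF square_integrable_rep])
  then show "d = 0"
    by (simp add: abs_L2_rep_L2)
qed

lemma in_resolvent_set: "z \<in> resolvent_set op_A"
proof -
  have "(y, x) \<in> (op_shift op_A z)\<inverse> \<longleftrightarrow> x = resolvent y" for x y
  proof
    assume "(y, x) \<in> (op_shift op_A z)\<inverse>"
    then obtain w where w: "(x, w) \<in> op_A" "y = w - z *\<^sub>C x"
      by (auto simp: op_shift_def)
    \<comment> \<open>Two solutions of \<open>(A - z) x = y\<close> differ by an eigenvector for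
      \<open>z\<close>, and there is none.\<close>
    have "w - (y + z *\<^sub>C resolvent y) = z *\<^sub>C (x - resolvent y)"
      using w(2) by (simp add: complex_vector.scale_right_diff_distrib)
    then have "(x - resolvent y, z *\<^sub>C (x - resolvent y)) \<in> op_A"
      using op_A_diff[OF w(1) resolvent_in_op_A[of y]] by simp
    then show "x = resolvent y"
      using op_A_eigenvector_zero by fastforce
  next
    assume "x = resolvent y"
    then show "(y, x) \<in> (op_shift op_A z)\<inverse>"
      using resolvent_in_op_A[of y] by (force simp: op_shift_def)
  qed
  then have "(op_shift op_A z)\<inverse> = {(y, resolvent y) | y. True}"
    by auto
  then show ?thesis
    using bounded_clinear_resolvent by (auto simp: resolvent_set_def)
qed

end

section \<open>Jost solutions\<close>

lemma has_vector_derivative_gluing: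
  assumes "(f has_vector_derivative d) (at 0)" "(g has_vector_derivative d) (at 0)" "f 0 = g 0"
  shows "((\<lambda>x::real. if 0 \<le> x then f x else g x) has_vector_derivative d) (at 0)"
proof -
  let ?F = "\<lambda>x. if 0 \<le> x then f x else g x"
  have "(?F has_vector_derivative d) (at 0 within {0..})"
    by (rule has_vector_derivative_transform[OF _ _ has_vector_derivative_at_within[OF assms(1)]]) auto
  moreover have "(?F has_vector_derivative d) (at 0 within {..0})"
    by (rule has_vector_derivative_transform[OF _ _ has_vector_derivative_at_within[OF assms(2)]]) (auto simp: assms(3))
  ultimately have "(?F has_vector_derivative d) (at 0 within ({0..} \<union> {..0}))"
    unfolding has_vector_derivative_def has_derivative_within by (blast intro: Lim_Un)
  moreover have "{0..} \<union> {..0} = (UNIV :: real set)"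
    by auto
  ultimately show ?thesis
    by (simp only:)
qed

section \<open>Jost solutions on the half-line\<close>

text \<open>\<open>r1\<close> and \<open>r2\<close> are the building blocks of the Jost solutions on the half-line
  \<open>x \<ge> 0\<close>; only \<open>x > - 1\<close> matters, where \<open>x ^ 3 + 3 > 0\<close>.\<close>

definition r1 :: "real \<Rightarrow> real" where "r1 x = x / (x ^ 3 + 3)"
definition r1' :: "real \<Rightarrow> real" where "r1' x = (3 - 2 * x ^ 3) / (x ^ 3 + 3)\<^sup>2"
definition r2 :: "real \<Rightarrow> real" where "r2 x = x\<^sup>2 / (x ^ 3 + 3)"
definition r2' :: "real \<Rightarrow> real" where "r2' x = (6 * x - x ^ 4) / (x ^ 3 + 3)\<^sup>2"
definition q1 :: "real \<Rightarrow> real" where "q1 x = 6 * (x ^ 4 - 6 * x) / (x ^ 3 + 3)\<^sup>2"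

lemma cube_plus_3_pos:
  assumes "- 1 < x"
  shows "0 < x ^ 3 + (3 :: real)"
proof -
  \<comment> \<open>This product is the factorization of \<open>x ^ 3 + 1\<close>.\<close>
  have "0 < (x + 1) * ((x - 1 / 2)\<^sup>2 + 3 / 4)"
    using assms by (intro mult_pos_pos) (auto intro: add_nonneg_pos)
  then show ?thesis
    by (simp add: algebra_simps power2_eq_square power3_eq_cube)
qed

text \<open>Order by order in \<open>1 / k\<close>, the equation for the Jost factor splits into
  three identities. The last two here are the coefficients of \<open>1 / k\<^sup>2\<close> and
  \<open>1 / k\<close>; the constant term is \<open>q1_r2'\<close>.\<close>

lemma r_deriv:
  assumes "- 1 < x"
  shows "(r1 has_real_derivative r1' x) (at x)" "(r2 has_real_derivative r2' x) (at x)"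
    "(r1' has_real_derivative q1 x * r1 x) (at x)" "(r2' has_real_derivative q1 x * r2 x + 2 * r1' x) (at x)"
proof -
  have nz: "x ^ 3 + 3 \<noteq> 0"
    using cube_plus_3_pos[OF assms] by simp
  define d where "d = x ^ 3 + 3"
  have x3: "x * (x * x) = d - 3"
    by (simp add: d_def power3_eq_cube)
  show "(r1 has_real_derivative r1' x) (at x)"
    unfolding r1_def[abs_def] r1'_def
    by (rule derivative_eq_intros refl nz)+ (simp add: power2_eq_square power3_eq_cube)
  show "(r2 has_real_derivative r2' x) (at x)"
    unfolding r2_def[abs_def] r2'_def
    by (rule derivative_eq_intros refl nz)+ (simp add: power2_eq_square power3_eq_cube power4_eq_xxxx algebra_simps)
  have "(r1' has_real_derivative ((- 2 * (3 * x\<^sup>2)) * (x ^ 3 + 3)\<^sup>2 - (3 - 2 * x ^ 3) * (2 * (x ^ 3 + 3) * (3 * x\<^sup>2))) / ((x ^ 3 + 3)\<^sup>2 * (x ^ 3 + 3)\<^sup>2)) (at x)"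
    unfolding r1'_def[abs_def] using nz
    by (intro DERIV_divide) (auto intro!: derivative_eq_intros)
  also have "((- 2 * (3 * x\<^sup>2)) * (x ^ 3 + 3)\<^sup>2 - (3 - 2 * x ^ 3) * (2 * (x ^ 3 + 3) * (3 * x\<^sup>2))) / ((x ^ 3 + 3)\<^sup>2 * (x ^ 3 + 3)\<^sup>2) = q1 x * r1 x"
    using nz by (simp add: q1_def r1_def divide_simps) algebra
  finally show "(r1' has_real_derivative q1 x * r1 x) (at x)" .
  have "(r2' has_real_derivative ((6 - 4 * x ^ 3) * (x ^ 3 + 3)\<^sup>2 - (6 * x - x ^ 4) * (2 * (x ^ 3 + 3) * (3 * x\<^sup>2))) / ((x ^ 3 + 3)\<^sup>2 * (x ^ 3 + 3)\<^sup>2)) (at x)"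
    unfolding r2'_def[abs_def] using nz
    by (intro DERIV_divide) (auto intro!: derivative_eq_intros)
  also have "((6 - 4 * x ^ 3) * (x ^ 3 + 3)\<^sup>2 - (6 * x - x ^ 4) * (2 * (x ^ 3 + 3) * (3 * x\<^sup>2))) / ((x ^ 3 + 3)\<^sup>2 * (x ^ 3 + 3)\<^sup>2) = q1 x * r2 x + 2 * r1' x"
    using nz by (simp add: q1_def r2_def r1'_def divide_simps) algebra
  finally show "(r2' has_real_derivative q1 x * r2 x + 2 * r1' x) (at x)" .
qed

lemma q1_r2': "q1 x = - 6 * r2' x"
  by (simp add: q1_def r2'_def field_simps)

lemma potential_q1: "potential x = q1 \<bar>x\<bar>"
  by (simp add: potential_def q1_def)

lemma r_bounds:
  assumes "0 \<le> x"
  shows "\<bar>r1 x\<bar> \<le> 1" "\<bar>r2 x\<bar> \<le> 1" "\<bar>r1' x\<bar> \<le> 2" "\<bar>r2' x\<bar> \<le> 2"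
proof -
  have tau: "x ^ 3 + 3 = tau x"
    using assms by (simp add: tau_def)
  have le: "c / (1 + \<bar>x\<bar>) \<le> c" if "0 \<le> c" for c
    using that by (simp add: pos_divide_le_eq distrib_left)
  have "r1 x = y0 x" "r1' x = y0' x"
    using assms by (simp_all only: r1_def y0_def r1'_def y0'_def tau abs_of_nonneg)
  then show "\<bar>r1 x\<bar> \<le> 1" "\<bar>r1' x\<bar> \<le> 2"
    using order_trans[OF y0_bound le] order_trans[OF y0'_bound le] by simp_all
  show "\<bar>r2 x\<bar> \<le> 1"
    using tau_ge(3)[of x] by (simp add: r2_def tau pos_divide_le_eq)
  have "\<bar>potential x\<bar> \<le> 12"
    by (rule order_trans[OF potential_bound le]) simp
  moreover have "potential x = - 6 * r2' x"
    using assms by (simp add: potential_q1 q1_r2')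
  ultimately show "\<bar>r2' x\<bar> \<le> 2"
    by (simp add: abs_mult)
qed

text \<open>The Jost solution comes from \<open>exp (\<i> k x)\<close> by the double Darboux transformation with seeds
  \<open>x\<close> and \<open>x ^ 3 / 6 - 1\<close>, whose Wronskian is \<open>(x ^ 3 + 3) / 3\<close>.\<close>

definition jost_factor :: "complex \<Rightarrow> real \<Rightarrow> complex" where
  "jost_factor k x = 1 + 3 * \<i> / k * complex_of_real (r2 x) - 3 / k\<^sup>2 * complex_of_real (r1 x)"

definition jost_factor' :: "complex \<Rightarrow> real \<Rightarrow> complex" where
  "jost_factor' k x = 3 * \<i> / k * complex_of_real (r2' x) - 3 / k\<^sup>2 * complex_of_real (r1' x)"

definition jost :: "complex \<Rightarrow> real \<Rightarrow> complex" where
  "jost k x = exp (\<i> * k * complex_of_real x) * jost_factor k x"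

definition jost' :: "complex \<Rightarrow> real \<Rightarrow> complex" where
  "jost' k x = exp (\<i> * k * complex_of_real x) * (\<i> * k * jost_factor k x + jost_factor' k x)"

lemma has_vector_derivative_cexp:
  "((\<lambda>x. exp (c * complex_of_real x)) has_vector_derivative c * exp (c * complex_of_real x)) (at x)"
proof -
  have "((\<lambda>w. exp (c * w)) has_field_derivative c * exp (c * complex_of_real x)) (at (complex_of_real x))"
    by (auto intro!: derivative_eq_intros)
  then show ?thesis
    by (rule has_vector_derivative_real_field)
qed

lemma jost_deriv:
  assumes x: "- 1 < x" and k: "k \<noteq> 0"
  shows "(jost k has_vector_derivative jost' k x) (at x)"
    "(jost' k has_vector_derivative (complex_of_real (q1 x) - k\<^sup>2) * jost k x) (at x)"
proof -
  have f: "(jost_factor k has_vector_derivative jost_factor' k x) (at x)"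
  proof -
    have "(jost_factor k has_vector_derivative
      0 + 3 * \<i> / k * complex_of_real (r2' x) - 3 / k\<^sup>2 * complex_of_real (r1' x)) (at x)"
      unfolding jost_factor_def[abs_def]
      by (intro has_vector_derivative_diff has_vector_derivative_add has_vector_derivative_const
          has_vector_derivative_mult_right has_vector_derivative_of_real r_deriv x)
    then show ?thesis
      by (simp add: jost_factor'_def)
  qed
  define f'' where "f'' = 3 * \<i> / k * complex_of_real (q1 x * r2 x + 2 * r1' x) - 3 / k\<^sup>2 * complex_of_real (q1 x * r1 x)"
  have f': "(jost_factor' k has_vector_derivative f'') (at x)"
    unfolding jost_factor'_def[abs_def] f''_def
    by (intro has_vector_derivative_diff has_vector_derivative_mult_right has_vector_derivative_of_real r_deriv x)
  note e = has_vector_derivative_cexp[of "\<i> * k" x]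
  from has_vector_derivative_mult[OF e f]
  show "(jost k has_vector_derivative jost' k x) (at x)"
    by (simp add: jost_def[abs_def] jost'_def algebra_simps)
  \<comment> \<open>The equation \<open>- y'' + q y = k\<^sup>2 y\<close> with the exponential
    factor removed.\<close>
  have "f'' + 2 * (\<i> * k) * jost_factor' k x = complex_of_real (q1 x) * jost_factor k x"
  proof -
    have "f'' + 2 * (\<i> * k) * jost_factor' k x - complex_of_real (q1 x) * jost_factor k x
      = 6 * \<i> / k * complex_of_real (r1' x) - 6 * complex_of_real (r2' x) - 6 * \<i> * k / k\<^sup>2 * complex_of_real (r1' x) - complex_of_real (q1 x)"
      using k by (simp add: f''_def jost_factor'_def jost_factor_def field_simps power2_eq_square)
    also have "\<dots> = 0"
      using k by (simp add: q1_r2' power2_eq_square)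
    finally show ?thesis
      by simp
  qed
  then have eq: "f'' = complex_of_real (q1 x) * jost_factor k x - 2 * (\<i> * k) * jost_factor' k x"
    by (simp add: algebra_simps)
  have "(jost' k has_vector_derivative
      exp (\<i> * k * complex_of_real x) * (\<i> * k * jost_factor' k x + f'') +
      \<i> * k * exp (\<i> * k * complex_of_real x) * (\<i> * k * jost_factor k x + jost_factor' k x)) (at x)"
    unfolding jost'_def[abs_def]
    by (intro has_vector_derivative_mult e has_vector_derivative_add has_vector_derivative_mult_right f f')
  also have "exp (\<i> * k * complex_of_real x) * (\<i> * k * jost_factor' k x + f'') +
      \<i> * k * exp (\<i> * k * complex_of_real x) * (\<i> * k * jost_factor k x + jost_factor' k x)
    = (complex_of_real (q1 x) - k\<^sup>2) * jost k x"
    unfolding eq jost_def by (simp add: algebra_simps power2_eq_square)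
  finally show "(jost' k has_vector_derivative (complex_of_real (q1 x) - k\<^sup>2) * jost k x) (at x)" .
qed

lemma jost_0: "jost k 0 = 1" "jost' k 0 = \<i> * k - 1 / k\<^sup>2"
  by (simp_all add: jost_def jost'_def jost_factor_def jost_factor'_def r1_def r2_def r1'_def r2'_def)

text \<open>Not restricted to the upper half-plane: it is also applied to
  \<open>- k\<^sub>2\<close>, where the right-hand side describes growth.\<close>

lemma jost_bound:
  obtains c where "0 \<le> c" "\<And>x. 0 \<le> x \<Longrightarrow> cmod (jost k x) \<le> c * exp (- Im k * x)"
    "\<And>x. 0 \<le> x \<Longrightarrow> cmod (jost' k x) \<le> c * exp (- Im k * x)"
proof -
  define c1 where "c1 = 1 + cmod (3 * \<i> / k) + cmod (3 / k\<^sup>2)"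
  define c2 where "c2 = 2 * cmod (3 * \<i> / k) + 2 * cmod (3 / k\<^sup>2)"
  have f: "cmod (jost_factor k x) \<le> c1" "cmod (jost_factor' k x) \<le> c2" if "0 \<le> x" for x
  proof -
    note r = r_bounds[OF that]
    have "cmod (jost_factor k x) \<le> cmod (1 + 3 * \<i> / k * complex_of_real (r2 x)) + cmod (3 / k\<^sup>2 * complex_of_real (r1 x))"
      unfolding jost_factor_def by (rule norm_triangle_ineq4)
    also have "\<dots> \<le> 1 + cmod (3 * \<i> / k * complex_of_real (r2 x)) + cmod (3 / k\<^sup>2 * complex_of_real (r1 x))"
      using norm_triangle_ineq[of 1 "3 * \<i> / k * complex_of_real (r2 x)"] by simp
    also have "\<dots> \<le> 1 + cmod (3 * \<i> / k) * 1 + cmod (3 / k\<^sup>2) * 1"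
      unfolding norm_mult[of _ "complex_of_real _"] norm_of_real
      by (intro add_mono mult_left_mono r) auto
    finally show "cmod (jost_factor k x) \<le> c1"
      by (simp add: c1_def)
    have "cmod (jost_factor' k x) \<le> cmod (3 * \<i> / k * complex_of_real (r2' x)) + cmod (3 / k\<^sup>2 * complex_of_real (r1' x))"
      unfolding jost_factor'_def by (rule norm_triangle_ineq4)
    also have "\<dots> \<le> cmod (3 * \<i> / k) * 2 + cmod (3 / k\<^sup>2) * 2"
      unfolding norm_mult[of _ "complex_of_real _"] norm_of_real
      by (intro add_mono mult_left_mono r) auto
    finally show "cmod (jost_factor' k x) \<le> c2"
      by (simp add: c2_def)
  qed
  have c: "0 \<le> c1" "0 \<le> c2"
    by (simp_all add: c1_def c2_def)
  have e: "cmod (exp (\<i> * k * complex_of_real x)) = exp (- Im k * x)" for x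
    by (simp add: norm_exp_eq_Re)
  show ?thesis
  proof (rule that[of "c1 + cmod k * c1 + c2"])
    show "0 \<le> c1 + cmod k * c1 + c2"
      using c by simp
    fix x :: real assume x: "0 \<le> x"
    have "cmod (jost_factor k x) \<le> c1 + cmod k * c1 + c2"
      using f(1)[OF x] c by (simp add: add_increasing2 mult_nonneg_nonneg)
    then show "cmod (jost k x) \<le> (c1 + cmod k * c1 + c2) * exp (- Im k * x)"
      unfolding jost_def norm_mult[of "exp _"] e by (subst mult.commute) (intro mult_right_mono, auto)
    have "cmod (\<i> * k * jost_factor k x + jost_factor' k x) \<le> cmod (\<i> * k * jost_factor k x) + cmod (jost_factor' k x)"
      by (rule norm_triangle_ineq)
    also have "\<dots> \<le> cmod k * c1 + c2"
      unfolding norm_mult using f[OF x] by (intro add_mono mult_mono) auto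
    also have "\<dots> \<le> c1 + cmod k * c1 + c2"
      using c by simp
    finally show "cmod (jost' k x) \<le> (c1 + cmod k * c1 + c2) * exp (- Im k * x)"
      unfolding jost'_def norm_mult[of "exp _"] e by (subst mult.commute) (intro mult_right_mono, auto)
  qed
qed

lemma has_vector_derivative_reflect:
  assumes "(f has_vector_derivative d) (at (- x))"
  shows "((\<lambda>x::real. f (- x)) has_vector_derivative - d) (at x)"
proof -
  have "((uminus :: real \<Rightarrow> real) has_vector_derivative - 1) (at x)"
    by (auto intro!: derivative_eq_intros)
  from vector_diff_chain_at[OF this assms] show ?thesis
    by (simp add: o_def)
qed

section \<open>Continuation across the origin\<close>

text \<open>The continuation of \<open>jost k\<^sub>1\<close> across \<open>0\<close> as a solution of \<open>A y = z y\<close>, where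
  \<open>k\<^sub>1\<^sup>2 = z\<close> and \<open>k\<^sub>2\<^sup>2 = - z\<close>; the coefficients match value and derivative at \<open>0\<close>.\<close>

definition glued :: "complex \<Rightarrow> complex \<Rightarrow> real \<Rightarrow> complex" where
  "glued k\<^sub>1 k\<^sub>2 x = (if 0 \<le> x then jost k\<^sub>1 x else
     (1 - k\<^sub>1 / k\<^sub>2) / 2 * jost k\<^sub>2 (- x) + (1 + k\<^sub>1 / k\<^sub>2) / 2 * jost (- k\<^sub>2) (- x))"

definition glued' :: "complex \<Rightarrow> complex \<Rightarrow> real \<Rightarrow> complex" where
  "glued' k\<^sub>1 k\<^sub>2 x = (if 0 \<le> x then jost' k\<^sub>1 x else
     - ((1 - k\<^sub>1 / k\<^sub>2) / 2 * jost' k\<^sub>2 (- x) + (1 + k\<^sub>1 / k\<^sub>2) / 2 * jost' (- k\<^sub>2) (- x)))"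

text \<open>The two coefficients add up to \<open>1\<close>, which matches the values. On the left
  the derivative at \<open>0\<close> is \<open>\<i> k\<^sub>2\<close> times their difference, that
  is \<open>\<i> k\<^sub>1\<close>, plus \<open>1 / k\<^sub>2\<^sup>2\<close>; since
  \<open>k\<^sub>2\<^sup>2 = - k\<^sub>1\<^sup>2\<close>, this is the derivative
  \<open>\<i> k\<^sub>1 - 1 / k\<^sub>1\<^sup>2\<close> from the right.\<close>

lemma glued_deriv:
  assumes k: "k\<^sub>1 \<noteq> 0" "k\<^sub>2 \<noteq> 0" "k\<^sub>1\<^sup>2 = z" "k\<^sub>2\<^sup>2 = - z"
  shows "(glued k\<^sub>1 k\<^sub>2 has_vector_derivative glued' k\<^sub>1 k\<^sub>2 x) (at x)"
    and "x \<noteq> 0 \<Longrightarrow> (glued' k\<^sub>1 k\<^sub>2 has_vector_derivative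
      (complex_of_real (potential x) - z * complex_of_real (sgn x)) * glued k\<^sub>1 k\<^sub>2 x) (at x)"
    and "continuous_on UNIV (glued' k\<^sub>1 k\<^sub>2)"
proof -
  define \<alpha> \<beta> where "\<alpha> = (1 - k\<^sub>1 / k\<^sub>2) / 2" and "\<beta> = (1 + k\<^sub>1 / k\<^sub>2) / 2"
  define l where "l x = \<alpha> * jost k\<^sub>2 (- x) + \<beta> * jost (- k\<^sub>2) (- x)" for x
  define l' where "l' x = - (\<alpha> * jost' k\<^sub>2 (- x) + \<beta> * jost' (- k\<^sub>2) (- x))" for x
  have glued: "glued k\<^sub>1 k\<^sub>2 = (\<lambda>x. if 0 \<le> x then jost k\<^sub>1 x else l x)"
    and glued': "glued' k\<^sub>1 k\<^sub>2 = (\<lambda>x. if 0 \<le> x then jost' k\<^sub>1 x else l' x)"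
    by (simp_all add: fun_eq_iff glued_def glued'_def l_def l'_def \<alpha>_def \<beta>_def)
  have l: "(l has_vector_derivative l' x) (at x)"
    and l': "(l' has_vector_derivative (complex_of_real (q1 (- x)) + z) * l x) (at x)" if "x < 1" for x
  proof -
    have x: "- 1 < - x" and k2: "- k\<^sub>2 \<noteq> 0"
      using that k(2) by auto
    have "(l has_vector_derivative \<alpha> * - jost' k\<^sub>2 (- x) + \<beta> * - jost' (- k\<^sub>2) (- x)) (at x)"
      unfolding l_def[abs_def]
      by (intro has_vector_derivative_add has_vector_derivative_mult_right has_vector_derivative_reflect
          jost_deriv(1)[OF x k(2)] jost_deriv(1)[OF x k2])
    then show "(l has_vector_derivative l' x) (at x)"
      by (simp add: l'_def)
    have "(l' has_vector_derivative
        - (\<alpha> * - ((complex_of_real (q1 (- x)) - k\<^sub>2\<^sup>2) * jost k\<^sub>2 (- x)) +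
           \<beta> * - ((complex_of_real (q1 (- x)) - (- k\<^sub>2)\<^sup>2) * jost (- k\<^sub>2) (- x)))) (at x)"
      unfolding l'_def[abs_def]
      by (intro has_vector_derivative_minus has_vector_derivative_add has_vector_derivative_mult_right
          has_vector_derivative_reflect jost_deriv(2)[OF x k(2)] jost_deriv(2)[OF x k2])
    then show "(l' has_vector_derivative (complex_of_real (q1 (- x)) + z) * l x) (at x)"
      by (simp add: l_def k(4) algebra_simps)
  qed
  have match: "jost k\<^sub>1 0 = l 0" "jost' k\<^sub>1 0 = l' 0"
  proof -
    show "jost k\<^sub>1 0 = l 0"
      by (simp add: l_def jost_0 \<alpha>_def \<beta>_def field_simps)
    have "l' 0 = \<i> * k\<^sub>2 * (\<beta> - \<alpha>) + (\<alpha> + \<beta>) / k\<^sub>2\<^sup>2"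
      by (simp add: l'_def jost_0 algebra_simps add_divide_distrib)
    also have "\<beta> - \<alpha> = k\<^sub>1 / k\<^sub>2"
      by (simp add: \<alpha>_def \<beta>_def field_simps)
    also have "\<alpha> + \<beta> = 1"
      by (simp add: \<alpha>_def \<beta>_def field_simps)
    finally show "jost' k\<^sub>1 0 = l' 0"
      using k by (simp add: jost_0)
  qed
  show "(glued k\<^sub>1 k\<^sub>2 has_vector_derivative glued' k\<^sub>1 k\<^sub>2 x) (at x)"
  proof -
    consider "x < 0" | "x = 0" | "0 < x"
      by linarith
    then show ?thesis
    proof cases
      case 1
      then show ?thesis
        using has_vector_derivative_transform_within_open[OF l[of x], of "{..<0}" "glued k\<^sub>1 k\<^sub>2"]
        by (auto simp: glued glued')
    next
      case 2
      \<comment> \<open>Both branches continue as differentiable functions beyond \<open>0\<close>,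
        because \<open>jost_deriv\<close> holds on \<open>x > - 1\<close>; so two-sided derivatives
        can be compared.\<close>
      have "(jost k\<^sub>1 has_vector_derivative l' 0) (at 0)" "(l has_vector_derivative l' 0) (at 0)"
        using jost_deriv(1)[of 0 k\<^sub>1] k(1) match(2) l[of 0] by simp_all
      then have "((\<lambda>x. if 0 \<le> x then jost k\<^sub>1 x else l x) has_vector_derivative l' 0) (at 0)"
        by (rule has_vector_derivative_gluing) (rule match(1))
      then show ?thesis
        using 2 match(2) by (simp add: glued glued')
    next
      case 3
      then show ?thesis
        using has_vector_derivative_transform_within_open[OF jost_deriv(1)[of x k\<^sub>1], of "{0<..}" "glued k\<^sub>1 k\<^sub>2"] k
        by (auto simp: glued glued')
    qed
  qed
  show "(glued' k\<^sub>1 k\<^sub>2 has_vector_derivative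
      (complex_of_real (potential x) - z * complex_of_real (sgn x)) * glued k\<^sub>1 k\<^sub>2 x) (at x)" if x: "x \<noteq> 0"
  proof -
    consider "x < 0" | "0 < x"
      using x by linarith
    then show ?thesis
    proof cases
      case 1
      then show ?thesis
        using has_vector_derivative_transform_within_open[OF l'[of x], of "{..<0}" "glued' k\<^sub>1 k\<^sub>2"]
        by (auto simp: glued glued' potential_q1)
    next
      case 2
      then show ?thesis
        using has_vector_derivative_transform_within_open[OF jost_deriv(2)[of x k\<^sub>1], of "{0<..}" "glued' k\<^sub>1 k\<^sub>2"] k
        by (auto simp: glued glued' potential_q1)
    qed
  qed
  have "continuous_on {0..} (jost' k\<^sub>1)"
    by (intro continuous_at_imp_continuous_on ballI has_vector_derivative_continuous[OF jost_deriv(2)[OF _ k(1)]]) auto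
  then have "continuous_on {0..} (glued' k\<^sub>1 k\<^sub>2)"
    by (rule continuous_on_eq) (simp add: glued')
  moreover have "continuous_on {..0} l'"
    by (intro continuous_at_imp_continuous_on ballI has_vector_derivative_continuous[OF l']) auto
  then have "continuous_on {..0} (glued' k\<^sub>1 k\<^sub>2)"
    by (rule continuous_on_eq) (auto simp: glued' match(2))
  ultimately have "continuous_on ({0..} \<union> {..0}) (glued' k\<^sub>1 k\<^sub>2)"
    by (intro continuous_on_closed_Un) auto
  moreover have "{0..} \<union> {..0} = (UNIV :: real set)"
    by auto
  ultimately show "continuous_on UNIV (glued' k\<^sub>1 k\<^sub>2)"
    by (simp only:)
qed

text \<open>The exponent \<open>h\<close> of the locale: its slopes are the imaginary parts of the
  roots of \<open>z\<close> on the right and of \<open>- z\<close> on the left, which differ in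
  general.\<close>

definition decay_rate :: "real \<Rightarrow> real \<Rightarrow> real \<Rightarrow> real" where
  "decay_rate b\<^sub>1 b\<^sub>2 x = (if 0 \<le> x then b\<^sub>1 * x else b\<^sub>2 * x)"

text \<open>To the left of \<open>0\<close> the continuation mixes a decaying and a growing
  exponential. The assumption on \<open>Im k\<^sub>2\<close> says which is which, and the growing
  one bounds both.\<close>

lemma glued_bound:
  assumes k: "0 < Im k\<^sub>2"
  obtains C where "0 \<le> C" "\<And>x. cmod (glued k\<^sub>1 k\<^sub>2 x) \<le> C * exp (- decay_rate (Im k\<^sub>1) (Im k\<^sub>2) x)"
    "\<And>x. cmod (glued' k\<^sub>1 k\<^sub>2 x) \<le> C * exp (- decay_rate (Im k\<^sub>1) (Im k\<^sub>2) x)"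
proof -
  obtain c1 where c1: "0 \<le> c1" "\<And>x. 0 \<le> x \<Longrightarrow> cmod (jost k\<^sub>1 x) \<le> c1 * exp (- Im k\<^sub>1 * x)"
    "\<And>x. 0 \<le> x \<Longrightarrow> cmod (jost' k\<^sub>1 x) \<le> c1 * exp (- Im k\<^sub>1 * x)"
    by (rule jost_bound) blast
  obtain c2 where c2: "0 \<le> c2" "\<And>x. 0 \<le> x \<Longrightarrow> cmod (jost k\<^sub>2 x) \<le> c2 * exp (- Im k\<^sub>2 * x)"
    "\<And>x. 0 \<le> x \<Longrightarrow> cmod (jost' k\<^sub>2 x) \<le> c2 * exp (- Im k\<^sub>2 * x)"
    by (rule jost_bound) blast
  obtain c3 where c3: "0 \<le> c3" "\<And>x. 0 \<le> x \<Longrightarrow> cmod (jost (- k\<^sub>2) x) \<le> c3 * exp (- Im (- k\<^sub>2) * x)"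
    "\<And>x. 0 \<le> x \<Longrightarrow> cmod (jost' (- k\<^sub>2) x) \<le> c3 * exp (- Im (- k\<^sub>2) * x)"
    by (rule jost_bound) blast
  define \<alpha> \<beta> where "\<alpha> = (1 - k\<^sub>1 / k\<^sub>2) / 2" and "\<beta> = (1 + k\<^sub>1 / k\<^sub>2) / 2"
  define C where "C = c1 + cmod \<alpha> * c2 + cmod \<beta> * c3"
  have C: "0 \<le> C" "c1 \<le> C" "cmod \<alpha> * c2 + cmod \<beta> * c3 \<le> C"
    using c1(1) c2(1) c3(1) by (simp_all add: C_def)
  have comb: "cmod (\<alpha> * u + \<beta> * v) \<le> C * exp (- (Im k\<^sub>2 * x))"
    if "x < 0" "cmod u \<le> c2 * exp (- Im k\<^sub>2 * - x)" "cmod v \<le> c3 * exp (- Im (- k\<^sub>2) * - x)" for u v x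
  proof -
    have "Im k\<^sub>2 * x \<le> 0"
      using that(1) k by (simp add: mult_le_0_iff)
    then have "exp (- Im k\<^sub>2 * - x) \<le> exp (- (Im k\<^sub>2 * x))"
      by simp
    then have "c2 * exp (- Im k\<^sub>2 * - x) \<le> c2 * exp (- (Im k\<^sub>2 * x))"
      using c2(1) by (rule mult_left_mono)
    then have u: "cmod u \<le> c2 * exp (- (Im k\<^sub>2 * x))"
      using that(2) by simp
    have v: "cmod v \<le> c3 * exp (- (Im k\<^sub>2 * x))"
      using that(3) by simp
    have "cmod (\<alpha> * u + \<beta> * v) \<le> cmod \<alpha> * cmod u + cmod \<beta> * cmod v"
      by (metis norm_mult norm_triangle_ineq)
    also have "\<dots> \<le> cmod \<alpha> * (c2 * exp (- (Im k\<^sub>2 * x))) + cmod \<beta> * (c3 * exp (- (Im k\<^sub>2 * x)))"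
      by (intro add_mono mult_left_mono u v) auto
    also have "\<dots> = (cmod \<alpha> * c2 + cmod \<beta> * c3) * exp (- (Im k\<^sub>2 * x))"
      by (simp add: algebra_simps)
    also have "\<dots> \<le> C * exp (- (Im k\<^sub>2 * x))"
      by (rule mult_right_mono[OF C(3)]) simp
    finally show ?thesis .
  qed
  have right: "y \<le> c1 * exp (- Im k\<^sub>1 * x) \<Longrightarrow> y \<le> C * exp (- (Im k\<^sub>1 * x))" for y x
    using order_trans[OF _ mult_right_mono[OF C(2) exp_ge_zero], of y "- (Im k\<^sub>1 * x)"] by simp
  show ?thesis
  proof (rule that[OF C(1)])
    fix x
    show "cmod (glued k\<^sub>1 k\<^sub>2 x) \<le> C * exp (- decay_rate (Im k\<^sub>1) (Im k\<^sub>2) x)"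
    proof (cases "0 \<le> x")
      case True
      then show ?thesis
        using right[OF c1(2)] by (simp add: glued_def decay_rate_def)
    next
      case False
      then have "cmod (\<alpha> * jost k\<^sub>2 (- x) + \<beta> * jost (- k\<^sub>2) (- x)) \<le> C * exp (- (Im k\<^sub>2 * x))"
        by (intro comb c2 c3) auto
      then show ?thesis
        using False by (simp add: glued_def decay_rate_def \<alpha>_def \<beta>_def)
    qed
    show "cmod (glued' k\<^sub>1 k\<^sub>2 x) \<le> C * exp (- decay_rate (Im k\<^sub>1) (Im k\<^sub>2) x)"
    proof (cases "0 \<le> x")
      case True
      then show ?thesis
        using right[OF c1(3)] by (simp add: glued'_def decay_rate_def)
    next
      case False
      then have "cmod (\<alpha> * jost' k\<^sub>2 (- x) + \<beta> * jost' (- k\<^sub>2) (- x)) \<le> C * exp (- (Im k\<^sub>2 * x))"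
        by (intro comb c2 c3) auto
      then show ?thesis
        using False unfolding glued'_def decay_rate_def \<alpha>_def \<beta>_def by (simp only: if_False norm_minus_cancel)
    qed
  qed
qed

section \<open>Nonreal points belong to the resolvent set\<close>

lemma square_root_upper_half_plane:
  assumes "z \<notin> \<real>"
  obtains k where "0 < Im k" "k\<^sup>2 = z"
proof -
  define c where "c = csqrt z"
  have c: "c\<^sup>2 = z"
    by (simp add: c_def)
  have "Im c \<noteq> 0"
  proof
    assume "Im c = 0"
    then have "c \<in> \<real>"
      by (simp add: complex_is_Real_iff)
    then show False
      using assms c by (metis Reals_power)
  qed
  then consider "0 < Im c" | "0 < Im (- c)"
    by (auto simp: neq_iff)
  then show ?thesis
    using that[of c] that[of "- c"] c by cases auto
qed

lemma nonreal_in_resolvent_set: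
  assumes "z \<notin> \<real>"
  shows "z \<in> resolvent_set op_A"
proof -
  obtain k\<^sub>1 where k1: "0 < Im k\<^sub>1" "k\<^sub>1\<^sup>2 = z"
    using square_root_upper_half_plane[OF assms] by blast
  have "- z \<notin> \<real>"
    using assms by (metis Reals_minus minus_minus)
  then obtain k\<^sub>2 where k2: "0 < Im k\<^sub>2" "k\<^sub>2\<^sup>2 = - z"
    using square_root_upper_half_plane by blast
  have nz: "k\<^sub>1 \<noteq> 0" "k\<^sub>2 \<noteq> 0"
    using k1(1) k2(1) by auto
  have k1': "k\<^sub>1\<^sup>2 = - (- z)"
    using k1(2) by simp
  define p where "p = glued k\<^sub>1 k\<^sub>2"
  define p' where "p' = glued' k\<^sub>1 k\<^sub>2"
  \<comment> \<open>The reflection \<open>x \<mapsto> - x\<close> turns \<open>z\<close> into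
    \<open>- z\<close>, so the solution decaying on the left is the mirror image of the glued
    solution with the two roots exchanged.\<close>
  define s where "s x = glued k\<^sub>2 k\<^sub>1 (- x)" for x
  define s' where "s' x = - glued' k\<^sub>2 k\<^sub>1 (- x)" for x
  define h where "h = decay_rate (Im k\<^sub>1) (Im k\<^sub>2)"
  define W where "W = \<i> * (k\<^sub>1 + k\<^sub>2)"
  note p_facts = glued_deriv[OF nz k1(2) k2(2), folded p_def p'_def]
  note s_facts = glued_deriv[OF nz(2,1) k2(2) k1']
  have s: "(s has_vector_derivative s' x) (at x)" for x
    unfolding s_def[abs_def] s'_def by (rule has_vector_derivative_reflect[OF s_facts(1)])
  have s'_deriv: "(s' has_vector_derivative (complex_of_real (potential x) - z * complex_of_real (sgn x)) * s x) (at x)"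
    if "x \<noteq> 0" for x
  proof -
    have "(s' has_vector_derivative - (- ((complex_of_real (potential (- x)) - - z * complex_of_real (sgn (- x))) * glued k\<^sub>2 k\<^sub>1 (- x)))) (at x)"
      unfolding s'_def[abs_def]
      by (rule has_vector_derivative_minus[OF has_vector_derivative_reflect[OF s_facts(2)]]) (use that in simp)
    moreover have "potential (- x) = potential x" "sgn (- x) = - sgn x"
      by (simp_all add: potential_def sgn_minus)
    ultimately show ?thesis
      by (simp add: s_def)
  qed
  have s'_cont: "continuous_on UNIV s'"
    unfolding s'_def[abs_def]
    by (intro continuous_on_minus continuous_on_compose2[OF s_facts(3)] continuous_on_id) auto
  have wronskian: "p' x * s x - p x * s' x = W" for x
  proof -
    have "continuous_on UNIV p" "continuous_on UNIV s"
      using p_facts(1) s by (meson continuous_at_imp_continuous_on has_vector_derivative_continuous)+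
    then have "continuous_on UNIV (\<lambda>x. p' x * s x - p x * s' x)"
      by (intro continuous_intros p_facts(3) s'_cont)
    moreover have "((\<lambda>x. p' x * s x - p x * s' x) has_vector_derivative 0) (at x)" if "x \<noteq> 0" for x
    proof -
      define q where "q = complex_of_real (potential x) - z * complex_of_real (sgn x)"
      have "((\<lambda>x. p' x * s x - p x * s' x) has_vector_derivative
          (p' x * s' x + q * p x * s x) - (p x * (q * s x) + p' x * s' x)) (at x)"
        unfolding q_def by (intro has_vector_derivative_diff has_vector_derivative_mult p_facts s s'_deriv that)
      then show ?thesis
        by (simp add: algebra_simps)
    qed
    ultimately have "p' x * s x - p x * s' x = p' 0 * s 0 - p 0 * s' 0"
      by (rule constant_if_derivative_zero)
    \<comment> \<open>At \<open>0\<close> both solutions are \<open>1\<close>, so this is the sum of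
      the derivatives of the two Jost solutions; \<open>1 / k\<^sub>1\<^sup>2\<close> and
      \<open>1 / k\<^sub>2\<^sup>2\<close> cancel.\<close>
    also have "\<dots> = W"
      by (simp add: p_def p'_def s_def s'_def glued_def glued'_def jost_0 k1 k2 W_def algebra_simps)
    finally show ?thesis .
  qed
  have "W \<noteq> 0"
  proof
    assume "W = 0"
    then have "Im (k\<^sub>1 + k\<^sub>2) = 0"
      by (simp add: W_def)
    then show False
      using k1(1) k2(1) by simp
  qed
  obtain C1 where C1: "0 \<le> C1" "\<And>x. cmod (p x) \<le> C1 * exp (- h x)" "\<And>x. cmod (p' x) \<le> C1 * exp (- h x)"
    unfolding p_def p'_def h_def by (rule glued_bound[OF k2(1), of k\<^sub>1]) blast
  obtain C2 where C2: "0 \<le> C2" "\<And>x. cmod (glued k\<^sub>2 k\<^sub>1 x) \<le> C2 * exp (- decay_rate (Im k\<^sub>2) (Im k\<^sub>1) x)"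
    "\<And>x. cmod (glued' k\<^sub>2 k\<^sub>1 x) \<le> C2 * exp (- decay_rate (Im k\<^sub>2) (Im k\<^sub>1) x)"
    by (rule glued_bound[OF k1(1), of k\<^sub>2]) blast
  \<comment> \<open>Reflection and exchange of the roots together change the sign of the exponent,
    so one \<open>h\<close> serves both solutions.\<close>
  have reflect: "- decay_rate (Im k\<^sub>2) (Im k\<^sub>1) (- x) = h x" for x
    by (auto simp: h_def decay_rate_def)
  have le: "y \<le> C1 * exp u \<Longrightarrow> y \<le> (C1 + C2) * exp u" "y \<le> C2 * exp u \<Longrightarrow> y \<le> (C1 + C2) * exp u" for y u
    using mult_nonneg_nonneg[OF C1(1) exp_ge_zero[of u]] mult_nonneg_nonneg[OF C2(1) exp_ge_zero[of u]]
    by (simp_all add: distrib_right)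
  have "decaying_solutions z p p' s s' h W (C1 + C2) (min (Im k\<^sub>1) (Im k\<^sub>2))"
  proof
    show "cmod (p x) \<le> (C1 + C2) * exp (- h x)" "cmod (p' x) \<le> (C1 + C2) * exp (- h x)" for x
      by (intro le(1) C1)+
    show "cmod (s x) \<le> (C1 + C2) * exp (h x)" "cmod (s' x) \<le> (C1 + C2) * exp (h x)" for x
      unfolding s_def s'_def norm_minus_cancel reflect[symmetric] by (intro le(2) C2)+
    show "min (Im k\<^sub>1) (Im k\<^sub>2) * (x - t) \<le> h x - h t" if "t \<le> x" for t x
    proof -
      define m where "m = min (Im k\<^sub>1) (Im k\<^sub>2)"
      have m: "m \<le> Im k\<^sub>1" "m \<le> Im k\<^sub>2"
        by (auto simp: m_def)
      consider "0 \<le> t" | "t < 0" "0 \<le> x" | "x < 0"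
        by linarith
      then have "m * (x - t) \<le> h x - h t"
      proof cases
        case 1
        then show ?thesis
          using mult_right_mono[OF m(1), of "x - t"] that by (simp add: h_def decay_rate_def right_diff_distrib)
      next
        case 2
        show ?thesis
        proof -
          have "m * x \<le> Im k\<^sub>1 * x"
            by (rule mult_right_mono[OF m(1) 2(2)])
          moreover have "Im k\<^sub>2 * t \<le> m * t"
            using 2(1) by (intro mult_right_mono_neg m) simp
          moreover have "h x - h t = Im k\<^sub>1 * x - Im k\<^sub>2 * t"
            using 2 by (simp add: h_def decay_rate_def)
          ultimately show ?thesis
            unfolding right_diff_distrib by linarith
        qed
      next
        case 3
        then show ?thesis
          using mult_right_mono[OF m(2), of "x - t"] that by (simp add: h_def decay_rate_def right_diff_distrib)
      qed
      then show ?thesis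
        by (simp add: m_def)
    qed
  qed (use p_facts s s'_deriv s'_cont wronskian \<open>W \<noteq> 0\<close> k1(1) k2(1) in auto)
  then show ?thesis
    by (rule decaying_solutions.in_resolvent_set)
qed

theorem theorem6p1:
  "spectrum op_A \<subseteq> \<real> \<and>
   simple_eigenvalue op_A 0 \<and>
   \<not> (\<exists>T. self_adjoint T \<and> similar_operators op_A T)"
proof (intro conjI)
  show "spectrum op_A \<subseteq> \<real>"
    using nonreal_in_resolvent_set by (auto simp: spectrum_def)
  show "simple_eigenvalue op_A 0"
    by (rule simple_eigenvalue_0)
  show "\<not> (\<exists>T. self_adjoint T \<and> similar_operators op_A T)"
    by (rule op_A_not_similar_self_adjoint)
qed

end
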